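(* Let $W$ be a random variable with mean $a\in\mathbb{R}$ and variance $\sigma^2\in(0,\infty)$, and suppose that $\sigma^2>a^2$. Let $W^A$, defined on the same probability space as $W$, have the $W$-asymmetric equilibrium distribution and let $Z\sim\mathrm{AL}(0,a,\sqrt{\sigma^2-a^2})$. (i) For any $\beta>0$, $$d_\mathrm{K}(W,Z)\leq \bigg(\frac{14}{\sqrt{2\sigma^2-a^2}}+\frac{7 |a|}{\sigma^2-a^2}\bigg)\beta+\bigg(5+\frac{7|a|}{\sqrt{2\sigma^2-a^2}}\bigg)\mathbb{P}(|W-W^A|>\beta),$$ $$d_\mathrm{K}(W^A,Z)\leq \bigg(\frac{2}{\sqrt{2\sigma^2-a^2}}+\frac{4|a|}{\sigma^2-a^2}\bigg)\beta+\bigg(2+\frac{4|a|}{\sqrt{2\sigma^2-a^2}}\bigg)\mathbb{P}\big(|W-W^A|>\beta\big).$$ Further assume that $\mathbb{E}[|W|^{k+2}]<\infty$ for some $k\geq1$. Then $$d_\mathrm{K}(W,Z)\leq\bigg(\frac{14}{\sqrt{2\sigma^2-a^2}}+\frac{7 |a|}{\sigma^2-a^2}\bigg)^\frac{k}{k+1}\bigg\{(k+k^{-k})\bigg(5+\frac{7|a|}{\sqrt{2\sigma^2-a^2}}\bigg)\mathbb{E}\big[|W-W^A|^k\big]\bigg\}^\frac{1}{k+1}.$$ (ii) Suppose now that $\mathbb{E}\big[|W|^3\big]<\infty$. Then $$d_\mathrm{W}(W,Z)\leq 2\mathbb{E}|W-W^A|,$$ $$d_\mathrm{W}(W^A,Z)\leq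 \bigg(1+\frac{2|a|}{\sqrt{2\sigma^2-a^2}}\bigg)\mathbb{E}|W-W^A|,$$ $$d_\mathrm{K}(W^A,Z)\leq\bigg(\frac{2}{\sqrt{2\sigma^2-a^2}}+\frac{4|a|}{\sigma^2-a^2}\bigg)\mathbb{E}|W-W^A|.$$ (iii) Suppose that $\mathbb{E}[W^4]<\infty$. Then $$d_2(W,Z)\leq\frac{\sigma^2-a^2}{\sqrt{2\sigma^2-a^2}}\mathbb{E}\big[|\mathbb{E}[W-W^A\,|\,W]|\big]+\mathbb{E}\big[(W-W^A)^2\big].$$
   Context: Asymmetric equilibrium distribution: for a random variable $W$ with mean $a\in\mathbb{R}$ and variance $\sigma^2\in(0,\infty)$ with $\sigma^2>a^2$, a random variable $W^A$ has the $W$-asymmetric equilibrium distribution if $$\frac{\sigma^2-a^2}{2}\mathbb{E}\big[f''(W^A)\big]=\mathbb{E}\big[f(W)-f(0)-af'(W)\big]$$ for all functions $f:\mathbb{R}\to\mathbb{R}$ for which $f$ and $f'$ are locally absolutely continuous with $\mathbb{E}|f(W)|,\mathbb{E}|f'(W)|<\infty$. For $a\in\mathbb{R}$, $b>0$, $\mathrm{AL}(0,a,b)$ is the asymmetric Laplace distribution, with characteristic function $\dfrac{1}{1+b^2t^2/2-\mathrm{i}at}$, equivalently density $\dfrac{1}{\sqrt{2b^2+a^2}}\exp\big(\frac{a}{b^2}x-\frac{1}{b}\sqrt{2+\frac{a^2}{b^2}}\,|x|\big)$, $x\in\mathbb{R}$. For a class $\mathcal{H}$ of test functions, $d_{\mathcal{H}}(X,Y)=\sup_{h\in\mathcal{H}}|\mathbb{E}[h(X)]-\mathbb{E}[h(Y)]|$.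 The Kolmogorov distance $d_\mathrm{K}$, Wasserstein distance $d_\mathrm{W}$ and distance $d_2$ correspond respectively to $\mathcal{H}_\mathrm{K}=\{\mathbb{I}_{\cdot\leq z}\,|\,z\in\mathbb{R}\}$, $\mathcal{H}_\mathrm{W}=\{h:\mathbb{R}\to\mathbb{R}\,|\,h\text{ Lipschitz},\ \|h'\|\leq1\}$ and $\mathcal{H}_2=\{h:\mathbb{R}\to\mathbb{R}\,|\,h'\text{ Lipschitz},\ \|h''\|\leq1\}$, where $\|\cdot\|$ is the essential supremum norm on $\mathbb{R}$. *)

theory Defs
  imports "HOL-Probability.Probability"
begin

definition abs_continuous_on :: "real set \<Rightarrow> (real \<Rightarrow> real) \<Rightarrow> bool" where
  "abs_continuous_on S f \<longleftrightarrow>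
     (\<forall>\<epsilon>>0. \<exists>\<delta>>0. \<forall>D :: (real \<times> real) set.
        finite D \<and> (\<forall>(u, v)\<in>D. u \<le> v \<and> {u..v} \<subseteq> S) \<and>
        disjoint_family_on (\<lambda>(u, v). {u<..<v}) D \<and>
        (\<Sum>(u, v)\<in>D. v - u) < \<delta> \<longrightarrow>
        (\<Sum>(u, v)\<in>D. \<bar>f v - f u\<bar>) < \<epsilon>)"

definition locally_abs_continuous :: "(real \<Rightarrow> real) \<Rightarrow> bool" where
  "locally_abs_continuous f \<longleftrightarrow> (\<forall>x y. abs_continuous_on {x..y} f)"

text \<open>
  For f' to be a (locally absolutely continuous) function, f has to be differentiable
  everywhere, whereas f'' exists only Lebesgue-almost everywhere; \<^term>\<open>deriv (deriv f)\<close> takes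
  a fixed arbitrary value on the exceptional null set. This value is immaterial: the identity
  for twice continuously differentiable f with compactly supported f'' already forces the law
  of V to be absolutely continuous.

  The identity is required only where its left-hand side exists. Integrability of f(W) and
  f'(W) does not imply that of f''(V) (take f' = sin h with h growing rapidly), and since the
  Bochner integral of a non-integrable function is 0, an unguarded equation would be
  unsatisfiable for many W.
\<close>
definition has_asym_equilibrium ::
    "'a measure \<Rightarrow> ('a \<Rightarrow> real) \<Rightarrow> 'b measure \<Rightarrow> ('b \<Rightarrow> real) \<Rightarrow> bool" where
  "has_asym_equilibrium M W N V \<longleftrightarrow>
     V \<in> borel_measurable N \<and>
     (let a = prob_space.expectation M W; v = prob_space.variance M W in
      \<forall>f :: real \<Rightarrow> real.
        (\<forall>x. f differentiable (at x)) \<longrightarrow>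
        locally_abs_continuous f \<longrightarrow>
        locally_abs_continuous (deriv f) \<longrightarrow>
        integrable M (\<lambda>\<omega>. f (W \<omega>)) \<longrightarrow>
        integrable M (\<lambda>\<omega>. deriv f (W \<omega>)) \<longrightarrow>
        integrable N (\<lambda>\<omega>. deriv (deriv f) (V \<omega>)) \<longrightarrow>
        (v - a\<^sup>2) / 2 * (\<integral>\<omega>. deriv (deriv f) (V \<omega>) \<partial>N) =
        (\<integral>\<omega>. f (W \<omega>) - f 0 - a * deriv f (W \<omega>) \<partial>M))"

definition asym_laplace_density :: "real \<Rightarrow> real \<Rightarrow> real \<Rightarrow> real" where
  "asym_laplace_density a b x =
     1 / sqrt (2 * b\<^sup>2 + a\<^sup>2) *
     exp (a / b\<^sup>2 * x - 1 / b * sqrt (2 + a\<^sup>2 / b\<^sup>2) * \<bar>x\<bar>)"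

definition asym_laplace_distributed :: "'a measure \<Rightarrow> ('a \<Rightarrow> real) \<Rightarrow> real \<Rightarrow> real \<Rightarrow> bool" where
  "asym_laplace_distributed M Z a b \<longleftrightarrow>
     distributed M lborel Z (\<lambda>x. ennreal (asym_laplace_density a b x))"

definition ess_sup_norm :: "(real \<Rightarrow> real) \<Rightarrow> ereal" where
  "ess_sup_norm g = esssup lborel (\<lambda>x. ereal \<bar>g x\<bar>)"

definition prob_dist ::
    "(real \<Rightarrow> real) set \<Rightarrow> 'a measure \<Rightarrow> ('a \<Rightarrow> real) \<Rightarrow> 'b measure \<Rightarrow> ('b \<Rightarrow> real) \<Rightarrow> ereal" where
  "prob_dist H M X N Y =
     (SUP h\<in>H. ereal \<bar>(\<integral>\<omega>. h (X \<omega>) \<partial>M) - (\<integral>\<omega>. h (Y \<omega>) \<partial>N)\<bar>)"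

definition H_K :: "(real \<Rightarrow> real) set" where
  "H_K = {indicat_real {..z} | z. True}"

definition H_W :: "(real \<Rightarrow> real) set" where
  "H_W = {h. (\<exists>L. L-lipschitz_on UNIV h) \<and> ess_sup_norm (deriv h) \<le> 1}"

definition H_2 :: "(real \<Rightarrow> real) set" where
  "H_2 = {h. (\<forall>x. h differentiable (at x)) \<and> (\<exists>L. L-lipschitz_on UNIV (deriv h)) \<and>
             ess_sup_norm (deriv (deriv h)) \<le> 1}"

abbreviation d_K :: "'a measure \<Rightarrow> ('a \<Rightarrow> real) \<Rightarrow> 'b measure \<Rightarrow> ('b \<Rightarrow> real) \<Rightarrow> ereal" where
  "d_K \<equiv> prob_dist H_K"

abbreviation d_W :: "'a measure \<Rightarrow> ('a \<Rightarrow> real) \<Rightarrow> 'b measure \<Rightarrow> ('b \<Rightarrow> real) \<Rightarrow> ereal" where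
  "d_W \<equiv> prob_dist H_W"

abbreviation d_2 :: "'a measure \<Rightarrow> ('a \<Rightarrow> real) \<Rightarrow> 'b measure \<Rightarrow> ('b \<Rightarrow> real) \<Rightarrow> ereal" where
  "d_2 \<equiv> prob_dist H_2"

text \<open>The conditional expectation given the sigma-algebra generated by a real random variable.\<close>
definition cond_exp_given :: "'a measure \<Rightarrow> ('a \<Rightarrow> real) \<Rightarrow> ('a \<Rightarrow> real) \<Rightarrow> 'a \<Rightarrow> real" where
  "cond_exp_given M X Y = real_cond_exp M (vimage_algebra (space M) X borel) Y"

end

theory Submission
  imports Defs
begin

text \<open>
  The proof is Stein's method with a completely explicit solution of the Stein equation.

  Put \<open>D = sqrt (2 * \<sigma>\<^sup>2 - a\<^sup>2)\<close>, \<open>l = (D - a) / (\<sigma>\<^sup>2 - a\<^sup>2)\<close> and \<open>m = (D + a) / (\<sigma>\<^sup>2 - a\<^sup>2)\<close>. The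
  asymmetric Laplace law is the mixture of an exponential law of rate \<open>l\<close> on the positive half-line
  and a reflected exponential law of rate \<open>m\<close> on the negative one, so the average of \<open>h (x + Z)\<close> is
  the same mixture of a forward average \<open>F x\<close> (of \<open>h (x + u)\<close>, \<open>u\<close> exponential of rate \<open>l\<close>) and a
  backward average \<open>B x\<close> (of \<open>h (x - u)\<close>, \<open>u\<close> exponential of rate \<open>m\<close>). These satisfy the first
  order equations \<open>F' = l * (F - h)\<close> and \<open>B' = m * (h - B)\<close>, which make
  \<open>f x = E[h (Z)] - E[h (x + Z)]\<close> a solution of
  \<open>(\<sigma>\<^sup>2 - a\<^sup>2) / 2 * f'' + a * f' - f = h - E[h (Z)]\<close> with \<open>f 0 = 0\<close> and give closed forms for
  \<open>f'\<close> and \<open>f''\<close> in terms of \<open>h\<close>, \<open>F\<close> and \<open>B\<close>. All bounds on \<open>f\<close> can be read off: if \<open>h\<close> takes values in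
  \<open>[0, 1]\<close>, then \<open>f\<close> oscillates by at most 1, \<open>f'\<close> is bounded by \<open>1 / D\<close> and \<open>f''\<close> by
  \<open>2 / (\<sigma>\<^sup>2 - a\<^sup>2)\<close>; if \<open>h\<close> is 1-Lipschitz, then so is \<open>f\<close>, \<open>f''\<close> is bounded by \<open>2 / D\<close>, and \<open>f''\<close> has
  Lipschitz constant \<open>4 / (\<sigma>\<^sup>2 - a\<^sup>2)\<close>
  (\<open>stein_sol_bounds_of_unit_range\<close>, \<open>stein_sol_bounds_of_lipschitz\<close>).

  Inserting \<open>f\<close> into the identity that characterises the equilibrium distribution eliminates either
  \<open>f''\<close> or the lower order terms (\<open>expectation_diff_WA\<close>, \<open>expectation_diff_W\<close>):
  \<open>E[h (WA)] - E[h (Z)] = E[(f (W) - f (WA)) - a * (f' (W) - f' (WA))]\<close> and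
  \<open>E[h (W)] - E[h (Z)] = (\<sigma>\<^sup>2 - a\<^sup>2) / 2 * E[f'' (W) - f'' (WA)]\<close>.
  The Wasserstein bounds and the Kolmogorov bounds for \<open>WA\<close> follow from the Lipschitz constants of \<open>f\<close>,
  \<open>f'\<close> and \<open>f''\<close>, used everywhere or only on the event \<open>\<bar>W - WA\<bar> \<le> \<beta>\<close>; moments
  of \<open>WA\<close> are controlled by those of \<open>W\<close> through the same identity (\<open>asym_equilibrium_moment\<close>). If \<open>h'\<close> is 1-Lipschitz, \<open>f'''\<close> is the second derivative
  of the Stein solution for \<open>h'\<close>, and a second order Taylor expansion of \<open>f''\<close> at \<open>W\<close> gives the bound on
  \<open>d_2\<close>: the linear term \<open>f''' (W) * (W - WA)\<close> only sees the conditional expectation given \<open>W\<close>.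

  For the Kolmogorov distance only continuous \<open>h\<close> are used: they approximate indicators of
  half-lines while the bounds depend on nothing but their range, and they keep \<open>f''\<close> continuous. The
  distance between \<open>W\<close> and \<open>Z\<close> is then reached by shifting the half-line by \<open>\<beta>\<close>, since the density of
  \<open>Z\<close> is at most \<open>1 / D\<close>. This yields smaller constants than the ones stated (\<open>cdf_diff_W_le\<close>), and the
  moment bound depends on that margin: optimising the stated tail bound over \<open>\<beta>\<close> would leave
  \<open>k powr (1 / (k + 1)) + k powr (- k / (k + 1))\<close> in place of the smaller
  \<open>(k + k powr (- k)) powr (1 / (k + 1))\<close>.

  The classes \<open>H_W\<close> and \<open>H_2\<close> bound derivatives only almost everywhere, so the Lipschitz constant 1
  has to be recovered from that. This rests on the almost everywhere differentiability of Lipschitz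
  functions on the line, which is proved from Vitali's covering theorem.
\<close>

section \<open>Lipschitz functions are differentiable almost everywhere\<close>

text \<open>By Vitali's theorem the fine intervals contain a disjoint family that covers \<open>S\<close> up to a null set and
  stays inside an open set hardly larger than \<open>S\<close>; their images have total length at most \<open>p\<close> times
  theirs, and a Lipschitz map sends the uncovered null set to a null set.\<close>
lemma emeasure_image_le_of_fine_intervals:
  fixes f :: "real \<Rightarrow> real"
  assumes sm: "strict_mono f" and lip: "K-lipschitz_on UNIV f" and "0 \<le> p"
    and S: "S \<in> sets lebesgue" and fS: "f ` S \<in> sets lebesgue"
    and fine: "\<And>x d. x \<in> S \<Longrightarrow> d > 0 \<Longrightarrow>
      \<exists>u v. u < v \<and> v - u < d \<and> u \<le> x \<and> x \<le> v \<and> f v - f u \<le> p * (v - u)"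
  shows "emeasure lebesgue (f ` S) \<le> ennreal p * emeasure lebesgue S"
proof -
  have cont: "continuous_on X f" for X
    using lip continuous_on_subset lipschitz_on_continuous_on by blast
  have img: "f ` {u..v} = {f u..f v}" if "u < v" for u v
  proof -
    have "connected (f ` {u..v})" by (intro connected_continuous_image cont) simp
    moreover have "f u \<in> f ` {u..v}" "f v \<in> f ` {u..v}" using that by auto
    ultimately have "{f u..f v} \<subseteq> f ` {u..v}" by (rule connected_contains_Icc)
    thus ?thesis using sm by (auto simp: strict_mono_less_eq)
  qed
  have main: "emeasure lebesgue (f ` S) \<le> ennreal p * (emeasure lebesgue S + ennreal e)" if "e > 0" for e
  proof -
    obtain U where U: "open U" "S \<subseteq> U" "emeasure lebesgue (U - S) < ennreal e"
      using sets_lebesgue_outer_open[OF S \<open>e > 0\<close>] by metis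
    define J where "J = {(u, v). u < v \<and> {u..v} \<subseteq> U \<and> f v - f u \<le> p * (v - u)}"
    define c where "c = (\<lambda>(u::real, v). (u + v) / 2)"
    define r where "r = (\<lambda>(u::real, v). (v - u) / 2)"
    have cb: "cball (c i) (r i) = {fst i..snd i}" for i
      by (cases i) (auto simp: c_def r_def cball_def dist_real_def abs_if field_simps)
    have fineJ: "\<exists>i. i \<in> J \<and> x \<in> cball (c i) (r i) \<and> r i < d" if "x \<in> S" "0 < d" for x d
    proof -
      obtain \<epsilon> where \<epsilon>: "\<epsilon> > 0" "cball x \<epsilon> \<subseteq> U"
        using open_contains_cball[of U] U(1,2) \<open>x \<in> S\<close> by (metis subsetD)
      obtain u v where uv: "u < v" "v - u < min d \<epsilon>" "u \<le> x" "x \<le> v" "f v - f u \<le> p * (v - u)"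
        using fine[OF \<open>x \<in> S\<close>, of "min d \<epsilon>"] \<epsilon> \<open>0 < d\<close> by auto
      have "{u..v} \<subseteq> cball x \<epsilon>" using uv by (auto simp: dist_real_def)
      hence "(u, v) \<in> J" using uv \<epsilon> by (auto simp: J_def)
      thus ?thesis using uv by (intro exI[of _ "(u, v)"]) (auto simp: cb, auto simp: r_def)
    qed
    have rpos: "0 < r i" if "i \<in> J" for i using that by (auto simp: J_def r_def)
    obtain C where C: "countable C" "C \<subseteq> J"
      "pairwise (\<lambda>i j. disjnt (cball (c i) (r i)) (cball (c j) (r j))) C"
      "negligible (S - (\<Union>i\<in>C. cball (c i) (r i)))"
      by (rule Vitali_covering_theorem_cballs[OF rpos fineJ]) blast+
    define I where "I i = {fst i..snd i}" for i :: "real \<times> real"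
    have disjI: "disjoint_family_on I C"
      using C(3) by (auto simp: disjoint_family_on_def pairwise_def disjnt_def cb I_def)
    have fI: "f ` I i = {f (fst i)..f (snd i)}" if "i \<in> C" for i
    proof -
      have "fst i < snd i" using that C(2) by (auto simp: J_def)
      thus ?thesis using img unfolding I_def by blast
    qed
    have disjfI: "disjoint_family_on (\<lambda>i. f ` I i) C"
    proof -
      have "inj f" using sm by (simp add: strict_mono_imp_inj_on)
      thus ?thesis using disjI unfolding disjoint_family_on_def by (metis image_Int image_empty)
    qed
    have neg: "negligible (f ` (S - (\<Union>i\<in>C. I i)))"
    proof (rule negligible_locally_Lipschitz_image)
      show "negligible (S - (\<Union>i\<in>C. I i))" using C(4) by (simp add: cb I_def)
      show "\<exists>T B. open T \<and> x \<in> T \<and> (\<forall>y\<in>(S - (\<Union>i\<in>C. I i)) \<inter> T. norm (f y - f x) \<le> B * norm (y - x))" for x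
        using lipschitz_on_normD[OF lip] by (intro exI[of _ UNIV] exI[of _ K]) auto
    qed simp
    have "emeasure lebesgue (f ` S) \<le> emeasure lebesgue ((\<Union>i\<in>C. f ` I i) \<union> f ` (S - (\<Union>i\<in>C. I i)))"
    proof (rule emeasure_mono)
      show "f ` S \<subseteq> (\<Union>i\<in>C. f ` I i) \<union> f ` (S - (\<Union>i\<in>C. I i))" by blast
      show "(\<Union>i\<in>C. f ` I i) \<union> f ` (S - (\<Union>i\<in>C. I i)) \<in> sets lebesgue"
        using C(1) fI neg by (intro sets.Un sets.countable_UN') (auto simp: negligible_imp_sets)
    qed
    also have "\<dots> = emeasure lebesgue (\<Union>i\<in>C. f ` I i)"
      using neg C(1) fI by (intro emeasure_Un_null_set) (auto simp: negligible_iff_null_sets intro!: sets.countable_UN')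
    also have "\<dots> = (\<integral>\<^sup>+i. emeasure lebesgue (f ` I i) \<partial>count_space C)"
      using C(1) fI disjfI by (intro emeasure_UN_countable) auto
    also have "\<dots> \<le> (\<integral>\<^sup>+i. ennreal p * emeasure lebesgue (I i) \<partial>count_space C)"
    proof (intro nn_integral_mono)
      fix i assume "i \<in> space (count_space C)"
      hence i: "i \<in> C" "i \<in> J" using C by auto
      hence *: "fst i < snd i" "f (snd i) - f (fst i) \<le> p * (snd i - fst i)"
        by (auto simp: J_def)
      hence "f (fst i) < f (snd i)" using sm by (simp add: strict_mono_less)
      thus "emeasure lebesgue (f ` I i) \<le> ennreal p * emeasure lebesgue (I i)"
        using * \<open>0 \<le> p\<close> unfolding fI[OF i(1)] unfolding I_def
          by (simp add: ennreal_mult[symmetric] ennreal_leI)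
    qed
    also have "\<dots> = ennreal p * (\<integral>\<^sup>+i. emeasure lebesgue (I i) \<partial>count_space C)"
      by (rule nn_integral_cmult) simp
    finally have fS_le: "emeasure lebesgue (f ` S) \<le>
      ennreal p * (\<integral>\<^sup>+i. emeasure lebesgue (I i) \<partial>count_space C)" .
    have "(\<integral>\<^sup>+i. emeasure lebesgue (I i) \<partial>count_space C) = emeasure lebesgue (\<Union>i\<in>C. I i)"
      by (rule emeasure_UN_countable[symmetric]) (use C(1) disjI in \<open>simp_all add: I_def[abs_def]\<close>)
    also have "\<dots> \<le> emeasure lebesgue (S \<union> (U - S))"
    proof (rule emeasure_mono)
      have "I i \<subseteq> U" if "i \<in> C" for i
        using subsetD[OF C(2) that] unfolding I_def J_def by (simp add: case_prod_beta)
      thus "(\<Union>i\<in>C. I i) \<subseteq> S \<union> (U - S)" by blast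
      show "S \<union> (U - S) \<in> sets lebesgue" using U S by auto
    qed
    also have "\<dots> \<le> emeasure lebesgue S + emeasure lebesgue (U - S)"
      using U S by (intro emeasure_subadditive) auto
    also have "\<dots> \<le> emeasure lebesgue S + ennreal e"
      using U(3) by (intro add_left_mono) auto
    finally have "(\<integral>\<^sup>+i. emeasure lebesgue (I i) \<partial>count_space C) \<le> emeasure lebesgue S + ennreal e" .
    thus ?thesis using fS_le mult_left_mono order_trans by (metis zero_le)
  qed
  show ?thesis
  proof (cases "p = 0")
    case True thus ?thesis using main[of 1] by simp
  next
    case False
    show ?thesis
    proof (rule ennreal_le_epsilon)
      fix e :: real assume "e > 0"
      have "emeasure lebesgue (f ` S) \<le> ennreal p * (emeasure lebesgue S + ennreal (e / p))"
        using main[of "e / p"] \<open>e > 0\<close> False \<open>0 \<le> p\<close> by auto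
      also have "\<dots> = ennreal p * emeasure lebesgue S + ennreal e"
        using False \<open>0 \<le> p\<close> \<open>e > 0\<close> by (simp add: distrib_left ennreal_mult[symmetric])
      finally show "emeasure lebesgue (f ` S) \<le> ennreal p * emeasure lebesgue S + ennreal e" .
    qed
  qed
qed

lemma frequently_slope_imp_interval:
  fixes f :: "real \<Rightarrow> real"
  assumes "\<exists>\<^sub>F t in at 0. P ((f (x + t) - f x) / t)" "d > 0"
  shows "\<exists>u v. u < v \<and> v - u < d \<and> u \<le> x \<and> x \<le> v \<and> P ((f v - f u) / (v - u))"
proof -
  obtain t where t: "t \<noteq> 0" "\<bar>t\<bar> < d" "P ((f (x + t) - f x) / t)"
    using assms unfolding frequently_at by auto
  show ?thesis
  proof (cases "t > 0")
    case True thus ?thesis using t by (intro exI[of _ x] exI[of _ "x + t"]) auto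
  next
    case False
    hence "(f (x + t) - f x) / t = (f x - f (x + t)) / (x - (x + t))"
      using t by (simp add: field_simps)
    thus ?thesis using t False by (intro exI[of _ "x + t"] exI[of _ x]) auto
  qed
qed

text \<open>For a fixed increment the condition on the slope is open in \<open>x\<close>, so the set is a countable
  intersection of open sets.\<close>
lemma borel_frequently_slope:
  fixes f :: "real \<Rightarrow> real"
  assumes cont: "continuous_on UNIV f" and P: "open {y. P y}"
  shows "{x. \<exists>\<^sub>F t in at 0. P ((f (x + t) - f x) / t)} \<in> sets borel"
proof -
  have c: "continuous_on UNIV (\<lambda>x. (f (x + t) - f x) / t)" for t
    unfolding divide_inverse by (intro continuous_intros continuous_on_compose2[OF cont]) auto
  have op: "open {x. P ((f (x + t) - f x) / t)}" for t
  proof -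
    have "{x. P ((f (x + t) - f x) / t)} = (\<lambda>x. (f (x + t) - f x) / t) -` {y. P y}" by auto
    thus ?thesis using open_vimage[OF P c] by simp
  qed
  have "{x. \<exists>\<^sub>F t in at 0. P ((f (x + t) - f x) / t)} =
    (\<Inter>n. \<Union>t\<in>{t. t \<noteq> 0 \<and> \<bar>t\<bar> < 1 / real (Suc n)}. {x. P ((f (x + t) - f x) / t)})"
    (is "?L = ?R")
  proof
    show "?L \<subseteq> ?R" by (fastforce simp: frequently_at)
    show "?R \<subseteq> ?L"
    proof (clarsimp simp: frequently_at)
      fix x d :: real assume *: "\<forall>n. \<exists>t. t \<noteq> 0 \<and> \<bar>t\<bar> < 1 / (1 + real n) \<and> P ((f (x + t) - f x) / t)" and "d > 0"
      obtain n where "1 / real (Suc n) < d" using \<open>d > 0\<close> by (meson nat_approx_posE)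
      thus "\<exists>t. t \<noteq> 0 \<and> \<bar>t\<bar> < d \<and> P ((f (x + t) - f x) / t)"
        using *[rule_format, of n] by (auto intro: less_trans)
    qed
  qed
  moreover have "?R \<in> sets borel"
  proof (intro sets.countable_INT'' borel_open)
    show "open (\<Union>t\<in>{t. t \<noteq> 0 \<and> \<bar>t\<bar> < 1 / real (Suc n)}. {x. P ((f (x + t) - f x) / t)})" for n
      using op by blast
  qed simp_all
  ultimately show ?thesis by simp
qed

text \<open>The function \<open>f\<close> is a bi-Lipschitz homeomorphism of the line. Where arbitrarily short intervals have slope
  below \<open>p\<close>, \<open>f\<close> expands measure by at most \<open>p\<close>; where they have slope above \<open>q\<close>, the same statement
  for the inverse of \<open>f\<close> shows that \<open>f\<close> expands measure by at least \<open>q\<close>. Both hold on the same set, and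
  \<open>p < q\<close>.\<close>
lemma negligible_slope_oscillation:
  fixes f :: "real \<Rightarrow> real"
  assumes lo: "\<And>x y. x \<le> y \<Longrightarrow> y - x \<le> f y - f x" and up: "\<And>x y. x \<le> y \<Longrightarrow> f y - f x \<le> K * (y - x)"
    and pq: "0 < p" "p < q"
  shows "negligible {x. (\<exists>\<^sub>F t in at 0. (f (x + t) - f x) / t < p) \<and> (\<exists>\<^sub>F t in at 0. (f (x + t) - f x) / t > q)}"
    (is "negligible ?E")
proof -
  have sm: "strict_mono f"
  proof (rule strict_monoI)
    show "f x < f y" if "x < y" for x y using lo[of x y] that by simp
  qed
  have absd: "\<bar>x - y\<bar> \<le> \<bar>f x - f y\<bar>" "\<bar>f x - f y\<bar> \<le> K * \<bar>x - y\<bar>" for x y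
    using lo[of x y] lo[of y x] up[of x y] up[of y x] by (cases "x \<le> y"; simp add: abs_if algebra_simps)+
  have "0 \<le> K" using absd[of 0 1] by simp
  have lip: "K-lipschitz_on UNIV f"
    using absd \<open>0 \<le> K\<close> by (intro lipschitz_onI) (auto simp: dist_real_def)
  have cont: "continuous_on X f" for X
    using lip continuous_on_subset lipschitz_on_continuous_on by blast
  have "surj f"
  proof -
    have "\<exists>x. f x = y" for y
    proof -
      define m where "m = \<bar>y - f 0\<bar>"
      have "\<exists>x. - m \<le> x \<and> x \<le> m \<and> f x = y"
        using lo[of 0 m] lo[of "- m" 0] by (intro IVT' cont) (auto simp: m_def)
      thus ?thesis by blast
    qed
    thus ?thesis by (metis surjI)
  qed
  define g where "g = inv f"
  have "bij f" using \<open>surj f\<close> sm by (simp add: bij_def strict_mono_imp_inj_on)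
  have gf: "g (f x) = x" and fg: "f (g y) = y" for x y
    unfolding g_def using \<open>bij f\<close> by (simp_all add: bij_is_inj bij_is_surj surj_f_inv_f)
  have lipg: "1-lipschitz_on UNIV g"
    using absd(1)[of "g _" "g _"] by (intro lipschitz_onI) (auto simp: dist_real_def fg)
  have contg: "continuous_on UNIV g" using lipg lipschitz_on_continuous_on by blast
  have smg: "strict_mono g"
    by (rule strict_monoI) (metis fg sm strict_mono_less)
  have Eb: "?E \<in> sets borel"
    using borel_frequently_slope[OF cont, of "\<lambda>y. y < p"] borel_frequently_slope[OF cont, of "\<lambda>y. y > q"]
    by (auto simp: Collect_conj_eq lessThan_def[symmetric] greaterThan_def[symmetric] intro!: sets.Int)
  have "negligible (?E \<inter> {- real n..real n})" for n
  proof -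
    define S where "S = ?E \<inter> {- real n..real n}"
    have Sb: "S \<in> sets borel" using Eb by (auto simp: S_def)
    have fS: "f ` S = g -` S \<inter> space borel"
      by (auto simp: gf intro: rev_image_eqI[of "g _"] simp: fg)
    have fSb: "f ` S \<in> sets borel"
      unfolding fS using contg by (intro measurable_sets[OF _ Sb] borel_measurable_continuous_onI) auto
    have fin: "emeasure lebesgue S < \<infinity>"
    proof -
      have "emeasure lebesgue S \<le> emeasure lebesgue {- real n..real n}"
        by (intro emeasure_mono) (auto simp: S_def)
      also have "\<dots> < \<infinity>" by simp
      finally show ?thesis .
    qed
    have 1: "emeasure lebesgue (f ` S) \<le> ennreal p * emeasure lebesgue S"
    proof (rule emeasure_image_le_of_fine_intervals[OF sm lip])
      fix x d :: real assume "x \<in> S" "d > 0"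
      then obtain u v where "u < v" "v - u < d" "u \<le> x" "x \<le> v" "(f v - f u) / (v - u) < p"
        using frequently_slope_imp_interval[of "\<lambda>y. y < p" f x d] by (auto simp: S_def)
      thus "\<exists>u v. u < v \<and> v - u < d \<and> u \<le> x \<and> x \<le> v \<and> f v - f u \<le> p * (v - u)"
        by (intro exI[of _ u] exI[of _ v]) (auto simp: field_simps)
    qed (use pq Sb fSb in auto)
    have 2: "emeasure lebesgue (g ` (f ` S)) \<le> ennreal (1 / q) * emeasure lebesgue (f ` S)"
    proof (rule emeasure_image_le_of_fine_intervals[OF smg lipg])
      fix y d :: real assume "y \<in> f ` S" "d > 0"
      then obtain x where x: "x \<in> S" "y = f x" by auto
      then obtain u v where uv: "u < v" "v - u < d / (K + 1)" "u \<le> x" "x \<le> v" "(f v - f u) / (v - u) > q"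
        using frequently_slope_imp_interval[of "\<lambda>y. y > q" f x "d / (K + 1)"] \<open>0 \<le> K\<close> \<open>d > 0\<close> by (auto simp: S_def)
      have "f v - f u \<le> K * (v - u)" using up uv by simp
      also have "\<dots> \<le> (K + 1) * (v - u)" using uv by (simp add: algebra_simps)
      also have "\<dots> < d" using uv \<open>0 \<le> K\<close> by (simp add: field_simps)
      finally have "f v - f u < d" .
      moreover have "g (f v) - g (f u) \<le> 1 / q * (f v - f u)"
        using uv pq by (simp add: gf field_simps)
      ultimately show "\<exists>u v. u < v \<and> v - u < d \<and> u \<le> y \<and> y \<le> v \<and> g v - g u \<le> 1 / q * (v - u)"
        using uv sm x by (intro exI[of _ "f u"] exI[of _ "f v"]) (auto simp: strict_mono_less strict_mono_less_eq)
    qed (use pq Sb fSb in \<open>auto simp: image_image gf\<close>)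
    have "emeasure lebesgue S \<le> ennreal (1 / q) * (ennreal p * emeasure lebesgue S)"
      using 2 mult_left_mono[OF 1, of "ennreal (1 / q)"] by (simp add: image_image gf)
    moreover obtain m where m: "emeasure lebesgue S = ennreal m" "m \<ge> 0"
      using fin by (metis ennreal_cases infinity_ennreal_def less_irrefl)
    ultimately have "m \<le> 1 / q * (p * m)"
      using pq by (simp add: ennreal_mult[symmetric])
    hence "m * (q - p) \<le> 0" using pq by (simp add: field_simps)
    hence "m = 0" using pq m by (simp add: mult_le_0_iff)
    hence "S \<in> null_sets lebesgue" using m Sb by (auto intro: null_setsI)
    thus ?thesis by (simp add: negligible_iff_null_sets S_def)
  qed
  hence "negligible (\<Union>n. ?E \<inter> {- real n..real n})" by (intro negligible_countable_Union) auto
  moreover have "?E \<subseteq> (\<Union>n. ?E \<inter> {- real n..real n})"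
  proof
    fix x assume "x \<in> ?E"
    moreover obtain n where "\<bar>x\<bar> \<le> real n" using real_arch_simple by blast
    ultimately show "x \<in> (\<Union>n. ?E \<inter> {- real n..real n})" by (intro UN_I[of n]) auto
  qed
  ultimately show ?thesis using negligible_subset by blast
qed

text \<open>Adding a steep linear function makes all slopes positive and bounded, without affecting
  differentiability. Outside countably many null sets, indexed by rational \<open>p < q\<close>, the
  difference quotients then do not oscillate and hence converge.\<close>
theorem lipschitz_imp_AE_differentiable:
  fixes f :: "real \<Rightarrow> real"
  assumes lip: "L-lipschitz_on UNIV f"
  shows "AE x in lborel. f differentiable at x"
proof -
  have "0 \<le> L" using lipschitz_on_nonneg[OF lip] .
  define F where "F x = f x + (L + 1) * x" for x
  have lf: "\<bar>f y - f x\<bar> \<le> L * \<bar>y - x\<bar>" for x y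
    using lipschitz_onD[OF lip, of y x] by (simp add: dist_real_def)
  have lo: "y - x \<le> F y - F x" and up: "F y - F x \<le> (2 * L + 1) * (y - x)" if "x \<le> y" for x y
    using lf[of y x] that by (simp_all add: F_def algebra_simps abs_le_iff)
  define E where "E p q = {x. (\<exists>\<^sub>F t in at 0. (F (x + t) - F x) / t < p) \<and> (\<exists>\<^sub>F t in at 0. (F (x + t) - F x) / t > q)}" for p q
  define PQ where "PQ = {(p, q). p \<in> \<rat> \<and> q \<in> \<rat> \<and> 0 < p \<and> p < (q::real)}"
  have "countable PQ"
    by (rule countable_subset[of _ "\<rat> \<times> \<rat>"]) (auto simp: PQ_def countable_rat)
  hence "negligible (\<Union>(p, q)\<in>PQ. E p q)"
    using negligible_slope_oscillation[of F, OF lo up]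
    by (intro negligible_countable_Union) (auto simp: PQ_def E_def)
  hence "AE x in lborel. x \<notin> (\<Union>(p, q)\<in>PQ. E p q)"
    using AE_not_in[of "\<Union>(p, q)\<in>PQ. E p q" lebesgue] by (simp add: negligible_iff_null_sets AE_completion_iff)
  thus ?thesis
  proof eventually_elim
    case (elim x)
    define Q where "Q t = (F (x + t) - F x) / t" for t
    have Qb: "1 \<le> Q t" "Q t \<le> 2 * L + 1" if "t \<noteq> 0" for t
      using that lo[of x "x + t"] up[of x "x + t"] lo[of "x + t" x] up[of "x + t" x]
      by (cases "t > 0"; simp add: Q_def field_simps)+
    define li where "li = Liminf (at (0::real)) (\<lambda>t. ereal (Q t))"
    define ls where "ls = Limsup (at (0::real)) (\<lambda>t. ereal (Q t))"
    have ev: "\<forall>\<^sub>F t in at (0::real). t \<noteq> 0" by (simp add: eventually_at_filter)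
    have b1: "1 \<le> li"
      unfolding li_def using ev by (intro Liminf_bounded) (auto elim!: eventually_mono simp: Qb one_ereal_def)
    have b2: "ls \<le> ereal (2 * L + 1)"
      unfolding ls_def using ev by (intro Limsup_bounded) (auto elim!: eventually_mono dest: Qb(2))
    have le: "li \<le> ls" unfolding li_def ls_def by (rule Liminf_le_Limsup) simp
    have "\<not> li < ls"
    proof
      assume "li < ls"
      then obtain q' where q': "li < ereal q'" "ereal q' < ls" using ereal_dense2 by blast
      \<comment> \<open>The real bounds leave room for rational \<open>p < q\<close> strictly between the two limits.\<close>
      then obtain p' where p': "li < ereal p'" "ereal p' < ereal q'" using ereal_dense2 by blast
      obtain p where p: "p \<in> \<rat>" "p' < p" "p < q'" using Rats_dense_in_real p' by auto
      obtain r where r: "p < r" "r < q'" using dense p by blast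
      obtain q where q: "q \<in> \<rat>" "r < q" "q < q'" using Rats_dense_in_real r by blast
      have lip_p: "li < ereal p" using p' p by (meson less_ereal.simps(1) less_trans)
      have "ereal q < ls" using q q' by (meson less_ereal.simps(1) less_trans)
      hence "\<exists>\<^sub>F t in at 0. Q t > q"
        using Limsup_bounded[of "\<lambda>t. ereal (Q t)" "ereal q" "at 0"] by (auto simp: ls_def frequently_def not_less)
      moreover have "\<exists>\<^sub>F t in at 0. Q t < p"
        using lip_p Liminf_bounded[of "ereal p" "\<lambda>t. ereal (Q t)" "at 0"] by (auto simp: li_def frequently_def not_less)
      ultimately have "x \<in> E p q" by (simp add: E_def Q_def)
      moreover have "ereal 1 < ereal p" using le_less_trans[OF b1 lip_p] by (simp add: one_ereal_def)
      hence "(p, q) \<in> PQ" using p q r by (auto simp: PQ_def)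
      ultimately show False using elim by blast
    qed
    hence eq: "li = ls" using le by simp
    obtain l where l: "li = ereal l" using b1 b2 eq by (cases li) auto
    have "((\<lambda>t. ereal (Q t)) \<longlongrightarrow> ereal l) (at 0)"
      using eq l by (subst tendsto_iff_Liminf_eq_Limsup) (auto simp: li_def ls_def)
    hence "(Q \<longlongrightarrow> l) (at 0)" by simp
    hence "(F has_real_derivative l) (at x)" by (simp add: DERIV_def Q_def[abs_def])
    hence "((\<lambda>y. F y - (L + 1) * y) has_real_derivative (l - (L + 1))) (at x)"
      by (auto intro!: derivative_eq_intros)
    thus ?case by (auto simp: F_def real_differentiable_def)
  qed
qed


lemma continuous_imp_antiderivative:
  fixes g :: "real \<Rightarrow> real"
  assumes "continuous_on UNIV g"
  obtains G where "\<And>x. (G has_real_derivative g x) (at x)" "G 0 = 0"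
proof -
  have "isCont g x" for x using assms by (simp add: continuous_on_eq_continuous_at)
  then obtain G where G: "\<And>x. (G has_vector_derivative g x) (at x)"
    using einterval_antiderivative[of "-\<infinity>" "\<infinity>" g] by auto
  have "((\<lambda>x. G x - G 0) has_real_derivative g x) (at x)" for x
    using G[of x] by (auto intro!: derivative_eq_intros simp: has_real_derivative_iff_has_vector_derivative)
  thus ?thesis using that[of "\<lambda>x. G x - G 0"] by simp
qed

text \<open>The increment of \<open>h\<close> is the limit of the integrals of its difference quotients. By dominated
  convergence it is the integral of the almost everywhere derivative.\<close>
lemma lipschitz_of_AE_deriv_le:
  fixes h :: "real \<Rightarrow> real"
  assumes lip: "L-lipschitz_on UNIV h" and c: "AE x in lborel. \<bar>deriv h x\<bar> \<le> c"
  shows "\<bar>h y - h x\<bar> \<le> c * \<bar>y - x\<bar>"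
proof -
  have *: "\<bar>h y - h x\<bar> \<le> c * (y - x)" if "x < y" for x y
  proof -
    have cont: "continuous_on X h" for X
      using lip continuous_on_subset lipschitz_on_continuous_on by blast
    have lh: "\<bar>h v - h u\<bar> \<le> L * \<bar>v - u\<bar>" for u v
      using lipschitz_onD[OF lip, of v u] by (simp add: dist_real_def)
    obtain H where H: "\<And>x. (H has_real_derivative h x) (at x)"
      using continuous_imp_antiderivative[OF cont] by metis
    define t where "t n = 1 / real (Suc n)" for n
    have t: "t n > 0" for n by (simp add: t_def)
    have t0: "t \<longlonglongrightarrow> 0" unfolding t_def using LIMSEQ_inverse_real_of_nat by (simp add: inverse_eq_divide)
    have tat: "filterlim t (at 0) sequentially"
      using t0 t by (auto simp: filterlim_at intro!: always_eventually) (metis less_irrefl)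
    define q where "q n s = (h (s + t n) - h s) / t n" for n s
    have qcont: "continuous_on X (q n)" for X n
      unfolding q_def divide_inverse by (intro continuous_intros continuous_on_compose2[OF cont]) auto
    hence qmeas[measurable]: "q n \<in> borel_measurable borel" for n
      by (intro borel_measurable_continuous_onI)
    have qlim: "AE s in lborel. (\<lambda>n. q n s) \<longlonglongrightarrow> deriv h s"
      using lipschitz_imp_AE_differentiable[OF lip]
    proof eventually_elim
      case (elim s)
      hence "(h has_real_derivative deriv h s) (at s)"
        by (simp add: DERIV_deriv_iff_real_differentiable)
      thus ?case unfolding DERIV_def q_def by (rule filterlim_compose[OF _ tat])
    qed
    define g where "g s = lim (\<lambda>n. q n s)" for s
    have gm[measurable]: "g \<in> borel_measurable borel" unfolding g_def by measurable
    have qg: "AE s in lborel. (\<lambda>n. q n s) \<longlonglongrightarrow> g s \<and> \<bar>g s\<bar> \<le> c"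
      using qlim c by eventually_elim (auto simp: g_def limI)
    have int_c: "integrable lborel (\<lambda>s. indicator {x..y} s *\<^sub>R (K::real))" for K
      by (intro integrable_scaleR_left integrable_real_indicator) (auto simp: emeasure_lborel_Icc_eq)
    have lim1: "(\<lambda>n. \<integral>s. indicator {x..y} s *\<^sub>R q n s \<partial>lborel) \<longlonglongrightarrow> (\<integral>s. indicator {x..y} s *\<^sub>R g s \<partial>lborel)"
    proof (rule integral_dominated_convergence[where w = "\<lambda>s. indicator {x..y} s *\<^sub>R L"])
      show "AE s in lborel. (\<lambda>n. indicator {x..y} s *\<^sub>R q n s) \<longlonglongrightarrow> indicator {x..y} s *\<^sub>R g s"
        using qg by eventually_elim (intro tendsto_intros, simp)
      show "AE s in lborel. norm (indicator {x..y} s *\<^sub>R q n s) \<le> indicator {x..y} s *\<^sub>R L" for n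
      proof (intro always_eventually allI)
        show "norm (indicator {x..y} s *\<^sub>R q n s) \<le> indicator {x..y} s *\<^sub>R L" for s
          using lh[of "s + t n" s] t[of n] by (simp add: q_def indicator_def field_simps)
      qed
    qed (use int_c in auto)
    have "(\<integral>s. indicator {x..y} s *\<^sub>R q n s \<partial>lborel) = (H (y + t n) - H y) / t n - (H (x + t n) - H x) / t n" for n
    proof -
      have "((\<lambda>s. (H (s + t n) - H s) / t n) has_real_derivative q n s) (at s)" for s
        unfolding q_def using DERIV_shift H t[of n]
        by (auto intro!: derivative_eq_intros DERIV_chain2[OF H])
      hence "(\<integral>s. indicator {x..y} s *\<^sub>R q n s \<partial>lborel) = (H (y + t n) - H y) / t n - (H (x + t n) - H x) / t n"
        using qcont that
        by (intro integral_FTC_Icc[where F = "\<lambda>s. (H (s + t n) - H s) / t n"])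
           (auto simp: has_real_derivative_iff_has_vector_derivative[symmetric] intro: has_field_derivative_at_within)
      thus ?thesis .
    qed
    moreover have "(\<lambda>n. (H (z + t n) - H z) / t n) \<longlonglongrightarrow> h z" for z
      using filterlim_compose[OF H[of z, unfolded DERIV_def] tat] .
    ultimately have "(\<lambda>n. \<integral>s. indicator {x..y} s *\<^sub>R q n s \<partial>lborel) \<longlonglongrightarrow> h y - h x"
      by (auto intro!: tendsto_intros)
    hence eq: "h y - h x = (\<integral>s. indicator {x..y} s *\<^sub>R g s \<partial>lborel)"
      using lim1 LIMSEQ_unique by blast
    have "norm (\<integral>s. indicator {x..y} s *\<^sub>R g s \<partial>lborel) \<le> (\<integral>s. indicator {x..y} s *\<^sub>R c \<partial>lborel)"
    proof -
      have bd: "AE s in lborel. norm (indicator {x..y} s *\<^sub>R g s) \<le> indicator {x..y} s *\<^sub>R c"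
        using qg by eventually_elim (auto simp: indicator_def)
      have "integrable lborel (\<lambda>s. indicator {x..y} s *\<^sub>R g s)"
      proof (rule Bochner_Integration.integrable_bound[OF int_c[of c]])
        show "AE s in lborel. norm (indicator {x..y} s *\<^sub>R g s) \<le> norm (indicator {x..y} s *\<^sub>R c)"
          using bd by eventually_elim (auto simp: indicator_def)
      qed simp
      thus ?thesis using bd int_c
        by (intro order_trans[OF integral_norm_bound] integral_mono_AE integrable_norm) auto
    qed
    thus ?thesis using that eq by (simp add: mult.commute)
  qed
  show ?thesis using *[of x y] *[of y x] by (cases x y rule: linorder_cases) (auto simp: abs_minus_commute)
qed

section \<open>Averages against an exponential distribution\<close>

definition exp_measure :: "real \<Rightarrow> real measure" where
  "exp_measure l = density lborel (\<lambda>x. ennreal (exponential_density l x))"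

lemma sets_exp_measure [measurable_cong, simp]: "sets (exp_measure l) = sets borel"
  and space_exp_measure [simp]: "space (exp_measure l) = UNIV"
  by (simp_all add: exp_measure_def)

lemma prob_space_exp_measure: "l > 0 \<Longrightarrow> prob_space (exp_measure l)"
  by (simp add: exp_measure_def prob_space_exponential_density)

lemma measure_exp_measure_UNIV [simp]: "l > 0 \<Longrightarrow> measure (exp_measure l) UNIV = 1"
  using prob_space.prob_space[OF prob_space_exp_measure, of l] by simp

lemma AE_exp_measure_nonneg: "AE u in exp_measure l. 0 \<le> u"
  unfolding exp_measure_def by (subst AE_density) (auto simp: exponential_density_def not_less[symmetric])

lemma exp_measure_moment:
  assumes "l > 0"
  shows "has_bochner_integral (exp_measure l) (\<lambda>u. u ^ i) (fact i / l ^ i)"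
proof -
  interpret prob_space "exp_measure l" by (rule prob_space_exp_measure) fact
  have "distributed (exp_measure l) lborel (\<lambda>u. u) (exponential_density l)"
    unfolding distributed_def
    by (auto simp: exp_measure_def intro!: measurable_If distr_id2[THEN trans])
  from has_bochner_integral_erlang_ith_moment[OF assms this, of i] show ?thesis by simp
qed

text \<open>A class of test functions that is large enough for the solutions of all Stein equations considered
  here, and for which two moments of the random variable suffice.\<close>
definition quad_growth :: "(real \<Rightarrow> real) \<Rightarrow> bool" where
  "quad_growth h \<longleftrightarrow> continuous_on UNIV h \<and> (\<exists>C\<ge>0. \<forall>x. \<bar>h x\<bar> \<le> C * (1 + x\<^sup>2))"

lemma quad_growth_measurable: "quad_growth h \<Longrightarrow> h \<in> borel_measurable borel"
  by (simp add: quad_growth_def borel_measurable_continuous_onI)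

lemma quad_growthE:
  assumes "quad_growth h" obtains C where "C \<ge> 0" "\<And>x. \<bar>h x\<bar> \<le> C * (1 + x\<^sup>2)"
  using assms by (auto simp: quad_growth_def)

lemma quad_growth_uminus:
  assumes "quad_growth h" shows "quad_growth (\<lambda>x. h (- x))"
proof -
  from assms obtain C where "C \<ge> 0" and C: "\<And>x. \<bar>h x\<bar> \<le> C * (1 + x\<^sup>2)" by (metis quad_growthE)
  moreover have "continuous_on UNIV (\<lambda>x. h (- x))"
    using assms by (auto simp: quad_growth_def intro!: continuous_on_compose2[of UNIV h] continuous_intros)
  ultimately show ?thesis
    unfolding quad_growth_def by (metis power2_minus)
qed

lemma quad_growth_lincomb:
  assumes "quad_growth f" "quad_growth g"
  shows "quad_growth (\<lambda>x. c * f x + d * g x)"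
proof -
  from assms obtain A B where "A \<ge> 0" and A: "\<And>x. \<bar>f x\<bar> \<le> A * (1 + x\<^sup>2)"
    and "B \<ge> 0" and B: "\<And>x. \<bar>g x\<bar> \<le> B * (1 + x\<^sup>2)" by (metis quad_growthE)
  have "\<bar>c * f x + d * g x\<bar> \<le> (\<bar>c\<bar> * A + \<bar>d\<bar> * B) * (1 + x\<^sup>2)" for x
  proof -
    have "\<bar>c * f x + d * g x\<bar> \<le> \<bar>c\<bar> * \<bar>f x\<bar> + \<bar>d\<bar> * \<bar>g x\<bar>"
      by (metis abs_mult abs_triangle_ineq)
    also have "\<dots> \<le> \<bar>c\<bar> * (A * (1 + x\<^sup>2)) + \<bar>d\<bar> * (B * (1 + x\<^sup>2))"
      by (intro add_mono mult_left_mono A B) auto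
    finally show ?thesis by (simp add: algebra_simps)
  qed
  moreover have "continuous_on UNIV (\<lambda>x. c * f x + d * g x)"
    using assms by (auto simp: quad_growth_def intro!: continuous_intros)
  ultimately show ?thesis
    using \<open>A \<ge> 0\<close> \<open>B \<ge> 0\<close> unfolding quad_growth_def by (metis add_nonneg_nonneg abs_ge_zero mult_nonneg_nonneg)
qed

lemma quad_growth_const: "quad_growth (\<lambda>_. c)"
proof -
  have "\<bar>c\<bar> \<le> \<bar>c\<bar> * (1 + x\<^sup>2)" for x using mult_left_mono[of 1 "1 + x\<^sup>2" "\<bar>c\<bar>"] by simp
  thus ?thesis by (auto simp: quad_growth_def intro!: exI[of _ "\<bar>c\<bar>"])
qed

lemma square_add_le: "(x + y)\<^sup>2 \<le> 2 * x\<^sup>2 + 2 * (y::real)\<^sup>2"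
  using zero_le_power2[of "x - y"] by (simp add: power2_eq_square algebra_simps)

lemma quad_growth_integrable:
  assumes "prob_space M" "X \<in> borel_measurable M" "integrable M (\<lambda>\<omega>. (X \<omega>)\<^sup>2)" "quad_growth h"
  shows "integrable M (\<lambda>\<omega>. h (X \<omega>))"
proof -
  interpret prob_space M by fact
  obtain C where "C \<ge> 0" and C: "\<And>x. \<bar>h x\<bar> \<le> C * (1 + x\<^sup>2)" using assms by (metis quad_growthE)
  show ?thesis
  proof (rule Bochner_Integration.integrable_bound)
    show "integrable M (\<lambda>\<omega>. C * (1 + (X \<omega>)\<^sup>2))" using assms by auto
    show "AE \<omega> in M. norm (h (X \<omega>)) \<le> norm (C * (1 + (X \<omega>)\<^sup>2))"
      using C \<open>C \<ge> 0\<close> by (intro always_eventually) (metis abs_ge_self order_trans real_norm_def)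
    show "(\<lambda>\<omega>. h (X \<omega>)) \<in> borel_measurable M"
      using measurable_compose[OF assms(2) quad_growth_measurable[OF assms(4)]] .
  qed
qed

lemma exp_measure_square_add:
  assumes "l > 0"
  shows "integrable (exp_measure l) (\<lambda>u. (x + u)\<^sup>2)"
    "(\<integral>u. (x + u)\<^sup>2 \<partial>exp_measure l) = x\<^sup>2 + 2 * x / l + 2 / l\<^sup>2"
proof -
  interpret prob_space "exp_measure l" by (rule prob_space_exp_measure) fact
  have m: "has_bochner_integral (exp_measure l) (\<lambda>u. x\<^sup>2 + (2 * x) * u ^ 1 + u ^ 2)
      (x\<^sup>2 + (2 * x) * (fact 1 / l ^ 1) + fact 2 / l ^ 2)"
    by (intro has_bochner_integral_add has_bochner_integral_mult_right exp_measure_moment assms)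
       (simp add: has_bochner_integral_iff assms)
  have eq: "(\<lambda>u. x\<^sup>2 + (2 * x) * u ^ 1 + u ^ 2) = (\<lambda>u. (x + u)\<^sup>2)"
    by (auto simp: power2_eq_square algebra_simps)
  show "integrable (exp_measure l) (\<lambda>u. (x + u)\<^sup>2)"
    "(\<integral>u. (x + u)\<^sup>2 \<partial>exp_measure l) = x\<^sup>2 + 2 * x / l + 2 / l\<^sup>2"
    using m[unfolded eq] by (auto simp: has_bochner_integral_iff fact_numeral)
qed

definition fwd_avg :: "real \<Rightarrow> (real \<Rightarrow> real) \<Rightarrow> real \<Rightarrow> real" where
  "fwd_avg l h x = (\<integral>u. h (x + u) \<partial>exp_measure l)"

lemma integrable_shift_exp_measure:
  assumes "l > 0" "quad_growth h"
  shows "integrable (exp_measure l) (\<lambda>u. h (x + u))"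
  by (rule quad_growth_integrable[OF prob_space_exp_measure[OF assms(1)] _ exp_measure_square_add(1)[OF assms(1)] assms(2)]) simp

lemma fwd_avg_range:
  assumes "l > 0" "quad_growth h" "\<And>x. c \<le> h x" "\<And>x. h x \<le> d"
  shows "c \<le> fwd_avg l h x" "fwd_avg l h x \<le> d"
proof -
  interpret prob_space "exp_measure l" by (rule prob_space_exp_measure) fact
  show "c \<le> fwd_avg l h x" "fwd_avg l h x \<le> d"
    unfolding fwd_avg_def using assms(3,4) integrable_shift_exp_measure[OF assms(1,2)]
    by (simp_all add: integral_ge_const integral_le_const)
qed

text \<open>The second bound holds because the shift \<open>u\<close> has mean \<open>1 / l\<close>.\<close>
lemma fwd_avg_lipschitz:
  assumes "l > 0" "quad_growth h" "\<And>x y. \<bar>h x - h y\<bar> \<le> \<bar>x - y\<bar>"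
  shows "\<bar>fwd_avg l h x - fwd_avg l h y\<bar> \<le> \<bar>x - y\<bar>" "\<bar>fwd_avg l h x - h x\<bar> \<le> 1 / l"
proof -
  interpret prob_space "exp_measure l" by (rule prob_space_exp_measure) fact
  note int = integrable_shift_exp_measure[OF assms(1,2)]
  have "fwd_avg l h x - fwd_avg l h y = (\<integral>u. h (x + u) - h (y + u) \<partial>exp_measure l)"
    unfolding fwd_avg_def by (intro Bochner_Integration.integral_diff[symmetric] int)
  also have "\<bar>\<dots>\<bar> \<le> (\<integral>u. \<bar>h (x + u) - h (y + u)\<bar> \<partial>exp_measure l)" by (rule integral_abs_bound)
  also have "\<dots> \<le> \<bar>x - y\<bar>"
  proof (rule integral_le_const)
    show "AE u in exp_measure l. \<bar>h (x + u) - h (y + u)\<bar> \<le> \<bar>x - y\<bar>"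
    proof (intro always_eventually allI)
      show "\<bar>h (x + u) - h (y + u)\<bar> \<le> \<bar>x - y\<bar>" for u using assms(3)[of "x + u" "y + u"] by simp
    qed
  qed (use int in simp)
  finally show "\<bar>fwd_avg l h x - fwd_avg l h y\<bar> \<le> \<bar>x - y\<bar>" .
  have "fwd_avg l h x - h x = (\<integral>u. h (x + u) - h x \<partial>exp_measure l)"
    unfolding fwd_avg_def using int assms by simp
  also have "\<bar>\<dots>\<bar> \<le> (\<integral>u. \<bar>h (x + u) - h x\<bar> \<partial>exp_measure l)" by (rule integral_abs_bound)
  also have "\<dots> \<le> (\<integral>u. u \<partial>exp_measure l)"
  proof (rule integral_mono_AE)
    show "AE u in exp_measure l. \<bar>h (x + u) - h x\<bar> \<le> u"
      using AE_exp_measure_nonneg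
    proof eventually_elim
      case (elim u) thus ?case using assms(3)[of "x + u" x] by simp
    qed
  qed (use int exp_measure_moment[OF \<open>l > 0\<close>, of 1] in \<open>auto simp: has_bochner_integral_iff\<close>)
  also have "\<dots> = 1 / l" using exp_measure_moment[OF \<open>l > 0\<close>, of 1] by (simp add: has_bochner_integral_iff)
  finally show "\<bar>fwd_avg l h x - h x\<bar> \<le> 1 / l" .
qed

text \<open>Substituting \<open>y = x + u\<close> moves the dependence on \<open>x\<close> from the integrand to the domain of integration,
  where it can be differentiated although \<open>h\<close> is merely continuous.\<close>
lemma fwd_avg_shift:
  assumes "l > 0" "quad_growth h"
  shows "set_integrable lborel {x..} (\<lambda>y. l * exp (- l * y) * h y)"
    and "fwd_avg l h x = exp (l * x) * (LINT y:{x..}|lborel. l * exp (- l * y) * h y)"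
proof -
  note [measurable] = quad_growth_measurable[OF assms(2)]
  have eq: "exponential_density l u *\<^sub>R h (x + u) =
     exp (l * x) * (indicator {x..} (x + 1 * u) *\<^sub>R (l * exp (- l * (x + 1 * u)) * h (x + 1 * u)))" for u
  proof -
    have "exp (l * x) * exp (- l * (x + u)) = exp (- u * l)"
      by (simp add: mult_exp_exp algebra_simps)
    hence "exp (l * x) * (l * exp (- l * (x + u)) * h (x + u)) = l * exp (- u * l) * h (x + u)"
      by (metis (no_types, lifting) mult.assoc mult.left_commute)
    thus ?thesis by (cases "u < 0") (simp_all only: exponential_density_def indicator_def, auto)
  qed
  have "integrable lborel (\<lambda>u. exponential_density l u *\<^sub>R h (x + u))"
    using integrable_shift_exp_measure[OF assms, of x] assms(1)
    unfolding exp_measure_def by (subst (asm) integrable_density) (auto simp: exponential_density_nonneg)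
  hence "integrable lborel (\<lambda>u. (indicator {x..} (x + 1 * u) *\<^sub>R (l * exp (- l * (x + 1 * u)) * h (x + 1 * u))))"
    unfolding eq by simp
  thus "set_integrable lborel {x..} (\<lambda>y. l * exp (- l * y) * h y)"
    unfolding set_integrable_def by (subst (asm) lborel_integrable_real_affine_iff) simp_all
  have "fwd_avg l h x = (\<integral>u. exponential_density l u *\<^sub>R h (x + u) \<partial>lborel)"
    unfolding fwd_avg_def exp_measure_def using assms(1)
    by (subst integral_density) (auto simp: exponential_density_nonneg)
  also have "\<dots> = exp (l * x) * (\<integral>u. indicator {x..} (x + 1 * u) *\<^sub>R (l * exp (- l * (x + 1 * u)) * h (x + 1 * u)) \<partial>lborel)"
    unfolding eq by simp
  also have "\<dots> = exp (l * x) * (LINT y:{x..}|lborel. l * exp (- l * y) * h y)"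
    unfolding set_lebesgue_integral_def
    by (subst lborel_integral_real_affine[of 1 "\<lambda>y. indicator {x..} y *\<^sub>R (l * exp (- l * y) * h y)" x]) simp_all
  finally show "fwd_avg l h x = exp (l * x) * (LINT y:{x..}|lborel. l * exp (- l * y) * h y)" .
qed

text \<open>The integral over \<open>{x..}\<close> differs from \<open>- K x\<close>, for an antiderivative \<open>K\<close> of the integrand, by a
  constant.\<close>
lemma fwd_avg_deriv:
  assumes "l > 0" "quad_growth h"
  shows "(fwd_avg l h has_real_derivative l * (fwd_avg l h x - h x)) (at x)"
proof -
  define k where "k y = l * exp (- l * y) * h y" for y
  have kc: "continuous_on UNIV k"
    using assms(2) unfolding k_def[abs_def] quad_growth_def by (intro continuous_intros) auto
  obtain K where K: "\<And>x. (K has_real_derivative k x) (at x)"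
    using continuous_imp_antiderivative[OF kc] by metis
  have int: "set_integrable lborel {x..} k" for x
    using fwd_avg_shift(1)[OF assms] by (simp add: k_def[abs_def])
  have step: "(LINT y:{x..}|lborel. k y) + K x = (LINT y:{z..}|lborel. k y) + K z" if "x \<le> z" for x z
  proof -
    have "(\<integral>y. indicator {x..z} y *\<^sub>R k y \<partial>lborel) = K z - K x"
      using K kc that
      by (intro integral_FTC_Icc) (auto simp: has_real_derivative_iff_has_vector_derivative[symmetric]
          intro: has_field_derivative_at_within continuous_on_subset)
    moreover have "(LINT y:{x..}|lborel. k y) = (LINT y:{x..<z} \<union> {z..}|lborel. k y)"
      using that by (simp add: ivl_disj_un)
    hence "(LINT y:{x..}|lborel. k y) = (LINT y:{x..<z}|lborel. k y) + (LINT y:{z..}|lborel. k y)"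
      using int by (subst (asm) set_integral_Un) (auto intro: set_integrable_subset[OF int[of x]])
    moreover have "(LINT y:{x..<z}|lborel. k y) = (LINT y:{x..z}|lborel. k y)"
      unfolding set_lebesgue_integral_def
    proof (rule integral_cong_AE)
      show "AE y in lborel. indicat_real {x..<z} y *\<^sub>R k y = indicat_real {x..z} y *\<^sub>R k y"
        using AE_lborel_singleton[of z] by eventually_elim (auto simp: indicator_def)
    qed (use borel_measurable_continuous_onI[OF kc] in simp_all)
    ultimately show ?thesis by (simp add: set_lebesgue_integral_def)
  qed
  have const: "(LINT y:{x..}|lborel. k y) = (LINT y:{0..}|lborel. k y) + K 0 - K x" for x
    using step[of x 0] step[of 0 x] by (cases "x \<le> 0") auto
  have eq: "fwd_avg l h = (\<lambda>x. exp (l * x) * ((LINT y:{0..}|lborel. k y) + K 0 - K x))"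
  proof
    show "fwd_avg l h x = exp (l * x) * ((LINT y:{0..}|lborel. k y) + K 0 - K x)" for x
      using fwd_avg_shift(2)[OF assms, of x] unfolding k_def[symmetric] const[of x] .
  qed
  show ?thesis
    unfolding eq
  proof -
    have "exp (l * x) * (l * exp (- l * x) * h x) = l * h x"
      using exp_not_eq_zero[of "l * x"] by (simp add: exp_minus field_simps)
    thus "((\<lambda>x. exp (l * x) * ((LINT y:{0..}|lborel. k y) + K 0 - K x)) has_real_derivative
        l * (exp (l * x) * ((LINT y:{0..}|lborel. k y) + K 0 - K x) - h x)) (at x)"
      by (auto intro!: derivative_eq_intros K simp: k_def algebra_simps)
  qed
qed

lemma quad_growth_fwd_avg:
  assumes "l > 0" "quad_growth h" shows "quad_growth (fwd_avg l h)"
proof -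
  interpret prob_space "exp_measure l" by (rule prob_space_exp_measure) fact
  obtain C where "C \<ge> 0" and C: "\<And>x. \<bar>h x\<bar> \<le> C * (1 + x\<^sup>2)" using assms by (metis quad_growthE)
  have "\<bar>fwd_avg l h x\<bar> \<le> (C * (2 + 4 / l\<^sup>2)) * (1 + x\<^sup>2)" for x
  proof -
    have "\<bar>fwd_avg l h x\<bar> \<le> (\<integral>u. \<bar>h (x + u)\<bar> \<partial>exp_measure l)"
      unfolding fwd_avg_def by (rule integral_abs_bound)
    also have "\<dots> \<le> (\<integral>u. C * (1 + (x + u)\<^sup>2) \<partial>exp_measure l)"
      using C integrable_shift_exp_measure[OF assms, of x] exp_measure_square_add[OF \<open>l > 0\<close>, of x]
      by (intro integral_mono integrable_mult_right Bochner_Integration.integrable_add) auto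
    also have "\<dots> = C * (1 + (x\<^sup>2 + 2 * x / l + 2 / l\<^sup>2))"
      using exp_measure_square_add[OF \<open>l > 0\<close>, of x] assms by simp
    also have "\<dots> \<le> C * ((2 + 4 / l\<^sup>2) * (1 + x\<^sup>2))"
    proof (rule mult_left_mono)
      define r where "r = 1 / l"
      have "1 + (x\<^sup>2 + 2 * x * r + 2 * r\<^sup>2) \<le> (2 + 4 * r\<^sup>2) * (1 + x\<^sup>2)"
      proof -
        have "(2 + 4 * r\<^sup>2) * (1 + x\<^sup>2) = 2 + 2 * x\<^sup>2 + 4 * r\<^sup>2 + 4 * (r * x)\<^sup>2"
          by (simp add: power_mult_distrib algebra_simps)
        moreover have "2 * x * r \<le> x\<^sup>2 + r\<^sup>2"
          using zero_le_power2[of "x - r"] by (simp add: power2_diff)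
        ultimately show ?thesis
          using zero_le_power2[of "r * x"] zero_le_power2[of r] zero_le_power2[of x] by linarith
      qed
      thus "1 + (x\<^sup>2 + 2 * x / l + 2 / l\<^sup>2) \<le> (2 + 4 / l\<^sup>2) * (1 + x\<^sup>2)"
        by (simp add: r_def power_divide)
    qed fact
    finally show ?thesis by (simp add: mult.assoc)
  qed
  moreover have "continuous_on UNIV (fwd_avg l h)"
    using fwd_avg_deriv[OF assms] by (meson DERIV_isCont continuous_at_imp_continuous_on)
  ultimately show ?thesis
    unfolding quad_growth_def using \<open>C \<ge> 0\<close> \<open>l > 0\<close> by (intro conjI exI[of _ "C * (2 + 4 / l\<^sup>2)"]) auto
qed

text \<open>A Taylor bound for functions that are only once differentiable with Lipschitz derivative: the
  difference of the two sides is monotone on either side of the base point.\<close>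
lemma taylor_remainder_le:
  fixes h g :: "real \<Rightarrow> real"
  assumes h: "\<And>x. (h has_real_derivative g x) (at x)" and g: "\<And>x y. \<bar>g x - g y\<bar> \<le> B * \<bar>x - y\<bar>"
  shows "\<bar>h y - h x - g x * (y - x)\<bar> \<le> B / 2 * (y - x)\<^sup>2"
proof -
  have up: "h (x + s * t) - h x - g x * (s * t) \<le> B / 2 * t\<^sup>2" if "0 \<le> t" "\<bar>s\<bar> = 1" and h: "\<And>x. (h has_real_derivative g x) (at x)" and g: "\<And>x y. \<bar>g x - g y\<bar> \<le> B * \<bar>x - y\<bar>"
    for h g :: "real \<Rightarrow> real" and s t x
  proof -
    define \<phi> where "\<phi> t = B / 2 * t\<^sup>2 - (h (x + s * t) - h x - g x * (s * t))" for t
    have "((\<lambda>t. h (x + s * t)) has_real_derivative g (x + s * t) * s) (at t)" for t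
      by (rule DERIV_chain2[OF h]) (auto intro!: derivative_eq_intros)
    hence "(\<phi> has_real_derivative (B * t - (g (x + s * t) - g x) * s)) (at t)" for t
      unfolding \<phi>_def[abs_def] by (auto intro!: derivative_eq_intros simp: algebra_simps)
    moreover have "B * t - (g (x + s * t) - g x) * s \<ge> 0" if "0 \<le> t" for t
    proof -
      have "\<bar>(g (x + s * t) - g x) * s\<bar> \<le> B * t"
        using g[of "x + s * t" x] that \<open>\<bar>s\<bar> = 1\<close> by (simp add: abs_mult)
      thus ?thesis by (simp add: abs_le_iff)
    qed
    ultimately have "\<phi> 0 \<le> \<phi> t"
      by (intro DERIV_nonneg_imp_nondecreasing[OF \<open>0 \<le> t\<close>]) blast
    thus ?thesis by (simp add: \<phi>_def)
  qed
  \<comment> \<open>The sign of \<open>y - x\<close> lets one estimate treat both directions.\<close>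
  define s where "s = (if x \<le> y then 1 else -1 :: real)"
  have s: "s * \<bar>y - x\<bar> = y - x" "\<bar>s\<bar> = 1" by (auto simp: s_def)
  have "h y - h x - g x * (y - x) \<le> B / 2 * (y - x)\<^sup>2"
    using up[of "\<bar>y - x\<bar>" s h g x] s h g by simp
  moreover have "- h y - - h x - - g x * (y - x) \<le> B / 2 * (y - x)\<^sup>2"
  proof -
    have "((\<lambda>x. - h x) has_real_derivative - g x) (at x)" for x using h by (auto intro!: derivative_eq_intros)
    moreover have "\<bar>- g x - - g y\<bar> \<le> B * \<bar>x - y\<bar>" for x y using g[of x y] by simp
    ultimately show ?thesis
      using up[of "\<bar>y - x\<bar>" s "\<lambda>x. - h x" "\<lambda>x. - g x" x] s by simp
  qed
  ultimately show ?thesis by linarith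
qed

text \<open>Averaging commutes with differentiation: by the Taylor bound the averaged difference quotients of
  \<open>h\<close> converge to the average of \<open>g\<close>. The left-hand side is another expression for the same derivative.\<close>
lemma fwd_avg_deriv_commute:
  assumes "l > 0" "quad_growth h" "quad_growth g"
    and h: "\<And>x. (h has_real_derivative g x) (at x)" and g: "\<And>x y. \<bar>g x - g y\<bar> \<le> \<bar>x - y\<bar>"
  shows "l * (fwd_avg l h x - h x) = fwd_avg l g x"
proof -
  interpret prob_space "exp_measure l" by (rule prob_space_exp_measure) fact
  note ih = integrable_shift_exp_measure[OF assms(1,2)]
  note ig = integrable_shift_exp_measure[OF assms(1,3)]
  have bd: "\<bar>fwd_avg l h (x + t) - fwd_avg l h x - fwd_avg l g x * t\<bar> \<le> t\<^sup>2 / 2" for t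
  proof -
    have "fwd_avg l h (x + t) - fwd_avg l h x - fwd_avg l g x * t =
      (\<integral>u. h (x + t + u) - h (x + u) - g (x + u) * t \<partial>exp_measure l)"
      unfolding fwd_avg_def using ih ig by simp
    also have "\<bar>\<dots>\<bar> \<le> (\<integral>u. \<bar>h (x + t + u) - h (x + u) - g (x + u) * t\<bar> \<partial>exp_measure l)"
      by (rule integral_abs_bound)
    also have "\<dots> \<le> t\<^sup>2 / 2"
    proof (rule integral_le_const)
      show "AE u in exp_measure l. \<bar>h (x + t + u) - h (x + u) - g (x + u) * t\<bar> \<le> t\<^sup>2 / 2"
      proof (intro always_eventually allI)
        fix u show "\<bar>h (x + t + u) - h (x + u) - g (x + u) * t\<bar> \<le> t\<^sup>2 / 2"
          using taylor_remainder_le[of h g 1 "x + t + u" "x + u"] h g by simp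
      qed
    qed (use ih ig in auto)
    finally show ?thesis .
  qed
  have "(\<lambda>t. (fwd_avg l h (x + t) - fwd_avg l h x) / t - fwd_avg l g x) \<midarrow>0\<rightarrow> 0"
  proof (rule Lim_null_comparison)
    show "\<forall>\<^sub>F t in at 0. norm ((fwd_avg l h (x + t) - fwd_avg l h x) / t - fwd_avg l g x) \<le> \<bar>t\<bar> / 2"
    proof (rule eventually_at_filter[THEN iffD2], intro always_eventually allI impI)
      fix t :: real assume "t \<noteq> 0"
      hence "(fwd_avg l h (x + t) - fwd_avg l h x) / t - fwd_avg l g x =
        (fwd_avg l h (x + t) - fwd_avg l h x - fwd_avg l g x * t) / t" by (simp add: field_simps)
      also have "norm \<dots> \<le> (t\<^sup>2 / 2) / \<bar>t\<bar>"
        unfolding real_norm_def abs_divide by (intro divide_right_mono bd abs_ge_zero)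
      also have "\<dots> = \<bar>t\<bar> / 2" using \<open>t \<noteq> 0\<close> by (simp add: power2_eq_square abs_if)
      finally show "norm ((fwd_avg l h (x + t) - fwd_avg l h x) / t - fwd_avg l g x) \<le> \<bar>t\<bar> / 2" .
    qed
    show "(\<lambda>t::real. \<bar>t\<bar> / 2) \<midarrow>0\<rightarrow> 0" by (auto intro!: tendsto_eq_intros)
  qed
  hence "(fwd_avg l h has_real_derivative fwd_avg l g x) (at x)"
    unfolding DERIV_def by (rule LIM_zero_cancel)
  thus ?thesis by (rule DERIV_unique[OF fwd_avg_deriv[OF assms(1,2)]])
qed

definition bwd_avg :: "real \<Rightarrow> (real \<Rightarrow> real) \<Rightarrow> real \<Rightarrow> real" where
  "bwd_avg l h x = (\<integral>u. h (x - u) \<partial>exp_measure l)"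

text \<open>Reflection reduces backward averages to forward ones.\<close>
lemma bwd_avg_eq: "bwd_avg l h x = fwd_avg l (\<lambda>y. h (- y)) (- x)"
  by (simp add: bwd_avg_def fwd_avg_def)

lemma bwd_avg_deriv:
  assumes "l > 0" "quad_growth h"
  shows "(bwd_avg l h has_real_derivative l * (h x - bwd_avg l h x)) (at x)"
proof -
  have "((\<lambda>x. fwd_avg l (\<lambda>y. h (- y)) (- x)) has_real_derivative
      (l * (fwd_avg l (\<lambda>y. h (- y)) (- x) - h (- (- x)))) * (- 1)) (at x)"
    by (rule DERIV_chain2[OF fwd_avg_deriv[OF assms(1) quad_growth_uminus[OF assms(2)]]])
       (auto intro!: derivative_eq_intros)
  thus ?thesis by (simp add: bwd_avg_eq[abs_def] algebra_simps)
qed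

lemma quad_growth_bwd_avg:
  assumes "l > 0" "quad_growth h" shows "quad_growth (bwd_avg l h)"
  using quad_growth_uminus[OF quad_growth_fwd_avg[OF assms(1) quad_growth_uminus[OF assms(2)]]]
  by (simp add: bwd_avg_eq[abs_def])

lemma bwd_avg_range:
  assumes "l > 0" "quad_growth h" "\<And>x. c \<le> h x" "\<And>x. h x \<le> d"
  shows "c \<le> bwd_avg l h x" "bwd_avg l h x \<le> d"
  unfolding bwd_avg_eq using assms by (auto intro!: fwd_avg_range quad_growth_uminus)

lemma bwd_avg_lipschitz:
  assumes "l > 0" "quad_growth h" "\<And>x y. \<bar>h x - h y\<bar> \<le> \<bar>x - y\<bar>"
  shows "\<bar>bwd_avg l h x - bwd_avg l h y\<bar> \<le> \<bar>x - y\<bar>" "\<bar>bwd_avg l h x - h x\<bar> \<le> 1 / l"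
proof -
  have *: "\<bar>h (- x) - h (- y)\<bar> \<le> \<bar>x - y\<bar>" for x y
    using assms(3)[of "- x" "- y"] by (simp add: abs_minus_commute)
  note fwd = fwd_avg_lipschitz[OF assms(1) quad_growth_uminus[OF assms(2)] *]
  show "\<bar>bwd_avg l h x - bwd_avg l h y\<bar> \<le> \<bar>x - y\<bar>"
    using fwd(1)[of "- x" "- y"] by (simp add: bwd_avg_eq abs_minus_commute)
  show "\<bar>bwd_avg l h x - h x\<bar> \<le> 1 / l"
    using fwd(2)[of "- x"] by (simp add: bwd_avg_eq)
qed

lemma bwd_avg_deriv_commute:
  assumes "l > 0" "quad_growth h" "quad_growth g"
    and h: "\<And>x. (h has_real_derivative g x) (at x)" and g: "\<And>x y. \<bar>g x - g y\<bar> \<le> \<bar>x - y\<bar>"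
  shows "l * (h x - bwd_avg l h x) = bwd_avg l g x"
proof -
  have "l * (fwd_avg l (\<lambda>y. - h (- y)) (- x) - (- h (- (- x)))) = fwd_avg l (\<lambda>y. g (- y)) (- x)"
  proof (rule fwd_avg_deriv_commute)
    show "quad_growth (\<lambda>y. - h (- y))"
      using quad_growth_lincomb[OF quad_growth_uminus[OF assms(2)] quad_growth_const[of 0], of "-1" 0] by simp
    show "((\<lambda>y. - h (- y)) has_real_derivative g (- y)) (at y)" for y
    proof -
      have "((\<lambda>y. h (- y)) has_real_derivative g (- y) * (- 1)) (at y)"
        by (rule DERIV_chain2[OF h]) (auto intro!: derivative_eq_intros)
      from DERIV_minus[OF this] show ?thesis by simp
    qed
    show "\<bar>g (- x) - g (- y)\<bar> \<le> \<bar>x - y\<bar>" for x y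
      using g[of "- x" "- y"] by (simp add: abs_minus_commute)
  qed (use assms quad_growth_uminus in auto)
  thus ?thesis by (simp add: bwd_avg_eq fwd_avg_def)
qed

section \<open>The Stein equation of the asymmetric Laplace distribution\<close>

text \<open>The average of \<open>h (x + Z)\<close> when \<open>Z\<close> is the difference of independent exponential variables of rates
  \<open>l\<close> and \<open>m\<close>, written as a mixture; see \<open>asym_laplace_expectation\<close>.\<close>
definition laplace_avg :: "real \<Rightarrow> real \<Rightarrow> (real \<Rightarrow> real) \<Rightarrow> real \<Rightarrow> real" where
  "laplace_avg l m h x = m / (l + m) * fwd_avg l h x + l / (l + m) * bwd_avg m h x"

definition stein_sol :: "real \<Rightarrow> real \<Rightarrow> (real \<Rightarrow> real) \<Rightarrow> real \<Rightarrow> real" where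
  "stein_sol l m h x = laplace_avg l m h 0 - laplace_avg l m h x"

text \<open>In the derivative of the Stein solution the terms with \<open>h\<close> itself cancel, because the mixture
  weights are inversely proportional to the rates.\<close>
definition stein_sol1 :: "real \<Rightarrow> real \<Rightarrow> (real \<Rightarrow> real) \<Rightarrow> real \<Rightarrow> real" where
  "stein_sol1 l m h x = l * m / (l + m) * (bwd_avg m h x - fwd_avg l h x)"

definition stein_sol2 :: "real \<Rightarrow> real \<Rightarrow> (real \<Rightarrow> real) \<Rightarrow> real \<Rightarrow> real" where
  "stein_sol2 l m h x = l * m / (l + m) * (l * (h x - fwd_avg l h x) + m * (h x - bwd_avg m h x))"

context
  fixes l m :: real and h :: "real \<Rightarrow> real"
  assumes l: "l > 0" and m: "m > 0" and h: "quad_growth h"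
begin

lemma stein_sol_deriv: "(stein_sol l m h has_real_derivative stein_sol1 l m h x) (at x)"
proof -
  have "l + m > 0" using l m by simp
  have "((\<lambda>x. laplace_avg l m h 0 - (m / (l + m) * fwd_avg l h x + l / (l + m) * bwd_avg m h x))
      has_real_derivative 0 - (m / (l + m) * (l * (fwd_avg l h x - h x)) + l / (l + m) * (m * (h x - bwd_avg m h x)))) (at x)"
    by (intro DERIV_diff DERIV_add DERIV_const DERIV_cmult fwd_avg_deriv bwd_avg_deriv l m h)
  moreover have "0 - (m / (l + m) * (l * (fwd_avg l h x - h x)) + l / (l + m) * (m * (h x - bwd_avg m h x))) = stein_sol1 l m h x"
    by (simp add: stein_sol1_def diff_divide_distrib add_divide_distrib algebra_simps)
  ultimately show ?thesis by (simp add: stein_sol_def[abs_def] laplace_avg_def)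
qed

lemma stein_sol1_deriv: "(stein_sol1 l m h has_real_derivative stein_sol2 l m h x) (at x)"
proof -
  have "((\<lambda>x. l * m / (l + m) * (bwd_avg m h x - fwd_avg l h x))
      has_real_derivative l * m / (l + m) * (m * (h x - bwd_avg m h x) - l * (fwd_avg l h x - h x))) (at x)"
    by (intro DERIV_diff DERIV_cmult fwd_avg_deriv bwd_avg_deriv l m h)
  thus ?thesis by (simp add: stein_sol1_def[abs_def] stein_sol2_def algebra_simps)
qed

lemma stein_sol_0: "stein_sol l m h 0 = 0"
  by (simp add: stein_sol_def)

text \<open>With \<open>F\<close> and \<open>B\<close> as independent unknowns this is an identity of rational functions.\<close>
lemma stein_equation:
  "stein_sol2 l m h x / (l * m) + (1 / l - 1 / m) * stein_sol1 l m h x - stein_sol l m h x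
     = h x - laplace_avg l m h 0"
proof -
  define F where "F = fwd_avg l h x"
  define B where "B = bwd_avg m h x"
  have s: "l + m > 0" using l m by simp
  have "stein_sol2 l m h x / (l * m) = (l * (h x - F) + m * (h x - B)) / (l + m)"
    using l m s by (simp add: stein_sol2_def F_def B_def)
  moreover have "(1 / l - 1 / m) * stein_sol1 l m h x = (m - l) * (B - F) / (l + m)"
  proof -
    have "(1 / l - 1 / m) * (l * m) = m - l" using l m by (simp add: field_simps)
    moreover have "(1 / l - 1 / m) * stein_sol1 l m h x = (1 / l - 1 / m) * (l * m) * (B - F) / (l + m)"
      by (simp add: stein_sol1_def F_def B_def)
    ultimately show ?thesis by simp
  qed
  moreover have "laplace_avg l m h x = (m * F + l * B) / (l + m)"
    by (simp add: laplace_avg_def F_def B_def add_divide_distrib)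
  moreover have "(l * (h x - F) + m * (h x - B)) / (l + m) + (m - l) * (B - F) / (l + m) + (m * F + l * B) / (l + m) = h x"
  proof -
    have "(l * (h x - F) + m * (h x - B)) + (m - l) * (B - F) + (m * F + l * B) = h x * (l + m)"
      by (simp add: algebra_simps)
    thus ?thesis using s by (simp add: add_divide_distrib[symmetric])
  qed
  ultimately show ?thesis by (simp add: stein_sol_def)
qed

lemma quad_growth_stein_sol1: "quad_growth (stein_sol1 l m h)"
  using quad_growth_lincomb[OF quad_growth_bwd_avg[OF m h] quad_growth_fwd_avg[OF l h],
      of "l * m / (l + m)" "- (l * m / (l + m))"]
  by (simp add: stein_sol1_def[abs_def] right_diff_distrib)

lemma quad_growth_stein_sol: "quad_growth (stein_sol l m h)"
proof -
  have "quad_growth (\<lambda>x. m / (l + m) * fwd_avg l h x + l / (l + m) * bwd_avg m h x)"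
    by (intro quad_growth_lincomb quad_growth_fwd_avg quad_growth_bwd_avg l m h)
  moreover have "stein_sol l m h = (\<lambda>x. 1 * laplace_avg l m h 0 + (- 1) * (m / (l + m) * fwd_avg l h x + l / (l + m) * bwd_avg m h x))"
    by (simp add: fun_eq_iff stein_sol_def laplace_avg_def)
  ultimately show ?thesis using quad_growth_lincomb[OF quad_growth_const] by presburger
qed

lemma quad_growth_stein_sol2: "quad_growth (stein_sol2 l m h)"
proof -
  have "quad_growth (\<lambda>x. 1 * (l * h x + (- l) * fwd_avg l h x) + 1 * (m * h x + (- m) * bwd_avg m h x))"
    by (intro quad_growth_lincomb quad_growth_fwd_avg quad_growth_bwd_avg l m h)
  from quad_growth_lincomb[OF this this, of "l * m / (l + m)" 0]
  show ?thesis by (simp add: stein_sol2_def[abs_def] right_diff_distrib)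
qed

text \<open>The averages of \<open>h\<close> lie in \<open>[0, 1]\<close> with \<open>h\<close>.\<close>
lemma stein_sol_bounds_of_unit_range:
  assumes "\<And>x. 0 \<le> h x" "\<And>x. h x \<le> 1"
  shows "\<bar>stein_sol l m h x - stein_sol l m h y\<bar> \<le> 1"
    and "\<bar>stein_sol1 l m h x\<bar> \<le> l * m / (l + m)"
    and "\<bar>stein_sol2 l m h x\<bar> \<le> l * m"
proof -
  have s: "l + m > 0" using l m by simp
  note r = fwd_avg_range[OF l h assms] bwd_avg_range[OF m h assms]
  have "0 \<le> laplace_avg l m h x \<and> laplace_avg l m h x \<le> 1" for x
  proof
    show "0 \<le> laplace_avg l m h x" using r l m by (simp add: laplace_avg_def)
    have "laplace_avg l m h x \<le> m / (l + m) * 1 + l / (l + m) * 1"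
      unfolding laplace_avg_def using r l m by (intro add_mono mult_left_mono) auto
    also have "\<dots> = 1" using s by (simp add: add_divide_distrib[symmetric])
    finally show "laplace_avg l m h x \<le> 1" .
  qed
  from this[of x] this[of y] show "\<bar>stein_sol l m h x - stein_sol l m h y\<bar> \<le> 1"
    unfolding stein_sol_def by linarith
  have "\<bar>bwd_avg m h x - fwd_avg l h x\<bar> \<le> 1" using r[of x] by linarith
  from mult_left_mono[OF this, of "l * m / (l + m)"] show "\<bar>stein_sol1 l m h x\<bar> \<le> l * m / (l + m)"
    using l m by (simp add: stein_sol1_def abs_mult)
  have "\<bar>l * (h x - fwd_avg l h x) + m * (h x - bwd_avg m h x)\<bar> \<le> \<bar>l * (h x - fwd_avg l h x)\<bar> + \<bar>m * (h x - bwd_avg m h x)\<bar>"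
    by (rule abs_triangle_ineq)
  also have "\<dots> = l * \<bar>h x - fwd_avg l h x\<bar> + m * \<bar>h x - bwd_avg m h x\<bar>"
    using l m by (simp add: abs_mult)
  also have "\<dots> \<le> l * 1 + m * 1"
    using l m r[of x] assms[of x] by (intro add_mono mult_left_mono) auto
  finally have "\<bar>l * (h x - fwd_avg l h x) + m * (h x - bwd_avg m h x)\<bar> \<le> l + m" by simp
  from mult_left_mono[OF this, of "l * m / (l + m)"] show "\<bar>stein_sol2 l m h x\<bar> \<le> l * m"
    using l m s by (simp add: stein_sol2_def abs_mult)
qed

text \<open>Both averages are 1-Lipschitz with \<open>h\<close>, and they differ from \<open>h\<close> by at most \<open>1 / l\<close> and \<open>1 / m\<close>; these
  distances cancel the rates in front of them in \<open>stein_sol2\<close>.\<close>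
lemma stein_sol_bounds_of_lipschitz:
  assumes lip: "\<And>x y. \<bar>h x - h y\<bar> \<le> \<bar>x - y\<bar>"
  shows "\<bar>stein_sol l m h x - stein_sol l m h y\<bar> \<le> \<bar>x - y\<bar>"
    and "\<bar>stein_sol2 l m h x\<bar> \<le> 2 * (l * m / (l + m))"
    and "\<bar>stein_sol2 l m h x - stein_sol2 l m h y\<bar> \<le> 2 * (l * m) * \<bar>x - y\<bar>"
proof -
  have s: "l + m > 0" using l m by simp
  define \<kappa> where "\<kappa> = l * m / (l + m)"
  have \<kappa>: "\<kappa> > 0" using l m by (simp add: \<kappa>_def)
  note F = fwd_avg_lipschitz[OF l h lip] and B = bwd_avg_lipschitz[OF m h lip]
  have tri: "\<bar>p * u + q * v\<bar> \<le> p * U + q * V" if "0 \<le> p" "0 \<le> q" "\<bar>u\<bar> \<le> U" "\<bar>v\<bar> \<le> V" for p q u v U V :: real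
  proof -
    have "\<bar>p * u + q * v\<bar> \<le> p * \<bar>u\<bar> + q * \<bar>v\<bar>"
      using abs_triangle_ineq[of "p * u" "q * v"] that by (simp add: abs_mult)
    also have "\<dots> \<le> p * U + q * V" using that by (intro add_mono mult_left_mono) auto
    finally show ?thesis .
  qed
  have conv: "\<bar>laplace_avg l m h y - laplace_avg l m h x\<bar> \<le> \<bar>x - y\<bar>"
  proof -
    have "laplace_avg l m h y - laplace_avg l m h x =
       m / (l + m) * (fwd_avg l h y - fwd_avg l h x) + l / (l + m) * (bwd_avg m h y - bwd_avg m h x)"
      by (simp add: laplace_avg_def algebra_simps)
    also have "\<bar>\<dots>\<bar> \<le> m / (l + m) * \<bar>x - y\<bar> + l / (l + m) * \<bar>x - y\<bar>"
      using F(1)[of y x] B(1)[of y x] l m by (intro tri) (auto simp: abs_minus_commute)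
    also have "\<dots> = (m / (l + m) + l / (l + m)) * \<bar>x - y\<bar>" by (rule distrib_right[symmetric])
    also have "m / (l + m) + l / (l + m) = 1" using s by (simp add: add_divide_distrib[symmetric])
    also have "1 * \<bar>x - y\<bar> = \<bar>x - y\<bar>" by simp
    finally show ?thesis .
  qed
  thus "\<bar>stein_sol l m h x - stein_sol l m h y\<bar> \<le> \<bar>x - y\<bar>" by (simp add: stein_sol_def)
  have "\<bar>l * (h x - fwd_avg l h x) + m * (h x - bwd_avg m h x)\<bar> \<le> l * (1 / l) + m * (1 / m)"
    using F(2)[of x] B(2)[of x] l m by (intro tri) (auto simp: abs_minus_commute)
  hence "\<bar>l * (h x - fwd_avg l h x) + m * (h x - bwd_avg m h x)\<bar> \<le> 2" using l m by simp
  from mult_left_mono[OF this, of \<kappa>] show "\<bar>stein_sol2 l m h x\<bar> \<le> 2 * (l * m / (l + m))"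
    using \<kappa> by (simp add: stein_sol2_def abs_mult \<kappa>_def[symmetric])
  have "\<bar>l * (h x - h y - (fwd_avg l h x - fwd_avg l h y)) + m * (h x - h y - (bwd_avg m h x - bwd_avg m h y))\<bar>
      \<le> l * (2 * \<bar>x - y\<bar>) + m * (2 * \<bar>x - y\<bar>)"
  proof (rule tri)
    show "\<bar>h x - h y - (fwd_avg l h x - fwd_avg l h y)\<bar> \<le> 2 * \<bar>x - y\<bar>"
      using add_mono[OF lip[of x y] F(1)[of x y]] by (intro order_trans[OF abs_triangle_ineq4]) simp
    show "\<bar>h x - h y - (bwd_avg m h x - bwd_avg m h y)\<bar> \<le> 2 * \<bar>x - y\<bar>"
      using add_mono[OF lip[of x y] B(1)[of x y]] by (intro order_trans[OF abs_triangle_ineq4]) simp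
  qed (use l m in auto)
  from mult_left_mono[OF this, of \<kappa>] have star: "\<kappa> * \<bar>l * (h x - h y - (fwd_avg l h x - fwd_avg l h y)) + m * (h x - h y - (bwd_avg m h x - bwd_avg m h y))\<bar>
      \<le> \<kappa> * (l * (2 * \<bar>x - y\<bar>) + m * (2 * \<bar>x - y\<bar>))" using \<kappa> by simp
  have "\<bar>stein_sol2 l m h x - stein_sol2 l m h y\<bar> \<le> \<kappa> * (l * (2 * \<bar>x - y\<bar>) + m * (2 * \<bar>x - y\<bar>))"
  proof -
    have "stein_sol2 l m h x - stein_sol2 l m h y =
      \<kappa> * (l * (h x - h y - (fwd_avg l h x - fwd_avg l h y)) + m * (h x - h y - (bwd_avg m h x - bwd_avg m h y)))"
      unfolding stein_sol2_def \<kappa>_def[symmetric] by (simp add: algebra_simps)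
    thus ?thesis using star \<kappa> by (simp add: abs_mult)
  qed
  also have "\<dots> = 2 * (l * m) * \<bar>x - y\<bar>" using s by (simp add: \<kappa>_def field_simps)
  finally show "\<bar>stein_sol2 l m h x - stein_sol2 l m h y\<bar> \<le> 2 * (l * m) * \<bar>x - y\<bar>" .
qed

end

text \<open>Differentiating the Stein equation shows that \<open>f'\<close> is, up to a constant, the Stein solution for
  \<open>g = h'\<close>; hence \<open>f''\<close> is its first derivative, which \<open>stein_sol1_deriv\<close> differentiates once more.\<close>
lemma stein_sol2_deriv_of_smooth:
  assumes l: "l > 0" and m: "m > 0" and h: "quad_growth h" and g: "quad_growth g"
    and d: "\<And>x. (h has_real_derivative g x) (at x)" and lip: "\<And>x y. \<bar>g x - g y\<bar> \<le> \<bar>x - y\<bar>"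
  shows "(stein_sol2 l m h has_real_derivative stein_sol2 l m g x) (at x)"
proof -
  have "stein_sol2 l m h = stein_sol1 l m g"
  proof
    fix x
    have F: "l * (h x - fwd_avg l h x) = - fwd_avg l g x"
      using fwd_avg_deriv_commute[OF l h g d lip, of x] by (simp add: algebra_simps)
    show "stein_sol2 l m h x = stein_sol1 l m g x"
      unfolding stein_sol1_def stein_sol2_def F bwd_avg_deriv_commute[OF m h g d lip, of x] by simp
  qed
  thus ?thesis using stein_sol1_deriv[OF l m g] by simp
qed

section \<open>The asymmetric Laplace distribution\<close>

text \<open>The rates of the two exponential tails; \<open>l\<close> and \<open>- m\<close> are the zeros of \<open>b\<^sup>2 / 2 * t\<^sup>2 + a * t - 1\<close>.\<close>
lemma asym_laplace_rates:
  fixes a b :: real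
  assumes "b > 0"
  defines "D \<equiv> sqrt (2 * b\<^sup>2 + a\<^sup>2)"
  defines "l \<equiv> (D - a) / b\<^sup>2" and "m \<equiv> (D + a) / b\<^sup>2"
  shows "l > 0" "m > 0" "l * m = 2 / b\<^sup>2" "l + m = 2 * D / b\<^sup>2" "1 / l - 1 / m = a" "l * m / (l + m) = 1 / D"
    and "D > 0" "\<bar>a\<bar> \<le> D"
proof -
  have D2: "D\<^sup>2 = 2 * b\<^sup>2 + a\<^sup>2" by (simp add: D_def)
  have "\<bar>a\<bar> < D"
  proof -
    have "sqrt (a\<^sup>2) < D" unfolding D_def using assms(1) by (intro real_sqrt_less_mono) simp
    thus ?thesis by simp
  qed
  thus l: "l > 0" and m: "m > 0" and D: "D > 0" and "\<bar>a\<bar> \<le> D"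
    using assms(1) by (auto simp: l_def m_def)
  have "l * m = (D\<^sup>2 - a\<^sup>2) / (b\<^sup>2 * b\<^sup>2)"
    by (simp add: l_def m_def power2_eq_square algebra_simps)
  also have "\<dots> = 2 / b\<^sup>2" unfolding D2 using assms(1) by (simp add: power2_eq_square)
  finally show lm: "l * m = 2 / b\<^sup>2" .
  show s: "l + m = 2 * D / b\<^sup>2" by (simp add: l_def m_def add_divide_distrib[symmetric])
  have "1 / l - 1 / m = (m - l) / (l * m)" using l m by (simp add: field_simps)
  also have "m - l = 2 * a / b\<^sup>2" by (simp add: l_def m_def diff_divide_distrib[symmetric])
  finally show "1 / l - 1 / m = a" using assms(1) by (simp add: lm)
  show "l * m / (l + m) = 1 / D" using assms(1) D by (simp add: lm s)
qed

lemma asym_laplace_density_alt: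
  fixes a b :: real
  assumes "b > 0"
  defines "D \<equiv> sqrt (2 * b\<^sup>2 + a\<^sup>2)"
  shows "asym_laplace_density a b x = 1 / D * exp (a / b\<^sup>2 * x - D / b\<^sup>2 * \<bar>x\<bar>)"
proof -
  have "2 + a\<^sup>2 / b\<^sup>2 = (2 * b\<^sup>2 + a\<^sup>2) / b\<^sup>2" using assms(1) by (simp add: field_simps)
  hence "sqrt (2 + a\<^sup>2 / b\<^sup>2) = D / b" using assms(1) by (simp add: D_def real_sqrt_divide)
  hence "1 / b * sqrt (2 + a\<^sup>2 / b\<^sup>2) = D / b\<^sup>2" by (simp add: power2_eq_square)
  thus ?thesis unfolding asym_laplace_density_def D_def[symmetric] by simp
qed

text \<open>The point 0 is excluded because both exponential densities are positive there.\<close>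
lemma asym_laplace_density_eq_mixture:
  fixes a b :: real
  assumes "b > 0" "x \<noteq> 0"
  defines "D \<equiv> sqrt (2 * b\<^sup>2 + a\<^sup>2)"
  defines "l \<equiv> (D - a) / b\<^sup>2" and "m \<equiv> (D + a) / b\<^sup>2"
  shows "asym_laplace_density a b x =
    m / (l + m) * exponential_density l x + l / (l + m) * exponential_density m (- x)"
proof -
  note r = asym_laplace_rates[OF assms(1), of a, folded D_def, folded l_def m_def]
  note p = asym_laplace_density_alt[OF assms(1), of a x, folded D_def]
  have c: "m / (l + m) * l = 1 / D" "l / (l + m) * m = 1 / D" using r(6) by (simp_all add: mult.commute)
  show ?thesis
  proof (cases "x > 0")
    case True
    hence "a / b\<^sup>2 * x - D / b\<^sup>2 * \<bar>x\<bar> = - x * l" by (simp add: l_def diff_divide_distrib algebra_simps)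
    moreover have "m / (l + m) * (l * exp (- x * l)) = 1 / D * exp (- x * l)"
      unfolding mult.assoc[symmetric] c ..
    ultimately show ?thesis using True p by (simp add: exponential_density_def)
  next
    case False
    hence "a / b\<^sup>2 * x - D / b\<^sup>2 * \<bar>x\<bar> = - (- x) * m" using assms(2) by (simp add: m_def add_divide_distrib algebra_simps)
    moreover have "l / (l + m) * (m * exp (- (- x) * m)) = 1 / D * exp (- (- x) * m)"
      unfolding mult.assoc[symmetric] c ..
    ultimately show ?thesis using False assms(2) p by (simp add: exponential_density_def)
  qed
qed

lemma has_bochner_integral_exponential_density:
  assumes "l > 0" "quad_growth h"
  shows "has_bochner_integral lborel (\<lambda>x. exponential_density l x * h x) (fwd_avg l h 0)"
proof -
  note [measurable] = quad_growth_measurable[OF assms(2)]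
  have "has_bochner_integral (exp_measure l) (\<lambda>u. h (0 + u)) (fwd_avg l h 0)"
    unfolding fwd_avg_def by (rule has_bochner_integral_integrable[OF integrable_shift_exp_measure[OF assms]])
  thus ?thesis
    unfolding exp_measure_def has_bochner_integral_iff using assms(1)
    by (auto simp: integrable_density integral_density exponential_density_nonneg)
qed

lemma asym_laplace_expectation:
  fixes a b :: real
  assumes "b > 0" and Z: "asym_laplace_distributed N Z a b" and h: "quad_growth h"
  defines "D \<equiv> sqrt (2 * b\<^sup>2 + a\<^sup>2)"
  defines "l \<equiv> (D - a) / b\<^sup>2" and "m \<equiv> (D + a) / b\<^sup>2"
  shows "(\<integral>\<omega>. h (Z \<omega>) \<partial>N) = laplace_avg l m h 0"
proof -
  note r = asym_laplace_rates[OF assms(1), of a, folded D_def, folded l_def m_def]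
  note [measurable] = quad_growth_measurable[OF h]
  have "has_bochner_integral lborel (\<lambda>x. exponential_density m (- x) * h x) (bwd_avg m h 0)"
  proof -
    have "has_bochner_integral lborel (\<lambda>x. exponential_density m x * h (- x)) (bwd_avg m h 0)"
      using has_bochner_integral_exponential_density[OF r(2) quad_growth_uminus[OF h]] by (simp add: bwd_avg_eq)
    from lborel_has_bochner_integral_real_affine_iff[THEN iffD1, OF _ this, of "-1" 0]
    show ?thesis by simp
  qed
  hence "has_bochner_integral lborel
      (\<lambda>x. m / (l + m) * (exponential_density l x * h x) + l / (l + m) * (exponential_density m (- x) * h x))
      (laplace_avg l m h 0)"
    unfolding laplace_avg_def
    by (intro has_bochner_integral_add has_bochner_integral_mult_right has_bochner_integral_exponential_density r h)
  hence "laplace_avg l m h 0 = (\<integral>x. m / (l + m) * (exponential_density l x * h x) + l / (l + m) * (exponential_density m (- x) * h x) \<partial>lborel)"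
    by (simp add: has_bochner_integral_iff)
  also have "\<dots> = (\<integral>x. asym_laplace_density a b x * h x \<partial>lborel)"
  proof (rule integral_cong_AE)
    show "AE x in lborel. m / (l + m) * (exponential_density l x * h x) + l / (l + m) * (exponential_density m (- x) * h x)
        = asym_laplace_density a b x * h x"
      using AE_lborel_singleton[of 0]
    proof eventually_elim
      case (elim x)
      thus ?case
        using asym_laplace_density_eq_mixture[OF assms(1), of x a, folded D_def, folded l_def m_def]
        by (simp add: algebra_simps)
    qed
    show "(\<lambda>x. asym_laplace_density a b x * h x) \<in> borel_measurable lborel"
      unfolding asym_laplace_density_def by measurable
  qed measurable
  also have "\<dots> = (\<integral>\<omega>. h (Z \<omega>) \<partial>N)"
    using Z assms(1) unfolding asym_laplace_distributed_def
    by (intro distributed_integral) (auto simp: asym_laplace_density_def)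
  finally show ?thesis by simp
qed

lemma asym_laplace_density_le:
  assumes "b > 0" shows "asym_laplace_density a b x \<le> 1 / sqrt (2 * b\<^sup>2 + a\<^sup>2)"
proof -
  note r = asym_laplace_rates[OF assms, of a]
  have "a * x \<le> \<bar>a\<bar> * \<bar>x\<bar>" by (metis abs_ge_self abs_mult)
  also have "\<dots> \<le> sqrt (2 * b\<^sup>2 + a\<^sup>2) * \<bar>x\<bar>" using r(8) by (intro mult_right_mono) auto
  finally have "a / b\<^sup>2 * x - sqrt (2 * b\<^sup>2 + a\<^sup>2) / b\<^sup>2 * \<bar>x\<bar> \<le> 0"
    by (simp add: divide_right_mono)
  thus ?thesis
    using r(7) unfolding asym_laplace_density_alt[OF assms] by (simp add: divide_right_mono)
qed

text \<open>This is what allows half-lines to be shifted at a cost proportional to the shift.\<close>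
lemma asym_laplace_interval_le:
  assumes "b > 0" and N: "prob_space N" and Z: "asym_laplace_distributed N Z a b" and "u \<le> v"
  shows "measure N {\<omega> \<in> space N. Z \<omega> \<le> v} - measure N {\<omega> \<in> space N. Z \<omega> \<le> u} \<le> (v - u) / sqrt (2 * b\<^sup>2 + a\<^sup>2)"
proof -
  interpret prob_space N by fact
  note D = Z[unfolded asym_laplace_distributed_def]
  note [measurable] = distributed_measurable[OF D]
  have "emeasure N (Z -` {u<..v} \<inter> space N) = (\<integral>\<^sup>+x. ennreal (asym_laplace_density a b x) * indicator {u<..v} x \<partial>lborel)"
    by (rule distributed_emeasure[OF D]) simp
  also have "\<dots> \<le> (\<integral>\<^sup>+x. ennreal (1 / sqrt (2 * b\<^sup>2 + a\<^sup>2)) * indicator {u<..v} x \<partial>lborel)"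
    by (intro nn_integral_mono mult_right_mono ennreal_leI asym_laplace_density_le assms(1)) auto
  also have "\<dots> = ennreal ((v - u) / sqrt (2 * b\<^sup>2 + a\<^sup>2))"
    using \<open>u \<le> v\<close> by (simp add: nn_integral_cmult_indicator ennreal_mult[symmetric])
  finally have "prob (Z -` {u<..v} \<inter> space N) \<le> (v - u) / sqrt (2 * b\<^sup>2 + a\<^sup>2)"
    using \<open>u \<le> v\<close> by (simp add: emeasure_eq_measure)
  moreover have "Z -` {u<..v} \<inter> space N = {\<omega> \<in> space N. Z \<omega> \<le> v} - {\<omega> \<in> space N. Z \<omega> \<le> u}" by auto
  moreover have "prob ({\<omega> \<in> space N. Z \<omega> \<le> v} - {\<omega> \<in> space N. Z \<omega> \<le> u}) =
      prob {\<omega> \<in> space N. Z \<omega> \<le> v} - prob {\<omega> \<in> space N. Z \<omega> \<le> u}"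
    using \<open>u \<le> v\<close> by (intro finite_measure_Diff) auto
  ultimately show ?thesis by simp
qed

section \<open>The asymmetric equilibrium identity\<close>

text \<open>On a compact interval the continuous derivative is bounded, so \<open>f\<close> is Lipschitz there.\<close>
lemma locally_abs_continuous_of_C1:
  assumes d: "\<And>x. (f has_real_derivative f1 x) (at x)" and c: "continuous_on UNIV f1"
  shows "locally_abs_continuous f"
  unfolding locally_abs_continuous_def abs_continuous_on_def
proof (intro allI impI)
  fix x y \<epsilon> :: real assume "\<epsilon> > 0"
  have "bounded (f1 ` {x..y})"
    by (intro compact_imp_bounded compact_continuous_image continuous_on_subset[OF c]) auto
  then obtain B where "B > 0" and B: "\<And>t. t \<in> {x..y} \<Longrightarrow> \<bar>f1 t\<bar> \<le> B"
    by (auto simp: bounded_pos)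
  have lip: "\<bar>f v - f u\<bar> \<le> B * (v - u)" if "u \<le> v" "{u..v} \<subseteq> {x..y}" for u v
  proof -
    have "norm (f v - f u) \<le> B * norm (v - u)"
      using d B that by (intro field_differentiable_bound[of "{u..v}" f f1])
        (auto intro: has_field_derivative_at_within)
    thus ?thesis using that by simp
  qed
  show "\<exists>\<delta>>0. \<forall>D. finite D \<and> (\<forall>(u, v)\<in>D. u \<le> v \<and> {u..v} \<subseteq> {x..y}) \<and>
      disjoint_family_on (\<lambda>(u, v). {u<..<v}) D \<and> (\<Sum>(u, v)\<in>D. v - u) < \<delta> \<longrightarrow>
      (\<Sum>(u, v)\<in>D. \<bar>f v - f u\<bar>) < \<epsilon>"
  proof (intro exI[of _ "\<epsilon> / B"] conjI allI impI)
    show "\<epsilon> / B > 0" using \<open>\<epsilon> > 0\<close> \<open>B > 0\<close> by simp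
    fix D :: "(real \<times> real) set"
    assume D: "finite D \<and> (\<forall>(u, v)\<in>D. u \<le> v \<and> {u..v} \<subseteq> {x..y}) \<and>
      disjoint_family_on (\<lambda>(u, v). {u<..<v}) D \<and> (\<Sum>(u, v)\<in>D. v - u) < \<epsilon> / B"
    have "(\<Sum>(u, v)\<in>D. \<bar>f v - f u\<bar>) \<le> (\<Sum>(u, v)\<in>D. B * (v - u))"
      using D by (intro sum_mono) (auto intro!: lip)
    also have "\<dots> = B * (\<Sum>(u, v)\<in>D. v - u)" by (simp add: sum_distrib_left case_prod_beta)
    also have "\<dots> < \<epsilon>" using D \<open>B > 0\<close> by (simp add: field_simps)
    finally show "(\<Sum>(u, v)\<in>D. \<bar>f v - f u\<bar>) < \<epsilon>" .
  qed
qed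

text \<open>The defining identity restricted to twice continuously differentiable functions, where
  \<open>deriv (deriv f)\<close> is a genuine second derivative everywhere.\<close>
lemma asym_equilibrium_identity:
  assumes eq: "has_asym_equilibrium M W N V"
    and d: "\<And>x. (f has_real_derivative f1 x) (at x)" and d1: "\<And>x. (f1 has_real_derivative f2 x) (at x)"
    and c: "continuous_on UNIV f2"
    and int: "integrable M (\<lambda>\<omega>. f (W \<omega>))" "integrable M (\<lambda>\<omega>. f1 (W \<omega>))" "integrable N (\<lambda>\<omega>. f2 (V \<omega>))"
    and a: "prob_space.expectation M W = a" and v: "prob_space.variance M W = v"
  shows "(v - a\<^sup>2) / 2 * (\<integral>\<omega>. f2 (V \<omega>) \<partial>N) = (\<integral>\<omega>. f (W \<omega>) - f 0 - a * f1 (W \<omega>) \<partial>M)"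
proof -
  have f1: "deriv f = f1" and f2: "deriv f1 = f2"
    using d d1 by (auto intro: DERIV_imp_deriv)
  have "continuous_on UNIV f1" using d1 by (meson DERIV_isCont continuous_at_imp_continuous_on)
  hence "locally_abs_continuous f" "locally_abs_continuous f1"
    using locally_abs_continuous_of_C1 d d1 c by blast+
  moreover have "\<forall>x. f differentiable (at x)" using d real_differentiable_def by blast
  ultimately show ?thesis
    using eq[unfolded has_asym_equilibrium_def Let_def a v[unfolded a], THEN conjunct2, THEN spec[of _ f]] int
    unfolding f1 f2 by simp
qed

lemma antiderivative_powr_bound:
  fixes g G :: "real \<Rightarrow> real"
  assumes d: "\<And>x. (G has_real_derivative g x) (at x)" and G0: "G 0 = 0" and "j \<ge> 0"
    and g: "\<And>x. \<bar>g x\<bar> \<le> \<bar>x\<bar> powr j"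
  shows "\<bar>G x\<bar> \<le> \<bar>x\<bar> powr (j + 1)"
proof -
  have "norm (G x - G 0) \<le> \<bar>x\<bar> powr j * norm (x - 0)"
  proof (rule field_differentiable_bound[of "{- \<bar>x\<bar>..\<bar>x\<bar>}" G g])
    show "norm (g t) \<le> \<bar>x\<bar> powr j" if "t \<in> {- \<bar>x\<bar>..\<bar>x\<bar>}" for t
    proof -
      have "\<bar>t\<bar> \<le> \<bar>x\<bar>" using that by auto
      thus ?thesis using g[of t] powr_mono2[of j "\<bar>t\<bar>" "\<bar>x\<bar>"] \<open>j \<ge> 0\<close> by simp
    qed
  qed (use d in \<open>auto intro: has_field_derivative_at_within\<close>)
  also have "\<bar>x\<bar> powr j * norm (x - 0) = \<bar>x\<bar> powr (j + 1)"
    by (simp add: powr_add)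
  finally show ?thesis using G0 by simp
qed

lemma integrable_powr_le:
  fixes U :: "'a \<Rightarrow> real"
  assumes "prob_space M" and U: "U \<in> borel_measurable M" and int: "integrable M (\<lambda>\<omega>. \<bar>U \<omega>\<bar> powr p)" and "0 \<le> j" "j \<le> p"
  shows "integrable M (\<lambda>\<omega>. \<bar>U \<omega>\<bar> powr j)"
proof -
  interpret prob_space M by fact
  note [measurable] = U
  have le: "\<bar>x\<bar> powr j \<le> 1 + \<bar>x\<bar> powr p" for x :: real
  proof (cases "\<bar>x\<bar> \<le> 1")
    case True
    hence "\<bar>x\<bar> powr j \<le> 1" using \<open>0 \<le> j\<close> powr_mono2[of j "\<bar>x\<bar>" 1] by simp
    thus ?thesis by (simp add: add_increasing2)
  next
    case False
    hence "\<bar>x\<bar> powr j \<le> \<bar>x\<bar> powr p" using \<open>j \<le> p\<close> by (intro powr_mono) auto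
    thus ?thesis by simp
  qed
  show ?thesis
  proof (rule Bochner_Integration.integrable_bound)
    show "integrable M (\<lambda>\<omega>. 1 + \<bar>U \<omega>\<bar> powr p)" using int by simp
    show "AE \<omega> in M. norm (\<bar>U \<omega>\<bar> powr j) \<le> norm (1 + \<bar>U \<omega>\<bar> powr p)"
    proof (intro always_eventually allI)
      show "norm (\<bar>U \<omega>\<bar> powr j) \<le> norm (1 + \<bar>U \<omega>\<bar> powr p)" for \<omega> using le[of "U \<omega>"] by simp
    qed
  qed measurable
qed

text \<open>Test the identity with \<open>f''\<close> equal to \<open>\<bar>x\<bar> powr k\<close> truncated at height \<open>n powr k\<close>. Then \<open>f\<close> and \<open>f'\<close> are
  dominated by powers of \<open>\<bar>x\<bar>\<close> independently of \<open>n\<close>, and monotone convergence applies.\<close>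
lemma asym_equilibrium_moment:
  assumes M: "prob_space M" and N: "prob_space N" and W: "W \<in> borel_measurable M"
    and eq: "has_asym_equilibrium M W N V"
    and a: "prob_space.expectation M W = a" and v: "prob_space.variance M W = v" and "v > a\<^sup>2"
    and "k > 0" and int: "integrable M (\<lambda>\<omega>. \<bar>W \<omega>\<bar> powr (k + 2))"
  shows "integrable N (\<lambda>\<omega>. \<bar>V \<omega>\<bar> powr k)"
proof -
  interpret N: prob_space N by fact
  have V[measurable]: "V \<in> borel_measurable N" using eq by (simp add: has_asym_equilibrium_def)
  note [measurable] = W
  define C where "C = 2 / (v - a\<^sup>2) * (\<integral>\<omega>. \<bar>W \<omega>\<bar> powr (k + 2) + \<bar>a\<bar> * \<bar>W \<omega>\<bar> powr (k + 1) \<partial>M)"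
  have int1: "integrable M (\<lambda>\<omega>. \<bar>W \<omega>\<bar> powr (k + 1))"
    using integrable_powr_le[OF M W int, of "k + 1"] \<open>k > 0\<close> by simp
  define g where "g n x = (min \<bar>x\<bar> (real n)) powr k" for n x
  have gc: "continuous_on UNIV (g n)" for n
    unfolding g_def[abs_def] using \<open>k > 0\<close> by (intro continuous_on_powr' continuous_intros) auto
  have gm[measurable]: "g n \<in> borel_measurable borel" for n using gc by (rule borel_measurable_continuous_onI)
  have g_le: "\<bar>g n x\<bar> \<le> \<bar>x\<bar> powr k" "\<bar>g n x\<bar> \<le> real n powr k" for n x
    using \<open>k > 0\<close> by (auto simp: g_def intro!: powr_mono2)
  have gint: "integrable N (\<lambda>\<omega>. g n (V \<omega>))" for n
    by (rule N.integrable_const_bound[of _ "real n powr k"]) (use g_le in auto)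
  have bound: "(\<integral>\<omega>. g n (V \<omega>) \<partial>N) \<le> C" for n
  proof -
    obtain f1 where f1: "\<And>x. (f1 has_real_derivative g n x) (at x)" "f1 0 = 0"
      using continuous_imp_antiderivative[OF gc[of n]] by metis
    have c1: "continuous_on UNIV f1" using f1 by (meson DERIV_isCont continuous_at_imp_continuous_on)
    obtain f where f: "\<And>x. (f has_real_derivative f1 x) (at x)" "f 0 = 0"
      using continuous_imp_antiderivative[OF c1] by metis
    have c: "continuous_on UNIV f" using f by (meson DERIV_isCont continuous_at_imp_continuous_on)
    note [measurable] = borel_measurable_continuous_onI[OF c] borel_measurable_continuous_onI[OF c1]
    have b1: "\<bar>f1 x\<bar> \<le> \<bar>x\<bar> powr (k + 1)" for x
      using antiderivative_powr_bound[OF f1, of k] \<open>k > 0\<close> g_le by simp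
    have b: "\<bar>f x\<bar> \<le> \<bar>x\<bar> powr (k + 2)" for x
      using antiderivative_powr_bound[OF f, of "k + 1"] \<open>k > 0\<close> b1 by (simp add: add.assoc)
    have if1: "integrable M (\<lambda>\<omega>. f1 (W \<omega>))"
      by (rule Bochner_Integration.integrable_bound[OF int1]) (use b1 in auto)
    have iff: "integrable M (\<lambda>\<omega>. f (W \<omega>))"
      by (rule Bochner_Integration.integrable_bound[OF int]) (use b in auto)
    have "(v - a\<^sup>2) / 2 * (\<integral>\<omega>. g n (V \<omega>) \<partial>N) = (\<integral>\<omega>. f (W \<omega>) - f 0 - a * f1 (W \<omega>) \<partial>M)"
      by (rule asym_equilibrium_identity[OF eq f(1) f1(1) gc iff if1 gint a v])
    also have "\<dots> \<le> (\<integral>\<omega>. \<bar>W \<omega>\<bar> powr (k + 2) + \<bar>a\<bar> * \<bar>W \<omega>\<bar> powr (k + 1) \<partial>M)"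
    proof (rule integral_mono)
      fix \<omega>
      have "- (a * f1 (W \<omega>)) \<le> \<bar>a\<bar> * \<bar>f1 (W \<omega>)\<bar>" by (metis abs_ge_minus_self abs_mult)
      also have "\<dots> \<le> \<bar>a\<bar> * \<bar>W \<omega>\<bar> powr (k + 1)" by (intro mult_left_mono b1) simp
      finally show "f (W \<omega>) - f 0 - a * f1 (W \<omega>) \<le> \<bar>W \<omega>\<bar> powr (k + 2) + \<bar>a\<bar> * \<bar>W \<omega>\<bar> powr (k + 1)"
        using b[of "W \<omega>"] f(2) by linarith
    qed (use if1 iff int int1 f(2) in auto)
    finally show ?thesis using \<open>v > a\<^sup>2\<close> by (simp add: C_def field_simps)
  qed
  have mono: "g i x \<le> g j x" if "i \<le> j" for i j x
    using that \<open>k > 0\<close> by (auto simp: g_def intro!: powr_mono2)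
  have "incseq (\<lambda>n. \<integral>\<omega>. g n (V \<omega>) \<partial>N)"
    by (intro incseq_SucI integral_mono gint mono) auto
  then obtain L where L: "(\<lambda>n. \<integral>\<omega>. g n (V \<omega>) \<partial>N) \<longlonglongrightarrow> L"
    using bound incseq_convergent by metis
  have "AE \<omega> in N. mono (\<lambda>n. g n (V \<omega>))" using mono by (intro always_eventually) (simp add: mono_def)
  moreover have "AE \<omega> in N. (\<lambda>n. g n (V \<omega>)) \<longlonglongrightarrow> \<bar>V \<omega>\<bar> powr k"
  proof (rule always_eventually, rule allI, rule tendsto_eventually)
    fix \<omega>
    obtain n0 where "\<bar>V \<omega>\<bar> \<le> real n0" using real_arch_simple by blast
    hence "\<forall>n\<ge>n0. g n (V \<omega>) = \<bar>V \<omega>\<bar> powr k"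
      unfolding g_def by (metis min.absorb1 of_nat_mono order_trans)
    thus "\<forall>\<^sub>F n in sequentially. g n (V \<omega>) = \<bar>V \<omega>\<bar> powr k"
      unfolding eventually_sequentially by blast
  qed
  ultimately show ?thesis
    by (rule integrable_monotone_convergence[OF gint _ _ L]) measurable
qed

section \<open>Test functions of the three distances\<close>

lemma quad_growth_of_unit_range:
  assumes "continuous_on UNIV h" "\<And>x. 0 \<le> h x" "\<And>x. h x \<le> 1" shows "quad_growth h"
proof -
  have "\<bar>h x\<bar> \<le> 1 * (1 + x\<^sup>2)" for x using assms(2,3)[of x] by (simp add: add_increasing2)
  thus ?thesis using assms(1) unfolding quad_growth_def by (intro conjI exI[of _ 1]) auto
qed

lemma abs_le_1_plus_square: "\<bar>x\<bar> \<le> 1 + (x::real)\<^sup>2"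
proof -
  have "0 \<le> (\<bar>x\<bar> - 1)\<^sup>2" by simp
  hence "2 * \<bar>x\<bar> \<le> 1 + x\<^sup>2" by (simp add: power2_diff)
  thus ?thesis by linarith
qed

lemma continuous_of_lipschitz:
  fixes h :: "real \<Rightarrow> real"
  assumes "\<And>x y. \<bar>h x - h y\<bar> \<le> B * \<bar>x - y\<bar>" shows "continuous_on X h"
proof -
  have "0 \<le> B" using assms[of 0 1] by simp
  hence "B-lipschitz_on X h" using assms by (intro lipschitz_onI) (auto simp: dist_real_def)
  thus ?thesis by (rule lipschitz_on_continuous_on)
qed

lemma quad_growth_of_lipschitz:
  assumes lip: "\<And>x y. \<bar>h x - h y\<bar> \<le> \<bar>x - y\<bar>" shows "quad_growth h"
proof -
  have "\<bar>h x\<bar> \<le> (\<bar>h 0\<bar> + 1) * (1 + x\<^sup>2)" for x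
  proof -
    have "\<bar>h x\<bar> \<le> \<bar>h 0\<bar> + \<bar>x\<bar>" using lip[of x 0] by simp
    also have "\<dots> \<le> \<bar>h 0\<bar> * (1 + x\<^sup>2) + 1 * (1 + x\<^sup>2)"
      using abs_le_1_plus_square[of x] mult_left_mono[of 1 "1 + x\<^sup>2" "\<bar>h 0\<bar>"] by simp
    finally show ?thesis by (simp add: algebra_simps)
  qed
  moreover have "continuous_on UNIV h" using continuous_of_lipschitz[of h 1] lip by simp
  ultimately show ?thesis unfolding quad_growth_def by (intro conjI exI[of _ "\<bar>h 0\<bar> + 1"]) auto
qed

lemma quad_growth_of_lipschitz_deriv:
  assumes d: "\<And>x. (h has_real_derivative g x) (at x)" and lip: "\<And>x y. \<bar>g x - g y\<bar> \<le> \<bar>x - y\<bar>"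
  shows "quad_growth h"
proof -
  have "\<bar>h x\<bar> \<le> (\<bar>h 0\<bar> + \<bar>g 0\<bar> + 1) * (1 + x\<^sup>2)" for x
  proof -
    have "\<bar>h x - h 0 - g 0 * x\<bar> \<le> x\<^sup>2 / 2"
      using taylor_remainder_le[of h g 1 x 0] d lip by simp
    hence "\<bar>h x\<bar> \<le> \<bar>h 0\<bar> + \<bar>g 0\<bar> * \<bar>x\<bar> + 1 * x\<^sup>2"
      unfolding abs_mult[symmetric] using zero_le_power2[of x] by linarith
    also have "\<dots> \<le> \<bar>h 0\<bar> * (1 + x\<^sup>2) + \<bar>g 0\<bar> * (1 + x\<^sup>2) + 1 * (1 + x\<^sup>2)"
      using mult_left_mono[of 1 "1 + x\<^sup>2" "\<bar>h 0\<bar>"] mult_left_mono[OF abs_le_1_plus_square[of x], of "\<bar>g 0\<bar>"]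
      by (intro add_mono) auto
    finally show ?thesis by (simp add: algebra_simps)
  qed
  moreover have "continuous_on UNIV h" using d by (meson DERIV_isCont continuous_at_imp_continuous_on)
  ultimately show ?thesis unfolding quad_growth_def by (intro conjI exI[of _ "\<bar>h 0\<bar> + \<bar>g 0\<bar> + 1"]) auto
qed

text \<open>Piecewise linear functions with values in \<open>[0, 1]\<close> decrease to the indicator of a half-line.\<close>
lemma cdf_diff_le_of_continuous_tests:
  fixes X :: "'a \<Rightarrow> real" and Y :: "'b \<Rightarrow> real"
  assumes M: "prob_space M" and N: "prob_space N"
    and X[measurable]: "X \<in> borel_measurable M" and Y[measurable]: "Y \<in> borel_measurable N"
    and c: "\<And>h. continuous_on UNIV h \<Longrightarrow> (\<And>x. 0 \<le> h x) \<Longrightarrow> (\<And>x. h x \<le> 1) \<Longrightarrow>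
      \<bar>(\<integral>\<omega>. h (X \<omega>) \<partial>M) - (\<integral>\<omega>. h (Y \<omega>) \<partial>N)\<bar> \<le> c"
  shows "\<bar>measure M {\<omega> \<in> space M. X \<omega> \<le> z} - measure N {\<omega> \<in> space N. Y \<omega> \<le> z}\<bar> \<le> c"
proof -
  define h where "h n x = max 0 (min 1 (1 - real n * (x - z)))" for n x
  have hc: "continuous_on UNIV (h n)" for n unfolding h_def[abs_def] by (intro continuous_intros)
  have hm[measurable]: "h n \<in> borel_measurable borel" for n using hc by (rule borel_measurable_continuous_onI)
  have h01: "0 \<le> h n x" "h n x \<le> 1" for n x by (auto simp: h_def)
  have hlim: "(\<lambda>n. h n x) \<longlonglongrightarrow> indicat_real {..z} x" for x
  proof (cases "x \<le> z")
    case True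
    hence "h n x = 1" for n by (auto simp: h_def mult_nonneg_nonpos)
    thus ?thesis using True by simp
  next
    case False
    then obtain n0 where n0: "1 / (x - z) < real n0" using reals_Archimedean2 by blast
    have "h n x = 0" if "n \<ge> n0" for n
    proof -
      have "1 < real n0 * (x - z)" using n0 False by (simp add: field_simps)
      also have "\<dots> \<le> real n * (x - z)" using that False by (intro mult_right_mono) auto
      finally show ?thesis by (auto simp: h_def)
    qed
    hence "\<forall>\<^sub>F n in sequentially. h n x = 0" by (auto simp: eventually_sequentially)
    thus ?thesis using False by (simp add: tendsto_eventually)
  qed
  have lim: "(\<lambda>n. \<integral>\<omega>. h n (U \<omega>) \<partial>P) \<longlonglongrightarrow> measure P {\<omega> \<in> space P. U \<omega> \<le> z}"
    if P: "prob_space P" and U[measurable]: "U \<in> borel_measurable P" for P :: "'c measure" and U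
  proof -
    interpret prob_space P by fact
    have "(\<lambda>n. \<integral>\<omega>. h n (U \<omega>) \<partial>P) \<longlonglongrightarrow> (\<integral>\<omega>. indicat_real {..z} (U \<omega>) \<partial>P)"
    proof (rule integral_dominated_convergence[where w = "\<lambda>_. 1"])
      show "AE \<omega> in P. norm (h n (U \<omega>)) \<le> 1" for n using h01 by auto
    qed (use hlim in auto)
    also have "(\<integral>\<omega>. indicat_real {..z} (U \<omega>) \<partial>P) = (\<integral>\<omega>. indicat_real {\<omega> \<in> space P. U \<omega> \<le> z} \<omega> \<partial>P)"
      by (intro Bochner_Integration.integral_cong) (auto simp: indicator_def)
    also have "\<dots> = measure P {\<omega> \<in> space P. U \<omega> \<le> z}" by simp
    finally show ?thesis .
  qed
  have "(\<lambda>n. \<bar>(\<integral>\<omega>. h n (X \<omega>) \<partial>M) - (\<integral>\<omega>. h n (Y \<omega>) \<partial>N)\<bar>) \<longlonglongrightarrow>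
     \<bar>measure M {\<omega> \<in> space M. X \<omega> \<le> z} - measure N {\<omega> \<in> space N. Y \<omega> \<le> z}\<bar>"
    by (intro tendsto_rabs tendsto_diff lim M N X Y)
  thus ?thesis by (rule LIMSEQ_le_const2) (use c hc h01 in auto)
qed

lemma d_K_le:
  assumes "\<And>z. \<bar>measure M {\<omega> \<in> space M. X \<omega> \<le> z} - measure N {\<omega> \<in> space N. Y \<omega> \<le> z}\<bar> \<le> c"
  shows "d_K M X N Y \<le> ereal c"
proof -
  have "(\<integral>\<omega>. indicat_real {..z} (U \<omega>) \<partial>P) = measure P {\<omega> \<in> space P. U \<omega> \<le> z}" for U :: "'c \<Rightarrow> real" and P z
  proof -
    have "(\<integral>\<omega>. indicat_real {..z} (U \<omega>) \<partial>P) = (\<integral>\<omega>. indicat_real {\<omega> \<in> space P. U \<omega> \<le> z} \<omega> \<partial>P)"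
      by (intro Bochner_Integration.integral_cong) (auto simp: indicator_def)
    also have "\<dots> = measure P ({\<omega> \<in> space P. U \<omega> \<le> z} \<inter> space P)" by simp
    also have "{\<omega> \<in> space P. U \<omega> \<le> z} \<inter> space P = {\<omega> \<in> space P. U \<omega> \<le> z}" by blast
    finally show ?thesis .
  qed
  note * = this
  show ?thesis unfolding prob_dist_def H_K_def using assms by (auto intro!: SUP_least simp: *)
qed

lemma H_W_lipschitz:
  assumes "h \<in> H_W" shows "\<bar>h x - h y\<bar> \<le> \<bar>x - y\<bar>"
proof -
  obtain L where L: "L-lipschitz_on UNIV h" and e: "ess_sup_norm (deriv h) \<le> 1"
    using assms by (auto simp: H_W_def)
  have "AE x in lborel. \<bar>deriv h x\<bar> \<le> 1"
    using esssup_AE[of "\<lambda>x. ereal \<bar>deriv h x\<bar>" lborel]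
  proof eventually_elim
    case (elim x)
    hence "ereal \<bar>deriv h x\<bar> \<le> 1" using e unfolding ess_sup_norm_def by (rule order_trans)
    thus ?case by (simp add: one_ereal_def)
  qed
  from lipschitz_of_AE_deriv_le[OF L this, of x y] show ?thesis by (simp add: abs_minus_commute)
qed

lemma H_2_deriv_in_H_W: "h \<in> H_2 \<Longrightarrow> deriv h \<in> H_W"
  by (auto simp: H_2_def H_W_def)

lemma lipschitz_integrable:
  fixes h :: "real \<Rightarrow> real"
  assumes M: "prob_space M" and U[measurable]: "U \<in> borel_measurable M" and int: "integrable M (\<lambda>\<omega>. \<bar>U \<omega>\<bar>)"
    and lip: "\<And>x y. \<bar>h x - h y\<bar> \<le> B * \<bar>x - y\<bar>"
  shows "integrable M (\<lambda>\<omega>. h (U \<omega>))"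
proof (rule Bochner_Integration.integrable_bound)
  interpret prob_space M by fact
  note [measurable] = borel_measurable_continuous_onI[OF continuous_of_lipschitz[OF lip]]
  show "(\<lambda>\<omega>. h (U \<omega>)) \<in> borel_measurable M" by measurable
  show "integrable M (\<lambda>\<omega>. \<bar>h 0\<bar> + B * \<bar>U \<omega>\<bar>)" using int by simp
  show "AE \<omega> in M. norm (h (U \<omega>)) \<le> norm (\<bar>h 0\<bar> + B * \<bar>U \<omega>\<bar>)"
  proof (rule always_eventually, rule allI)
    show "norm (h (U \<omega>)) \<le> norm (\<bar>h 0\<bar> + B * \<bar>U \<omega>\<bar>)" for \<omega>
      using lip[of "U \<omega>" 0] by simp
  qed
qed

section \<open>Bounds for a coupled equilibrium distribution\<close>

text \<open>If \<open>B = 0\<close>, small \<open>\<beta>\<close> force \<open>d \<le> 0\<close>. Otherwise take \<open>\<beta> = T / K\<close>, where \<open>T\<close> is the claimed bound. Then \<open>K * \<beta> = T\<close>, and \<open>B * \<beta> powr (- k) \<le> T\<close>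
  because \<open>k + k powr (- k) \<ge> 1\<close>; the coefficients \<open>2 / 7\<close> and \<open>2 / 5\<close> add up to less than 1.\<close>
lemma optimize_tail_bound:
  fixes d K B k :: real
  assumes "K > 0" "B \<ge> 0" "k \<ge> 1"
    and bound: "\<And>\<beta>. \<beta> > 0 \<Longrightarrow> d \<le> 2 / 7 * (K * \<beta>) + 2 / 5 * (B * \<beta> powr (- k))"
  shows "d \<le> K powr (k / (k + 1)) * ((k + k powr (- k)) * B) powr (1 / (k + 1))"
proof (cases "B = 0")
  case True
  have "d \<le> 0"
  proof (rule ccontr)
    assume "\<not> d \<le> 0"
    hence "d \<le> 2 / 7 * d" using bound[of "d / K"] True \<open>K > 0\<close> by simp
    thus False using \<open>\<not> d \<le> 0\<close> by simp
  qed
  thus ?thesis using True by simp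
next
  case False
  hence "B > 0" using assms by simp
  define q where "q = k + k powr (- k)"
  have "q \<ge> 1" using \<open>k \<ge> 1\<close> by (simp add: q_def add_increasing2)
  \<comment> \<open>The claimed bound; it determines the value of \<open>\<beta>\<close>.\<close>
  define T where "T = K powr (k / (k + 1)) * (q * B) powr (1 / (k + 1))"
  have "T > 0" using \<open>K > 0\<close> \<open>B > 0\<close> \<open>q \<ge> 1\<close> by (simp add: T_def)
  have "T powr (k + 1) = K powr k * (q * B)"
  proof -
    have "k / (k + 1) * (k + 1) = k" "1 / (k + 1) * (k + 1) = 1" using \<open>k \<ge> 1\<close> by simp_all
    thus ?thesis unfolding T_def using \<open>K > 0\<close> \<open>B > 0\<close> \<open>q \<ge> 1\<close>
      by (subst powr_mult) (simp_all only: powr_powr, simp)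
  qed
  moreover have "K powr k * (1 * B) \<le> K powr k * (q * B)"
    using \<open>q \<ge> 1\<close> \<open>B > 0\<close> by (intro mult_left_mono mult_right_mono) auto
  ultimately have *: "K powr k * B \<le> T powr (k + 1)" by simp
  have "B * (T / K) powr (- k) = (K powr k * B) * T powr (- k)"
    using \<open>T > 0\<close> \<open>K > 0\<close> by (simp add: powr_divide powr_minus field_simps)
  also have "\<dots> \<le> T powr (k + 1) * T powr (- k)" using * by (intro mult_right_mono) auto
  also have "\<dots> = T" using \<open>T > 0\<close> by (simp add: powr_add[symmetric])
  finally have "B * (T / K) powr (- k) \<le> T" .
  moreover have "K * (T / K) = T" using \<open>K > 0\<close> by simp
  moreover have "d \<le> 2 / 7 * (K * (T / K)) + 2 / 5 * (B * (T / K) powr (- k))"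
    using bound[of "T / K"] \<open>T > 0\<close> \<open>K > 0\<close> by simp
  ultimately have "d \<le> T" using \<open>T > 0\<close> by linarith
  thus ?thesis by (simp add: T_def q_def)
qed

locale asym_equilibrium_coupling = M: prob_space M + N: prob_space N
  for M :: "'a measure" and N :: "'b measure" +
  fixes W WA :: "'a \<Rightarrow> real" and Z :: "'b \<Rightarrow> real" and a \<sigma> :: real
  assumes W_meas [measurable]: "W \<in> borel_measurable M"
    and W_sq: "integrable M (\<lambda>\<omega>. (W \<omega>)\<^sup>2)"
    and mean: "M.expectation W = a" and var: "M.variance W = \<sigma>\<^sup>2" and sigma_a: "\<sigma>\<^sup>2 > a\<^sup>2"
    and equilibrium: "has_asym_equilibrium M W M WA"
    and laplace: "asym_laplace_distributed N Z a (sqrt (\<sigma>\<^sup>2 - a\<^sup>2))"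
begin

text \<open>
  In the notation of the asymmetric Laplace distribution \<open>b\<^sup>2 = \<sigma>\<^sup>2 - a\<^sup>2\<close>; \<open>1 / D\<close> is the maximum of the density
  of \<open>Z\<close>, and \<open>l\<close> and \<open>m\<close> are the rates of its right and left tail.
\<close>
definition "D = sqrt (2 * \<sigma>\<^sup>2 - a\<^sup>2)"
definition "l = (D - a) / (\<sigma>\<^sup>2 - a\<^sup>2)"
definition "m = (D + a) / (\<sigma>\<^sup>2 - a\<^sup>2)"

lemma WA_meas [measurable]: "WA \<in> borel_measurable M"
  using equilibrium by (simp add: has_asym_equilibrium_def)

lemma Z_meas [measurable]: "Z \<in> borel_measurable N"
  using distributed_measurable[OF laplace[unfolded asym_laplace_distributed_def]] by simp

lemma W_int: "integrable M W"
  by (rule M.square_integrable_imp_integrable[OF W_meas W_sq])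

lemma b2: "(sqrt (\<sigma>\<^sup>2 - a\<^sup>2))\<^sup>2 = \<sigma>\<^sup>2 - a\<^sup>2" and b_pos: "sqrt (\<sigma>\<^sup>2 - a\<^sup>2) > 0"
  and D_eq: "sqrt (2 * (sqrt (\<sigma>\<^sup>2 - a\<^sup>2))\<^sup>2 + a\<^sup>2) = D"
  using sigma_a by (simp_all add: D_def algebra_simps)

lemmas rates = asym_laplace_rates[OF b_pos, of a, unfolded D_eq, unfolded b2, folded l_def m_def]

lemma l_pos: "l > 0" and m_pos: "m > 0" and D_pos: "D > 0"
  using rates by auto

lemma Z_expectation: "quad_growth h \<Longrightarrow> (\<integral>\<omega>. h (Z \<omega>) \<partial>N) = laplace_avg l m h 0"
  using asym_laplace_expectation[OF b_pos laplace, of h, unfolded D_eq, unfolded b2, folded l_def m_def] .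

lemma W_integrable: "quad_growth h \<Longrightarrow> integrable M (\<lambda>\<omega>. h (W \<omega>))"
  by (rule quad_growth_integrable[OF M.prob_space_axioms W_meas W_sq])

text \<open>The Stein solution and its first derivative grow at most quadratically, so the second moment of \<open>W\<close>
  makes them integrable; integrability of the second derivative at \<open>WA\<close> depends on the test function.\<close>
lemma stein_identity:
  assumes h: "quad_growth h" and int: "integrable M (\<lambda>\<omega>. stein_sol2 l m h (WA \<omega>))"
  shows "1 / (l * m) * (\<integral>\<omega>. stein_sol2 l m h (WA \<omega>) \<partial>M) =
    (\<integral>\<omega>. stein_sol l m h (W \<omega>) - a * stein_sol1 l m h (W \<omega>) \<partial>M)"
proof -
  have "continuous_on UNIV (stein_sol2 l m h)"
    using quad_growth_stein_sol2[OF l_pos m_pos h] by (simp add: quad_growth_def)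
  from asym_equilibrium_identity[OF equilibrium stein_sol_deriv[OF l_pos m_pos h] stein_sol1_deriv[OF l_pos m_pos h]
      this W_integrable[OF quad_growth_stein_sol[OF l_pos m_pos h]]
      W_integrable[OF quad_growth_stein_sol1[OF l_pos m_pos h]] int mean var]
  show ?thesis using rates(3) sigma_a by (simp add: stein_sol_0[OF l_pos m_pos h])
qed

lemma stein_equation_Z: "1 / (l * m) * stein_sol2 l m h x + a * stein_sol1 l m h x - stein_sol l m h x
    = h x - (\<integral>\<omega>. h (Z \<omega>) \<partial>N)" if "quad_growth h"
  using stein_equation[OF l_pos m_pos that, of x] Z_expectation[OF that] rates(5) by simp

text \<open>Evaluate the Stein equation at \<open>W\<close> and replace the lower order terms by \<open>f'' (WA)\<close>.\<close>
lemma expectation_diff_W: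
  assumes h: "quad_growth h" and int: "integrable M (\<lambda>\<omega>. stein_sol2 l m h (WA \<omega>))"
  shows "(\<integral>\<omega>. h (W \<omega>) \<partial>M) - (\<integral>\<omega>. h (Z \<omega>) \<partial>N) =
    1 / (l * m) * (\<integral>\<omega>. stein_sol2 l m h (W \<omega>) - stein_sol2 l m h (WA \<omega>) \<partial>M)"
proof -
  note i = W_integrable[OF quad_growth_stein_sol[OF l_pos m_pos h]]
    W_integrable[OF quad_growth_stein_sol1[OF l_pos m_pos h]]
    W_integrable[OF quad_growth_stein_sol2[OF l_pos m_pos h]] W_integrable[OF h]
  have "(\<integral>\<omega>. h (W \<omega>) \<partial>M) - (\<integral>\<omega>. h (Z \<omega>) \<partial>N) = (\<integral>\<omega>. h (W \<omega>) - (\<integral>\<omega>. h (Z \<omega>) \<partial>N) \<partial>M)"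
    using i by (simp add: M.prob_space)
  also have "\<dots> = (\<integral>\<omega>. 1 / (l * m) * stein_sol2 l m h (W \<omega>) + a * stein_sol1 l m h (W \<omega>) - stein_sol l m h (W \<omega>) \<partial>M)"
    by (simp only: stein_equation_Z[OF h])
  also have "\<dots> = 1 / (l * m) * (\<integral>\<omega>. stein_sol2 l m h (W \<omega>) \<partial>M) - (\<integral>\<omega>. stein_sol l m h (W \<omega>) - a * stein_sol1 l m h (W \<omega>) \<partial>M)"
    using i by simp
  also have "\<dots> = 1 / (l * m) * (\<integral>\<omega>. stein_sol2 l m h (W \<omega>) - stein_sol2 l m h (WA \<omega>) \<partial>M)"
    using i int by (simp add: stein_identity[OF h int, symmetric] right_diff_distrib diff_divide_distrib)
  finally show ?thesis .
qed

text \<open>Evaluate the Stein equation at \<open>WA\<close> and replace \<open>f'' (WA)\<close> by the lower order terms at \<open>W\<close>.\<close>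
lemma expectation_diff_WA:
  assumes h: "quad_growth h" and int: "integrable M (\<lambda>\<omega>. stein_sol l m h (WA \<omega>))"
    "integrable M (\<lambda>\<omega>. stein_sol1 l m h (WA \<omega>))" "integrable M (\<lambda>\<omega>. stein_sol2 l m h (WA \<omega>))"
    and hint: "integrable M (\<lambda>\<omega>. h (WA \<omega>))"
  shows "(\<integral>\<omega>. h (WA \<omega>) \<partial>M) - (\<integral>\<omega>. h (Z \<omega>) \<partial>N) =
    (\<integral>\<omega>. (stein_sol l m h (W \<omega>) - stein_sol l m h (WA \<omega>)) - a * (stein_sol1 l m h (W \<omega>) - stein_sol1 l m h (WA \<omega>)) \<partial>M)"
proof -
  note i = W_integrable[OF quad_growth_stein_sol[OF l_pos m_pos h]]
    W_integrable[OF quad_growth_stein_sol1[OF l_pos m_pos h]]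
  have "(\<integral>\<omega>. h (WA \<omega>) \<partial>M) - (\<integral>\<omega>. h (Z \<omega>) \<partial>N) = (\<integral>\<omega>. h (WA \<omega>) - (\<integral>\<omega>. h (Z \<omega>) \<partial>N) \<partial>M)"
    using hint by (simp add: M.prob_space)
  also have "\<dots> = (\<integral>\<omega>. 1 / (l * m) * stein_sol2 l m h (WA \<omega>) + a * stein_sol1 l m h (WA \<omega>) - stein_sol l m h (WA \<omega>) \<partial>M)"
    by (simp only: stein_equation_Z[OF h])
  also have "\<dots> = 1 / (l * m) * (\<integral>\<omega>. stein_sol2 l m h (WA \<omega>) \<partial>M)
      + a * (\<integral>\<omega>. stein_sol1 l m h (WA \<omega>) \<partial>M) - (\<integral>\<omega>. stein_sol l m h (WA \<omega>) \<partial>M)"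
    using int by simp
  also have "\<dots> = (\<integral>\<omega>. (stein_sol l m h (W \<omega>) - stein_sol l m h (WA \<omega>)) - a * (stein_sol1 l m h (W \<omega>) - stein_sol1 l m h (WA \<omega>)) \<partial>M)"
    unfolding stein_identity[OF h int(3)] using i int by (simp add: right_diff_distrib)
  finally show ?thesis .
qed

lemma coupling_moment:
  assumes "k \<ge> 1" and int: "integrable M (\<lambda>\<omega>. \<bar>W \<omega>\<bar> powr (k + 2))"
  shows "integrable M (\<lambda>\<omega>. \<bar>WA \<omega>\<bar> powr k)" "integrable M (\<lambda>\<omega>. \<bar>W \<omega> - WA \<omega>\<bar> powr k)"
proof -
  show i: "integrable M (\<lambda>\<omega>. \<bar>WA \<omega>\<bar> powr k)"
    by (rule asym_equilibrium_moment[OF M.prob_space_axioms M.prob_space_axioms W_meas equilibrium mean var sigma_a _ int])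
       (use assms in simp)
  have iW: "integrable M (\<lambda>\<omega>. \<bar>W \<omega>\<bar> powr k)"
    by (rule integrable_powr_le[OF M.prob_space_axioms W_meas int]) (use assms in auto)
  show "integrable M (\<lambda>\<omega>. \<bar>W \<omega> - WA \<omega>\<bar> powr k)"
  proof (rule Bochner_Integration.integrable_bound)
    show "integrable M (\<lambda>\<omega>. 2 powr k * (\<bar>W \<omega>\<bar> powr k + \<bar>WA \<omega>\<bar> powr k))" using i iW by auto
    show "AE \<omega> in M. norm (\<bar>W \<omega> - WA \<omega>\<bar> powr k) \<le> norm (2 powr k * (\<bar>W \<omega>\<bar> powr k + \<bar>WA \<omega>\<bar> powr k))"
    proof (rule always_eventually, rule allI)
      fix \<omega>
      have "\<bar>W \<omega> - WA \<omega>\<bar> powr k \<le> (2 * max \<bar>W \<omega>\<bar> \<bar>WA \<omega>\<bar>) powr k"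
        using assms by (intro powr_mono2) auto
      also have "\<dots> = 2 powr k * (max \<bar>W \<omega>\<bar> \<bar>WA \<omega>\<bar>) powr k" by (rule powr_mult)
      also have "\<dots> \<le> 2 powr k * (\<bar>W \<omega>\<bar> powr k + \<bar>WA \<omega>\<bar> powr k)"
        by (intro mult_left_mono) (auto simp: max_def)
      finally show "norm (\<bar>W \<omega> - WA \<omega>\<bar> powr k) \<le> norm (2 powr k * (\<bar>W \<omega>\<bar> powr k + \<bar>WA \<omega>\<bar> powr k))" by simp
    qed
  qed measurable
qed

text \<open>The remainder \<open>R\<close> is at most \<open>1 / D + 2 * \<bar>a\<bar> / (\<sigma>\<^sup>2 - a\<^sup>2)\<close> times \<open>\<bar>W - WA\<bar>\<close> by the mean value theorem,
  and at most \<open>1 + 2 * \<bar>a\<bar> / D\<close> by boundedness. The first estimate is used where \<open>W\<close> and \<open>WA\<close> are close,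
  the second on the exceptional event.\<close>
lemma integral_unit_test_le:
  assumes c: "continuous_on UNIV h" and h01: "\<And>x. 0 \<le> h x" "\<And>x. h x \<le> 1"
  shows "\<beta> > 0 \<Longrightarrow> \<bar>(\<integral>\<omega>. h (WA \<omega>) \<partial>M) - (\<integral>\<omega>. h (Z \<omega>) \<partial>N)\<bar> \<le>
      (1 / D + 2 * \<bar>a\<bar> / (\<sigma>\<^sup>2 - a\<^sup>2)) * \<beta> + (1 + 2 * \<bar>a\<bar> / D) * \<P>(\<omega> in M. \<bar>W \<omega> - WA \<omega>\<bar> > \<beta>)" (is "_ \<Longrightarrow> ?tail")
    and "integrable M (\<lambda>\<omega>. \<bar>W \<omega> - WA \<omega>\<bar>) \<Longrightarrow> \<bar>(\<integral>\<omega>. h (WA \<omega>) \<partial>M) - (\<integral>\<omega>. h (Z \<omega>) \<partial>N)\<bar> \<le>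
      (1 / D + 2 * \<bar>a\<bar> / (\<sigma>\<^sup>2 - a\<^sup>2)) * (\<integral>\<omega>. \<bar>W \<omega> - WA \<omega>\<bar> \<partial>M)" (is "_ \<Longrightarrow> ?mean")
proof -
  have h: "quad_growth h" by (rule quad_growth_of_unit_range[OF c h01])
  note [measurable] = quad_growth_measurable[OF quad_growth_stein_sol[OF l_pos m_pos h]]
    quad_growth_measurable[OF quad_growth_stein_sol1[OF l_pos m_pos h]]
    quad_growth_measurable[OF quad_growth_stein_sol2[OF l_pos m_pos h]] quad_growth_measurable[OF h]
  define f where "f = stein_sol l m h"
  define f1 where "f1 = stein_sol1 l m h"
  define f2 where "f2 = stein_sol2 l m h"
  note b = stein_sol_bounds_of_unit_range[OF l_pos m_pos h h01, unfolded rates(6), unfolded rates(3), folded f_def f1_def f2_def]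
  have f: "\<bar>f x - f y\<bar> \<le> 1 / D * \<bar>x - y\<bar>" for x y
    using field_differentiable_bound[of UNIV f f1 "1 / D" x y] stein_sol_deriv[OF l_pos m_pos h] b(2)
    by (simp add: f_def f1_def)
  have f1: "\<bar>f1 x - f1 y\<bar> \<le> 2 / (\<sigma>\<^sup>2 - a\<^sup>2) * \<bar>x - y\<bar>" for x y
    using field_differentiable_bound[of UNIV f1 f2 "2 / (\<sigma>\<^sup>2 - a\<^sup>2)" x y] stein_sol1_deriv[OF l_pos m_pos h] b(3)
    by (simp add: f1_def f2_def)
  define R where "R \<omega> = (f (W \<omega>) - f (WA \<omega>)) - a * (f1 (W \<omega>) - f1 (WA \<omega>))" for \<omega>
  have tri: "\<bar>R \<omega>\<bar> \<le> \<bar>f (W \<omega>) - f (WA \<omega>)\<bar> + \<bar>a\<bar> * \<bar>f1 (W \<omega>) - f1 (WA \<omega>)\<bar>" for \<omega>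
    unfolding R_def abs_mult[symmetric] by (rule abs_triangle_ineq4)
  have R_lip: "\<bar>R \<omega>\<bar> \<le> (1 / D + 2 * \<bar>a\<bar> / (\<sigma>\<^sup>2 - a\<^sup>2)) * \<bar>W \<omega> - WA \<omega>\<bar>" for \<omega>
  proof -
    have "\<bar>R \<omega>\<bar> \<le> 1 / D * \<bar>W \<omega> - WA \<omega>\<bar> + \<bar>a\<bar> * (2 / (\<sigma>\<^sup>2 - a\<^sup>2) * \<bar>W \<omega> - WA \<omega>\<bar>)"
      using add_mono[OF f mult_left_mono[OF f1 abs_ge_zero]] tri order_trans by blast
    also have "\<dots> = (1 / D + 2 * \<bar>a\<bar> / (\<sigma>\<^sup>2 - a\<^sup>2)) * \<bar>W \<omega> - WA \<omega>\<bar>" by (simp add: distrib_right)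
    finally show ?thesis .
  qed
  have R_bd: "\<bar>R \<omega>\<bar> \<le> 1 + 2 * \<bar>a\<bar> / D" for \<omega>
  proof -
    have "\<bar>f1 (W \<omega>) - f1 (WA \<omega>)\<bar> \<le> 2 / D"
      using abs_triangle_ineq4[of "f1 (W \<omega>)" "f1 (WA \<omega>)"] b(2)[of "W \<omega>"] b(2)[of "WA \<omega>"] by simp
    from add_mono[OF b(1) mult_left_mono[OF this abs_ge_zero]]
    have "\<bar>f (W \<omega>) - f (WA \<omega>)\<bar> + \<bar>a\<bar> * \<bar>f1 (W \<omega>) - f1 (WA \<omega>)\<bar> \<le> 1 + \<bar>a\<bar> * (2 / D)" .
    with tri[of \<omega>] show ?thesis by (simp add: mult.commute)
  qed
  have intb: "integrable M (\<lambda>\<omega>. g (WA \<omega>))" if "g \<in> borel_measurable borel" "\<And>x. \<bar>g x\<bar> \<le> K" for g :: "real \<Rightarrow> real" and K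
    by (rule M.integrable_const_bound[of _ K]) (use that in auto)
  have f0: "\<bar>f x\<bar> \<le> 1" for x using b(1)[of x 0] by (simp add: f_def stein_sol_0[OF l_pos m_pos h])
  have eq: "(\<integral>\<omega>. h (WA \<omega>) \<partial>M) - (\<integral>\<omega>. h (Z \<omega>) \<partial>N) = (\<integral>\<omega>. R \<omega> \<partial>M)"
    unfolding R_def f_def f1_def
  proof (rule expectation_diff_WA[OF h])
    show "integrable M (\<lambda>\<omega>. stein_sol l m h (WA \<omega>))" using f0 by (intro intb[of _ 1]) (simp_all add: f_def)
    show "integrable M (\<lambda>\<omega>. stein_sol1 l m h (WA \<omega>))" using b(2) by (intro intb[of _ "1 / D"]) (simp_all add: f1_def)
    show "integrable M (\<lambda>\<omega>. stein_sol2 l m h (WA \<omega>))" using b(3) by (intro intb[of _ "2 / (\<sigma>\<^sup>2 - a\<^sup>2)"]) (simp_all add: f2_def)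
    show "integrable M (\<lambda>\<omega>. h (WA \<omega>))" using h01 by (intro intb[of _ 1]) simp_all
  qed
  have Rm[measurable]: "R \<in> borel_measurable M" unfolding R_def[abs_def] f_def f1_def by measurable
  have Rint: "integrable M (\<lambda>\<omega>. \<bar>R \<omega>\<bar>)"
    by (rule M.integrable_const_bound[of _ "1 + 2 * \<bar>a\<bar> / D"]) (use R_bd in auto)
  have abs: "\<bar>(\<integral>\<omega>. h (WA \<omega>) \<partial>M) - (\<integral>\<omega>. h (Z \<omega>) \<partial>N)\<bar> \<le> (\<integral>\<omega>. \<bar>R \<omega>\<bar> \<partial>M)"
    unfolding eq by (rule integral_abs_bound)
  have c1: "1 / D + 2 * \<bar>a\<bar> / (\<sigma>\<^sup>2 - a\<^sup>2) \<ge> 0" using D_pos sigma_a by simp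
  show ?tail if "\<beta> > 0"
  proof -
    let ?E = "{\<omega> \<in> space M. \<bar>W \<omega> - WA \<omega>\<bar> > \<beta>}"
    have E: "?E \<in> sets M" by measurable
    note abs
    also have "(\<integral>\<omega>. \<bar>R \<omega>\<bar> \<partial>M) \<le> (\<integral>\<omega>. (1 / D + 2 * \<bar>a\<bar> / (\<sigma>\<^sup>2 - a\<^sup>2)) * \<beta> + (1 + 2 * \<bar>a\<bar> / D) * indicat_real ?E \<omega> \<partial>M)"
    proof (rule integral_mono[OF Rint])
      show "integrable M (\<lambda>\<omega>. (1 / D + 2 * \<bar>a\<bar> / (\<sigma>\<^sup>2 - a\<^sup>2)) * \<beta> + (1 + 2 * \<bar>a\<bar> / D) * indicat_real ?E \<omega>)"
        using E by (intro Bochner_Integration.integrable_add integrable_mult_right integrable_real_indicator)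
          (auto simp: M.emeasure_eq_measure)
      fix \<omega> assume "\<omega> \<in> space M"
      show "\<bar>R \<omega>\<bar> \<le> (1 / D + 2 * \<bar>a\<bar> / (\<sigma>\<^sup>2 - a\<^sup>2)) * \<beta> + (1 + 2 * \<bar>a\<bar> / D) * indicat_real ?E \<omega>"
      proof (cases "\<omega> \<in> ?E")
        case True
        thus ?thesis using R_bd[of \<omega>] mult_nonneg_nonneg[OF c1, of \<beta>] that by simp
      next
        case False
        hence "\<bar>W \<omega> - WA \<omega>\<bar> \<le> \<beta>" using \<open>\<omega> \<in> space M\<close> by simp
        thus ?thesis using False order_trans[OF R_lip mult_left_mono[OF _ c1]] by simp
      qed
    qed
    also have "\<dots> = (1 / D + 2 * \<bar>a\<bar> / (\<sigma>\<^sup>2 - a\<^sup>2)) * \<beta> + (1 + 2 * \<bar>a\<bar> / D) * \<P>(\<omega> in M. \<bar>W \<omega> - WA \<omega>\<bar> > \<beta>)"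
    proof -
      have "integrable M (\<lambda>\<omega>. (1 + 2 * \<bar>a\<bar> / D) * indicat_real ?E \<omega>)"
        using E by (intro integrable_mult_right integrable_real_indicator) (auto simp: M.emeasure_eq_measure)
      thus ?thesis using E by (subst Bochner_Integration.integral_add) (simp_all add: M.prob_space)
    qed
    finally show ?thesis .
  qed
  show ?mean if "integrable M (\<lambda>\<omega>. \<bar>W \<omega> - WA \<omega>\<bar>)"
  proof -
    note abs
    also have "(\<integral>\<omega>. \<bar>R \<omega>\<bar> \<partial>M) \<le> (\<integral>\<omega>. (1 / D + 2 * \<bar>a\<bar> / (\<sigma>\<^sup>2 - a\<^sup>2)) * \<bar>W \<omega> - WA \<omega>\<bar> \<partial>M)"
      by (rule integral_mono[OF Rint integrable_mult_right[OF that] R_lip])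
    finally show ?thesis by simp
  qed
qed

lemma cdf_diff_WA_le:
  assumes "\<beta> > 0"
  shows "\<bar>\<P>(\<omega> in M. WA \<omega> \<le> z) - \<P>(\<omega> in N. Z \<omega> \<le> z)\<bar> \<le>
    (1 / D + 2 * \<bar>a\<bar> / (\<sigma>\<^sup>2 - a\<^sup>2)) * \<beta> + (1 + 2 * \<bar>a\<bar> / D) * \<P>(\<omega> in M. \<bar>W \<omega> - WA \<omega>\<bar> > \<beta>)"
  by (rule cdf_diff_le_of_continuous_tests[OF M.prob_space_axioms N.prob_space_axioms WA_meas Z_meas])
     (rule integral_unit_test_le(1)[OF _ _ _ assms])

text \<open>Outside the exceptional event, \<open>{W \<le> z}\<close> lies between \<open>{WA \<le> z - \<beta>}\<close> and \<open>{WA \<le> z + \<beta>}\<close>.\<close>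
lemma cdf_diff_W_le:
  assumes "\<beta> > 0"
  shows "\<bar>\<P>(\<omega> in M. W \<omega> \<le> z) - \<P>(\<omega> in N. Z \<omega> \<le> z)\<bar> \<le>
    (2 / D + 2 * \<bar>a\<bar> / (\<sigma>\<^sup>2 - a\<^sup>2)) * \<beta> + (2 + 2 * \<bar>a\<bar> / D) * \<P>(\<omega> in M. \<bar>W \<omega> - WA \<omega>\<bar> > \<beta>)"
proof -
  let ?E = "{\<omega> \<in> space M. \<bar>W \<omega> - WA \<omega>\<bar> > \<beta>}"
  define Q where "Q = (1 / D + 2 * \<bar>a\<bar> / (\<sigma>\<^sup>2 - a\<^sup>2)) * \<beta> + (1 + 2 * \<bar>a\<bar> / D) * M.prob ?E"
  have sub: "M.prob {\<omega> \<in> space M. U \<omega> \<le> z} \<le> M.prob {\<omega> \<in> space M. V \<omega> \<le> z + \<beta>} + M.prob ?E"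
    if [measurable]: "U \<in> borel_measurable M" "V \<in> borel_measurable M"
      and UV: "\<And>\<omega>. \<bar>W \<omega> - WA \<omega>\<bar> = \<bar>U \<omega> - V \<omega>\<bar>" for U V and z
  proof -
    have "M.prob {\<omega> \<in> space M. U \<omega> \<le> z} \<le> M.prob ({\<omega> \<in> space M. V \<omega> \<le> z + \<beta>} \<union> ?E)"
      by (rule M.finite_measure_mono) (auto simp: UV)
    also have "\<dots> \<le> M.prob {\<omega> \<in> space M. V \<omega> \<le> z + \<beta>} + M.prob ?E"
      by (rule measure_Un_le) measurable
    finally show ?thesis .
  qed
  have "M.prob {\<omega> \<in> space M. W \<omega> \<le> z} \<le> M.prob {\<omega> \<in> space M. WA \<omega> \<le> z + \<beta>} + M.prob ?E"
    by (rule sub) simp_all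
  moreover have "M.prob {\<omega> \<in> space M. WA \<omega> \<le> z - \<beta>} \<le> M.prob {\<omega> \<in> space M. W \<omega> \<le> z} + M.prob ?E"
    using sub[of WA W "z - \<beta>"] by (simp add: abs_minus_commute)
  moreover have "\<bar>M.prob {\<omega> \<in> space M. WA \<omega> \<le> z + \<beta>} - N.prob {\<omega> \<in> space N. Z \<omega> \<le> z + \<beta>}\<bar> \<le> Q"
    "\<bar>M.prob {\<omega> \<in> space M. WA \<omega> \<le> z - \<beta>} - N.prob {\<omega> \<in> space N. Z \<omega> \<le> z - \<beta>}\<bar> \<le> Q"
    unfolding Q_def by (rule cdf_diff_WA_le[OF assms])+
  moreover have "N.prob {\<omega> \<in> space N. Z \<omega> \<le> z + \<beta>} - N.prob {\<omega> \<in> space N. Z \<omega> \<le> z} \<le> \<beta> / D"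
    "N.prob {\<omega> \<in> space N. Z \<omega> \<le> z} - N.prob {\<omega> \<in> space N. Z \<omega> \<le> z - \<beta>} \<le> \<beta> / D"
    using asym_laplace_interval_le[OF b_pos N.prob_space_axioms laplace, of z "z + \<beta>"]
      asym_laplace_interval_le[OF b_pos N.prob_space_axioms laplace, of "z - \<beta>" z] assms
    unfolding D_eq by simp_all
  ultimately have "\<bar>M.prob {\<omega> \<in> space M. W \<omega> \<le> z} - N.prob {\<omega> \<in> space N. Z \<omega> \<le> z}\<bar> \<le> Q + M.prob ?E + \<beta> / D"
    by linarith
  also have "\<dots> = (2 / D + 2 * \<bar>a\<bar> / (\<sigma>\<^sup>2 - a\<^sup>2)) * \<beta> + (2 + 2 * \<bar>a\<bar> / D) * M.prob ?E"
    by (simp add: Q_def distrib_right add_divide_distrib)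
  finally show ?thesis .
qed

lemma kolmogorov_W_tail:
  assumes "\<beta> > 0"
  shows "d_K M W N Z \<le> ereal ((14 / D + 7 * \<bar>a\<bar> / (\<sigma>\<^sup>2 - a\<^sup>2)) * \<beta> +
           (5 + 7 * \<bar>a\<bar> / D) * \<P>(\<omega> in M. \<bar>W \<omega> - WA \<omega>\<bar> > \<beta>))"
proof (rule d_K_le)
  fix z
  note cdf_diff_W_le[OF assms, of z]
  also have "(2 / D + 2 * \<bar>a\<bar> / (\<sigma>\<^sup>2 - a\<^sup>2)) * \<beta> + (2 + 2 * \<bar>a\<bar> / D) * \<P>(\<omega> in M. \<bar>W \<omega> - WA \<omega>\<bar> > \<beta>)
    \<le> (14 / D + 7 * \<bar>a\<bar> / (\<sigma>\<^sup>2 - a\<^sup>2)) * \<beta> + (5 + 7 * \<bar>a\<bar> / D) * \<P>(\<omega> in M. \<bar>W \<omega> - WA \<omega>\<bar> > \<beta>)"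
    using assms D_pos sigma_a by (intro add_mono mult_right_mono divide_right_mono) auto
  finally show "\<bar>\<P>(\<omega> in M. W \<omega> \<le> z) - \<P>(\<omega> in N. Z \<omega> \<le> z)\<bar> \<le>
    (14 / D + 7 * \<bar>a\<bar> / (\<sigma>\<^sup>2 - a\<^sup>2)) * \<beta> + (5 + 7 * \<bar>a\<bar> / D) * \<P>(\<omega> in M. \<bar>W \<omega> - WA \<omega>\<bar> > \<beta>)" .
qed

lemma kolmogorov_WA_tail:
  assumes "\<beta> > 0"
  shows "d_K M WA N Z \<le> ereal ((2 / D + 4 * \<bar>a\<bar> / (\<sigma>\<^sup>2 - a\<^sup>2)) * \<beta> +
           (2 + 4 * \<bar>a\<bar> / D) * \<P>(\<omega> in M. \<bar>W \<omega> - WA \<omega>\<bar> > \<beta>))"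
proof (rule d_K_le)
  fix z
  note cdf_diff_WA_le[OF assms, of z]
  also have "(1 / D + 2 * \<bar>a\<bar> / (\<sigma>\<^sup>2 - a\<^sup>2)) * \<beta> + (1 + 2 * \<bar>a\<bar> / D) * \<P>(\<omega> in M. \<bar>W \<omega> - WA \<omega>\<bar> > \<beta>)
    \<le> (2 / D + 4 * \<bar>a\<bar> / (\<sigma>\<^sup>2 - a\<^sup>2)) * \<beta> + (2 + 4 * \<bar>a\<bar> / D) * \<P>(\<omega> in M. \<bar>W \<omega> - WA \<omega>\<bar> > \<beta>)"
    using assms D_pos sigma_a by (intro add_mono mult_right_mono divide_right_mono) auto
  finally show "\<bar>\<P>(\<omega> in M. WA \<omega> \<le> z) - \<P>(\<omega> in N. Z \<omega> \<le> z)\<bar> \<le>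
    (2 / D + 4 * \<bar>a\<bar> / (\<sigma>\<^sup>2 - a\<^sup>2)) * \<beta> + (2 + 4 * \<bar>a\<bar> / D) * \<P>(\<omega> in M. \<bar>W \<omega> - WA \<omega>\<bar> > \<beta>)" .
qed

lemma kolmogorov_WA_mean:
  assumes "integrable M (\<lambda>\<omega>. \<bar>W \<omega> - WA \<omega>\<bar>)"
  shows "d_K M WA N Z \<le> ereal ((2 / D + 4 * \<bar>a\<bar> / (\<sigma>\<^sup>2 - a\<^sup>2)) * (\<integral>\<omega>. \<bar>W \<omega> - WA \<omega>\<bar> \<partial>M))"
proof (rule d_K_le)
  fix z
  have "\<bar>\<P>(\<omega> in M. WA \<omega> \<le> z) - \<P>(\<omega> in N. Z \<omega> \<le> z)\<bar> \<le>
    (1 / D + 2 * \<bar>a\<bar> / (\<sigma>\<^sup>2 - a\<^sup>2)) * (\<integral>\<omega>. \<bar>W \<omega> - WA \<omega>\<bar> \<partial>M)"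
    by (rule cdf_diff_le_of_continuous_tests[OF M.prob_space_axioms N.prob_space_axioms WA_meas Z_meas])
       (rule integral_unit_test_le(2)[OF _ _ _ assms])
  also have "\<dots> \<le> (2 / D + 4 * \<bar>a\<bar> / (\<sigma>\<^sup>2 - a\<^sup>2)) * (\<integral>\<omega>. \<bar>W \<omega> - WA \<omega>\<bar> \<partial>M)"
    using D_pos sigma_a by (intro add_mono mult_right_mono divide_right_mono Bochner_Integration.integral_nonneg) auto
  finally show "\<bar>\<P>(\<omega> in M. WA \<omega> \<le> z) - \<P>(\<omega> in N. Z \<omega> \<le> z)\<bar> \<le>
    (2 / D + 4 * \<bar>a\<bar> / (\<sigma>\<^sup>2 - a\<^sup>2)) * (\<integral>\<omega>. \<bar>W \<omega> - WA \<omega>\<bar> \<partial>M)" .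
qed

text \<open>Markov's inequality turns the tail bound \<open>cdf_diff_W_le\<close> into the hypothesis of
  \<open>optimize_tail_bound\<close>.\<close>
lemma kolmogorov_W_moment:
  assumes "k \<ge> 1" and int: "integrable M (\<lambda>\<omega>. \<bar>W \<omega>\<bar> powr (k + 2))"
  shows "d_K M W N Z \<le> ereal ((14 / D + 7 * \<bar>a\<bar> / (\<sigma>\<^sup>2 - a\<^sup>2)) powr (k / (k + 1)) *
           ((k + k powr (- k)) * (5 + 7 * \<bar>a\<bar> / D) *
            (\<integral>\<omega>. \<bar>W \<omega> - WA \<omega>\<bar> powr k \<partial>M)) powr (1 / (k + 1)))"
proof (rule d_K_le)
  fix z
  define I where "I = (\<integral>\<omega>. \<bar>W \<omega> - WA \<omega>\<bar> powr k \<partial>M)"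
  define K where "K = 14 / D + 7 * \<bar>a\<bar> / (\<sigma>\<^sup>2 - a\<^sup>2)"
  define L where "L = 5 + 7 * \<bar>a\<bar> / D"
  have I0: "I \<ge> 0" unfolding I_def by (rule Bochner_Integration.integral_nonneg) simp
  have K0: "K > 0" using D_pos sigma_a by (simp add: K_def add_pos_nonneg)
  have L0: "L > 0" using D_pos by (simp add: L_def add_pos_nonneg)
  have "\<bar>\<P>(\<omega> in M. W \<omega> \<le> z) - \<P>(\<omega> in N. Z \<omega> \<le> z)\<bar> \<le> K powr (k / (k + 1)) * ((k + k powr (- k)) * (L * I)) powr (1 / (k + 1))"
  proof (rule optimize_tail_bound[OF K0 _ \<open>k \<ge> 1\<close>])
    show "0 \<le> L * I" using I0 L0 by simp
    fix \<beta> :: real assume "\<beta> > 0"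
    let ?E = "{\<omega> \<in> space M. \<bar>W \<omega> - WA \<omega>\<bar> > \<beta>}"
    have E: "?E \<in> sets M" by measurable
    have "\<beta> powr k * M.prob ?E \<le> I"
    proof -
      have "\<beta> powr k * M.prob ?E = (\<integral>\<omega>. \<beta> powr k * indicat_real ?E \<omega> \<partial>M)" using E by simp
      also have "\<dots> \<le> I" unfolding I_def
      proof (rule integral_mono[OF _ coupling_moment(2)[OF assms]])
        show "integrable M (\<lambda>\<omega>. \<beta> powr k * indicat_real ?E \<omega>)"
          using E by (intro integrable_mult_right integrable_real_indicator) (auto simp: M.emeasure_eq_measure)
        show "\<beta> powr k * indicat_real ?E \<omega> \<le> \<bar>W \<omega> - WA \<omega>\<bar> powr k" for \<omega>
          using \<open>\<beta> > 0\<close> \<open>k \<ge> 1\<close> by (auto simp: indicator_def intro!: powr_mono2)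
      qed
      finally show ?thesis .
    qed
    hence P: "M.prob ?E \<le> I * \<beta> powr (- k)"
      using \<open>\<beta> > 0\<close> by (simp add: powr_minus field_simps)
    note cdf_diff_W_le[OF \<open>\<beta> > 0\<close>, of z]
    also have "(2 / D + 2 * \<bar>a\<bar> / (\<sigma>\<^sup>2 - a\<^sup>2)) * \<beta> + (2 + 2 * \<bar>a\<bar> / D) * M.prob ?E
      \<le> (2 / 7 * K) * \<beta> + (2 / 5 * L) * (I * \<beta> powr (- k))"
    proof (intro add_mono mult_mono P)
      \<comment> \<open>The stated constants exceed the ones of the tail bound by factors of at least \<open>7 / 2\<close> and \<open>5 / 2\<close>.\<close>
      have "2 / D \<le> 4 / D" using D_pos by (intro divide_right_mono) auto
      thus "2 / D + 2 * \<bar>a\<bar> / (\<sigma>\<^sup>2 - a\<^sup>2) \<le> 2 / 7 * K" by (simp add: K_def)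
      have "2 * \<bar>a\<bar> / D \<le> 14 / 5 * \<bar>a\<bar> / D" using D_pos by (intro divide_right_mono mult_right_mono) auto
      thus "2 + 2 * \<bar>a\<bar> / D \<le> 2 / 5 * L" by (simp add: L_def)
    qed (use \<open>\<beta> > 0\<close> K0 L0 in auto)
    finally show "\<bar>\<P>(\<omega> in M. W \<omega> \<le> z) - \<P>(\<omega> in N. Z \<omega> \<le> z)\<bar> \<le> 2 / 7 * (K * \<beta>) + 2 / 5 * (L * I * \<beta> powr (- k))"
      by (simp add: mult.assoc)
  qed
  thus "\<bar>\<P>(\<omega> in M. W \<omega> \<le> z) - \<P>(\<omega> in N. Z \<omega> \<le> z)\<bar> \<le> (14 / D + 7 * \<bar>a\<bar> / (\<sigma>\<^sup>2 - a\<^sup>2)) powr (k / (k + 1)) *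
           ((k + k powr (- k)) * (5 + 7 * \<bar>a\<bar> / D) * (\<integral>\<omega>. \<bar>W \<omega> - WA \<omega>\<bar> powr k \<partial>M)) powr (1 / (k + 1))"
    by (simp add: K_def L_def I_def mult.assoc)
qed

lemma wasserstein_bounds:
  assumes int: "integrable M (\<lambda>\<omega>. \<bar>WA \<omega>\<bar>)" "integrable M (\<lambda>\<omega>. \<bar>W \<omega> - WA \<omega>\<bar>)"
  shows "d_W M W N Z \<le> ereal (2 * (\<integral>\<omega>. \<bar>W \<omega> - WA \<omega>\<bar> \<partial>M))"
    and "d_W M WA N Z \<le> ereal ((1 + 2 * \<bar>a\<bar> / D) * (\<integral>\<omega>. \<bar>W \<omega> - WA \<omega>\<bar> \<partial>M))"
proof -
  have lm: "l * m > 0" using l_pos m_pos by simp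
  have "\<bar>(\<integral>\<omega>. h (W \<omega>) \<partial>M) - (\<integral>\<omega>. h (Z \<omega>) \<partial>N)\<bar> \<le> 2 * (\<integral>\<omega>. \<bar>W \<omega> - WA \<omega>\<bar> \<partial>M) \<and>
    \<bar>(\<integral>\<omega>. h (WA \<omega>) \<partial>M) - (\<integral>\<omega>. h (Z \<omega>) \<partial>N)\<bar> \<le> (1 + 2 * \<bar>a\<bar> / D) * (\<integral>\<omega>. \<bar>W \<omega> - WA \<omega>\<bar> \<partial>M)"
    if "h \<in> H_W" for h
  proof
    note lip = H_W_lipschitz[OF that]
    have h: "quad_growth h" by (rule quad_growth_of_lipschitz[OF lip])
    note b = stein_sol_bounds_of_lipschitz[OF l_pos m_pos h lip, unfolded rates(6)]
    have b1: "\<bar>stein_sol1 l m h x - stein_sol1 l m h y\<bar> \<le> 2 / D * \<bar>x - y\<bar>" for x y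
      using field_differentiable_bound[of UNIV "stein_sol1 l m h" "stein_sol2 l m h" "2 / D" x y]
        stein_sol1_deriv[OF l_pos m_pos h] b(2) by simp
    have i2: "integrable M (\<lambda>\<omega>. stein_sol2 l m h (WA \<omega>))" by (rule lipschitz_integrable[OF M.prob_space_axioms WA_meas int(1) b(3)])
    have i0: "integrable M (\<lambda>\<omega>. stein_sol l m h (WA \<omega>))"
      by (rule lipschitz_integrable[OF M.prob_space_axioms WA_meas int(1), where B = 1]) (use b(1) in simp)
    have i1: "integrable M (\<lambda>\<omega>. stein_sol1 l m h (WA \<omega>))" by (rule lipschitz_integrable[OF M.prob_space_axioms WA_meas int(1) b1])
    have ih: "integrable M (\<lambda>\<omega>. h (WA \<omega>))"
      by (rule lipschitz_integrable[OF M.prob_space_axioms WA_meas int(1), where B = 1]) (use lip in simp)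
    note iW = W_integrable[OF quad_growth_stein_sol[OF l_pos m_pos h]]
      W_integrable[OF quad_growth_stein_sol1[OF l_pos m_pos h]] W_integrable[OF quad_growth_stein_sol2[OF l_pos m_pos h]]
    have "\<bar>(\<integral>\<omega>. h (W \<omega>) \<partial>M) - (\<integral>\<omega>. h (Z \<omega>) \<partial>N)\<bar> =
        1 / (l * m) * \<bar>\<integral>\<omega>. stein_sol2 l m h (W \<omega>) - stein_sol2 l m h (WA \<omega>) \<partial>M\<bar>"
      unfolding expectation_diff_W[OF h i2] abs_mult[of "1 / (l * m)"] using lm by simp
    also have "\<dots> \<le> 1 / (l * m) * (\<integral>\<omega>. 2 * (l * m) * \<bar>W \<omega> - WA \<omega>\<bar> \<partial>M)"
    proof (rule mult_left_mono)
      have "\<bar>\<integral>\<omega>. stein_sol2 l m h (W \<omega>) - stein_sol2 l m h (WA \<omega>) \<partial>M\<bar> \<le>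
          (\<integral>\<omega>. \<bar>stein_sol2 l m h (W \<omega>) - stein_sol2 l m h (WA \<omega>)\<bar> \<partial>M)" by (rule integral_abs_bound)
      also have "\<dots> \<le> (\<integral>\<omega>. 2 * (l * m) * \<bar>W \<omega> - WA \<omega>\<bar> \<partial>M)"
        using iW i2 int by (intro integral_mono b(3)) auto
      finally show "\<bar>\<integral>\<omega>. stein_sol2 l m h (W \<omega>) - stein_sol2 l m h (WA \<omega>) \<partial>M\<bar> \<le> (\<integral>\<omega>. 2 * (l * m) * \<bar>W \<omega> - WA \<omega>\<bar> \<partial>M)" .
    qed (use lm in simp)
    also have "\<dots> = 2 * (\<integral>\<omega>. \<bar>W \<omega> - WA \<omega>\<bar> \<partial>M)" using l_pos m_pos by simp
    finally show "\<bar>(\<integral>\<omega>. h (W \<omega>) \<partial>M) - (\<integral>\<omega>. h (Z \<omega>) \<partial>N)\<bar> \<le> 2 * (\<integral>\<omega>. \<bar>W \<omega> - WA \<omega>\<bar> \<partial>M)" .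
    have "\<bar>(\<integral>\<omega>. h (WA \<omega>) \<partial>M) - (\<integral>\<omega>. h (Z \<omega>) \<partial>N)\<bar> \<le>
      (\<integral>\<omega>. \<bar>(stein_sol l m h (W \<omega>) - stein_sol l m h (WA \<omega>)) - a * (stein_sol1 l m h (W \<omega>) - stein_sol1 l m h (WA \<omega>))\<bar> \<partial>M)"
      unfolding expectation_diff_WA[OF h i0 i1 i2 ih] by (rule integral_abs_bound)
    also have "\<dots> \<le> (\<integral>\<omega>. (1 + 2 * \<bar>a\<bar> / D) * \<bar>W \<omega> - WA \<omega>\<bar> \<partial>M)"
    proof (rule integral_mono)
      fix \<omega>
      have "\<bar>(stein_sol l m h (W \<omega>) - stein_sol l m h (WA \<omega>)) - a * (stein_sol1 l m h (W \<omega>) - stein_sol1 l m h (WA \<omega>))\<bar>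
        \<le> \<bar>stein_sol l m h (W \<omega>) - stein_sol l m h (WA \<omega>)\<bar> + \<bar>a\<bar> * \<bar>stein_sol1 l m h (W \<omega>) - stein_sol1 l m h (WA \<omega>)\<bar>"
        unfolding abs_mult[symmetric] by (rule abs_triangle_ineq4)
      also have "\<dots> \<le> \<bar>W \<omega> - WA \<omega>\<bar> + \<bar>a\<bar> * (2 / D * \<bar>W \<omega> - WA \<omega>\<bar>)"
        by (intro add_mono b(1) mult_left_mono b1) simp
      also have "\<dots> = (1 + 2 * \<bar>a\<bar> / D) * \<bar>W \<omega> - WA \<omega>\<bar>" by (simp add: distrib_right)
      finally show "\<bar>(stein_sol l m h (W \<omega>) - stein_sol l m h (WA \<omega>)) - a * (stein_sol1 l m h (W \<omega>) - stein_sol1 l m h (WA \<omega>))\<bar>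
        \<le> (1 + 2 * \<bar>a\<bar> / D) * \<bar>W \<omega> - WA \<omega>\<bar>" .
    qed (use iW i0 i1 int in auto)
    also have "\<dots> = (1 + 2 * \<bar>a\<bar> / D) * (\<integral>\<omega>. \<bar>W \<omega> - WA \<omega>\<bar> \<partial>M)" by simp
    finally show "\<bar>(\<integral>\<omega>. h (WA \<omega>) \<partial>M) - (\<integral>\<omega>. h (Z \<omega>) \<partial>N)\<bar> \<le> (1 + 2 * \<bar>a\<bar> / D) * (\<integral>\<omega>. \<bar>W \<omega> - WA \<omega>\<bar> \<partial>M)" .
  qed
  thus "d_W M W N Z \<le> ereal (2 * (\<integral>\<omega>. \<bar>W \<omega> - WA \<omega>\<bar> \<partial>M))"
    and "d_W M WA N Z \<le> ereal ((1 + 2 * \<bar>a\<bar> / D) * (\<integral>\<omega>. \<bar>W \<omega> - WA \<omega>\<bar> \<partial>M))"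
    unfolding prob_dist_def by (auto intro!: SUP_least)
qed

text \<open>Expand \<open>f''\<close> at \<open>W\<close>: the linear term is \<open>f''' (W) * (W - WA)\<close>, where \<open>f'''\<close> is bounded by \<open>2 / D\<close> and
  \<open>W - WA\<close> may be replaced by its conditional expectation, and the remainder is quadratic because
  \<open>f'''\<close> is Lipschitz.\<close>
lemma d_2_bound:
  assumes int: "integrable M (\<lambda>\<omega>. (WA \<omega>)\<^sup>2)"
  shows "d_2 M W N Z \<le> ereal ((\<sigma>\<^sup>2 - a\<^sup>2) / D * (\<integral>\<omega>. \<bar>cond_exp_given M W (\<lambda>\<omega>'. W \<omega>' - WA \<omega>') \<omega>\<bar> \<partial>M) +
     (\<integral>\<omega>. (W \<omega> - WA \<omega>)\<^sup>2 \<partial>M))"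
  unfolding prob_dist_def
proof (rule SUP_least)
  fix h assume "h \<in> H_2"
  define g where "g = deriv h"
  have lip: "\<bar>g x - g y\<bar> \<le> \<bar>x - y\<bar>" for x y
    using H_W_lipschitz[OF H_2_deriv_in_H_W[OF \<open>h \<in> H_2\<close>]] by (simp add: g_def)
  have d: "(h has_real_derivative g x) (at x)" for x
    using \<open>h \<in> H_2\<close> by (simp add: g_def H_2_def DERIV_deriv_iff_real_differentiable)
  have h: "quad_growth h" by (rule quad_growth_of_lipschitz_deriv[OF d lip])
  have g: "quad_growth g" by (rule quad_growth_of_lipschitz[OF lip])
  define f2 where "f2 = stein_sol2 l m h"
  define f3 where "f3 = stein_sol2 l m g"
  have lm: "l * m > 0" using l_pos m_pos by simp
  note b = stein_sol_bounds_of_lipschitz[OF l_pos m_pos g lip, unfolded rates(6), folded f3_def]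
  have f23: "(f2 has_real_derivative f3 x) (at x)" for x
    unfolding f2_def f3_def by (rule stein_sol2_deriv_of_smooth[OF l_pos m_pos h g d lip])
  have taylor: "\<bar>f2 y - f2 x - f3 x * (y - x)\<bar> \<le> l * m * (y - x)\<^sup>2" for x y
    using taylor_remainder_le[OF f23 b(3), of y x] by simp
  have f3_meas[measurable]: "f3 \<in> borel_measurable borel"
    unfolding f3_def by (rule quad_growth_measurable[OF quad_growth_stein_sol2[OF l_pos m_pos g]])
  have i2A: "integrable M (\<lambda>\<omega>. f2 (WA \<omega>))" unfolding f2_def
    by (rule quad_growth_integrable[OF M.prob_space_axioms WA_meas int quad_growth_stein_sol2[OF l_pos m_pos h]])
  have i2W: "integrable M (\<lambda>\<omega>. f2 (W \<omega>))" unfolding f2_def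
    by (rule W_integrable[OF quad_growth_stein_sol2[OF l_pos m_pos h]])
  have WA_int: "integrable M WA" by (rule M.square_integrable_imp_integrable[OF WA_meas int])
  have idiff: "integrable M (\<lambda>\<omega>. W \<omega> - WA \<omega>)" using W_int WA_int by simp
  have isq: "integrable M (\<lambda>\<omega>. (W \<omega> - WA \<omega>)\<^sup>2)"
  proof (rule Bochner_Integration.integrable_bound)
    show "integrable M (\<lambda>\<omega>. 2 * (W \<omega>)\<^sup>2 + 2 * (WA \<omega>)\<^sup>2)" using W_sq int by simp
    show "AE \<omega> in M. norm ((W \<omega> - WA \<omega>)\<^sup>2) \<le> norm (2 * (W \<omega>)\<^sup>2 + 2 * (WA \<omega>)\<^sup>2)"
    proof (rule always_eventually, rule allI)
      show "norm ((W \<omega> - WA \<omega>)\<^sup>2) \<le> norm (2 * (W \<omega>)\<^sup>2 + 2 * (WA \<omega>)\<^sup>2)" for \<omega>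
        using square_add_le[of "W \<omega>" "- WA \<omega>"] by simp
    qed
  qed measurable
  have i3: "integrable M (\<lambda>\<omega>. f3 (W \<omega>) * (W \<omega> - WA \<omega>))"
  proof (rule Bochner_Integration.integrable_bound)
    show "integrable M (\<lambda>\<omega>. 2 / D * \<bar>W \<omega> - WA \<omega>\<bar>)" using idiff by simp
    show "AE \<omega> in M. norm (f3 (W \<omega>) * (W \<omega> - WA \<omega>)) \<le> norm (2 / D * \<bar>W \<omega> - WA \<omega>\<bar>)"
    proof (rule always_eventually, rule allI)
      show "norm (f3 (W \<omega>) * (W \<omega> - WA \<omega>)) \<le> norm (2 / D * \<bar>W \<omega> - WA \<omega>\<bar>)" for \<omega>
        using mult_right_mono[OF b(2)[of "W \<omega>"] abs_ge_zero[of "W \<omega> - WA \<omega>"]] D_pos by (simp add: abs_mult)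
    qed
  qed measurable
  define F where "F = vimage_algebra (space M) W borel"
  define E where "E = real_cond_exp M F (\<lambda>\<omega>. W \<omega> - WA \<omega>)"
  have sub: "subalgebra M F"
    unfolding subalgebra_def F_def using measurable_sets[OF W_meas] by (auto simp: sets_vimage_algebra2)
  interpret F: finite_measure_subalgebra M F by unfold_locales (rule sub)
  have WF: "W \<in> borel_measurable F" unfolding F_def by (rule measurable_vimage_algebra1) simp
  have f3F: "(\<lambda>\<omega>. f3 (W \<omega>)) \<in> borel_measurable F" using measurable_compose[OF WF f3_meas] .
  note ce = F.real_cond_exp_intg[OF i3 f3F]
  have iE: "integrable M E" unfolding E_def by (rule F.real_cond_exp_int(1)[OF idiff])
  have "\<bar>\<integral>\<omega>. f3 (W \<omega>) * (W \<omega> - WA \<omega>) \<partial>M\<bar> = \<bar>\<integral>\<omega>. f3 (W \<omega>) * E \<omega> \<partial>M\<bar>"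
    unfolding E_def by (subst ce(2)) simp_all
  also have "\<dots> \<le> (\<integral>\<omega>. \<bar>f3 (W \<omega>) * E \<omega>\<bar> \<partial>M)" by (rule integral_abs_bound)
  also have "\<dots> \<le> (\<integral>\<omega>. 2 / D * \<bar>E \<omega>\<bar> \<partial>M)"
  proof (rule integral_mono)
    show "integrable M (\<lambda>\<omega>. \<bar>f3 (W \<omega>) * E \<omega>\<bar>)" unfolding E_def using ce(1) by simp
    show "integrable M (\<lambda>\<omega>. 2 / D * \<bar>E \<omega>\<bar>)" using iE by simp
    show "\<bar>f3 (W \<omega>) * E \<omega>\<bar> \<le> 2 / D * \<bar>E \<omega>\<bar>" for \<omega>
      using mult_right_mono[OF b(2)[of "W \<omega>"] abs_ge_zero[of "E \<omega>"]] by (simp add: abs_mult)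
  qed
  finally have lin: "\<bar>\<integral>\<omega>. f3 (W \<omega>) * (W \<omega> - WA \<omega>) \<partial>M\<bar> \<le> 2 / D * (\<integral>\<omega>. \<bar>E \<omega>\<bar> \<partial>M)" by simp
  define r where "r \<omega> = f2 (W \<omega>) - f2 (WA \<omega>) - f3 (W \<omega>) * (W \<omega> - WA \<omega>)" for \<omega>
  have ir: "integrable M r" unfolding r_def[abs_def] using i2W i2A i3 by simp
  have rem: "\<bar>\<integral>\<omega>. r \<omega> \<partial>M\<bar> \<le> l * m * (\<integral>\<omega>. (W \<omega> - WA \<omega>)\<^sup>2 \<partial>M)"
  proof -
    have "\<bar>\<integral>\<omega>. r \<omega> \<partial>M\<bar> \<le> (\<integral>\<omega>. \<bar>r \<omega>\<bar> \<partial>M)" by (rule integral_abs_bound)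
    also have "\<dots> \<le> (\<integral>\<omega>. l * m * (W \<omega> - WA \<omega>)\<^sup>2 \<partial>M)"
    proof (rule integral_mono)
      show "\<bar>r \<omega>\<bar> \<le> l * m * (W \<omega> - WA \<omega>)\<^sup>2" for \<omega>
      proof -
        have "r \<omega> = - (f2 (WA \<omega>) - f2 (W \<omega>) - f3 (W \<omega>) * (WA \<omega> - W \<omega>))"
          by (simp add: r_def algebra_simps)
        thus ?thesis using taylor[of "WA \<omega>" "W \<omega>"] by (simp add: power2_commute)
      qed
    qed (use ir isq in auto)
    finally show ?thesis by simp
  qed
  have "(\<integral>\<omega>. f2 (W \<omega>) - f2 (WA \<omega>) \<partial>M) = (\<integral>\<omega>. f3 (W \<omega>) * (W \<omega> - WA \<omega>) + r \<omega> \<partial>M)"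
    by (simp add: r_def)
  also have "\<dots> = (\<integral>\<omega>. f3 (W \<omega>) * (W \<omega> - WA \<omega>) \<partial>M) + (\<integral>\<omega>. r \<omega> \<partial>M)"
    by (rule Bochner_Integration.integral_add[OF i3 ir])
  finally have "\<bar>\<integral>\<omega>. f2 (W \<omega>) - f2 (WA \<omega>) \<partial>M\<bar> \<le> 2 / D * (\<integral>\<omega>. \<bar>E \<omega>\<bar> \<partial>M) + l * m * (\<integral>\<omega>. (W \<omega> - WA \<omega>)\<^sup>2 \<partial>M)"
    using lin rem by linarith
  hence "1 / (l * m) * \<bar>\<integral>\<omega>. f2 (W \<omega>) - f2 (WA \<omega>) \<partial>M\<bar> \<le>
      1 / (l * m) * (2 / D * (\<integral>\<omega>. \<bar>E \<omega>\<bar> \<partial>M) + l * m * (\<integral>\<omega>. (W \<omega> - WA \<omega>)\<^sup>2 \<partial>M))"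
    by (rule mult_left_mono) (use lm in simp)
  also have "\<dots> = 1 / (l * m) * (2 / D) * (\<integral>\<omega>. \<bar>E \<omega>\<bar> \<partial>M) + (\<integral>\<omega>. (W \<omega> - WA \<omega>)\<^sup>2 \<partial>M)"
    using l_pos m_pos by (simp add: distrib_left)
  also have "1 / (l * m) * (2 / D) = (\<sigma>\<^sup>2 - a\<^sup>2) / D"
  proof -
    have "1 / (2 / s) * (2 / D) = s / D" for s :: real by simp
    thus ?thesis unfolding rates(3) .
  qed
  finally have "\<bar>(\<integral>\<omega>. h (W \<omega>) \<partial>M) - (\<integral>\<omega>. h (Z \<omega>) \<partial>N)\<bar> \<le>
      (\<sigma>\<^sup>2 - a\<^sup>2) / D * (\<integral>\<omega>. \<bar>E \<omega>\<bar> \<partial>M) + (\<integral>\<omega>. (W \<omega> - WA \<omega>)\<^sup>2 \<partial>M)"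
    unfolding expectation_diff_W[OF h i2A[unfolded f2_def]] abs_mult[of "1 / (l * m)"] f2_def
    using lm by simp
  thus "ereal \<bar>(\<integral>\<omega>. h (W \<omega>) \<partial>M) - (\<integral>\<omega>. h (Z \<omega>) \<partial>N)\<bar> \<le>
      ereal ((\<sigma>\<^sup>2 - a\<^sup>2) / D * (\<integral>\<omega>. \<bar>cond_exp_given M W (\<lambda>\<omega>'. W \<omega>' - WA \<omega>') \<omega>\<bar> \<partial>M) + (\<integral>\<omega>. (W \<omega> - WA \<omega>)\<^sup>2 \<partial>M))"
    by (simp add: cond_exp_given_def E_def F_def)
qed

end

theorem theorem3p11:
  fixes M :: "'a measure" and N :: "'b measure"
    and W WA :: "'a \<Rightarrow> real" and Z :: "'b \<Rightarrow> real"
    and a \<sigma> :: real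
  assumes "prob_space M" and "prob_space N"
    and "W \<in> borel_measurable M"
    and "integrable M W" and "integrable M (\<lambda>\<omega>. (W \<omega>)\<^sup>2)"
    and "prob_space.expectation M W = a"
    and "prob_space.variance M W = \<sigma>\<^sup>2"
    and "\<sigma>\<^sup>2 > 0" and "\<sigma>\<^sup>2 > a\<^sup>2"
    and "has_asym_equilibrium M W M WA"
    and "asym_laplace_distributed N Z a (sqrt (\<sigma>\<^sup>2 - a\<^sup>2))"
  shows
    "(\<forall>\<beta>>0.
        d_K M W N Z \<le> ereal
          ((14 / sqrt (2 * \<sigma>\<^sup>2 - a\<^sup>2) + 7 * \<bar>a\<bar> / (\<sigma>\<^sup>2 - a\<^sup>2)) * \<beta> +
           (5 + 7 * \<bar>a\<bar> / sqrt (2 * \<sigma>\<^sup>2 - a\<^sup>2)) * \<P>(\<omega> in M. \<bar>W \<omega> - WA \<omega>\<bar> > \<beta>)) \<and>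
        d_K M WA N Z \<le> ereal
          ((2 / sqrt (2 * \<sigma>\<^sup>2 - a\<^sup>2) + 4 * \<bar>a\<bar> / (\<sigma>\<^sup>2 - a\<^sup>2)) * \<beta> +
           (2 + 4 * \<bar>a\<bar> / sqrt (2 * \<sigma>\<^sup>2 - a\<^sup>2)) * \<P>(\<omega> in M. \<bar>W \<omega> - WA \<omega>\<bar> > \<beta>)))
     \<and>
     (\<forall>k::real. k \<ge> 1 \<longrightarrow> integrable M (\<lambda>\<omega>. \<bar>W \<omega>\<bar> powr (k + 2)) \<longrightarrow>
        d_K M W N Z \<le> ereal
          ((14 / sqrt (2 * \<sigma>\<^sup>2 - a\<^sup>2) + 7 * \<bar>a\<bar> / (\<sigma>\<^sup>2 - a\<^sup>2)) powr (k / (k + 1)) *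
           ((k + k powr (- k)) * (5 + 7 * \<bar>a\<bar> / sqrt (2 * \<sigma>\<^sup>2 - a\<^sup>2)) *
            (\<integral>\<omega>. \<bar>W \<omega> - WA \<omega>\<bar> powr k \<partial>M)) powr (1 / (k + 1))))
     \<and>
     (integrable M (\<lambda>\<omega>. \<bar>W \<omega>\<bar> ^ 3) \<longrightarrow>
        d_W M W N Z \<le> ereal (2 * (\<integral>\<omega>. \<bar>W \<omega> - WA \<omega>\<bar> \<partial>M)) \<and>
        d_W M WA N Z \<le> ereal
          ((1 + 2 * \<bar>a\<bar> / sqrt (2 * \<sigma>\<^sup>2 - a\<^sup>2)) * (\<integral>\<omega>. \<bar>W \<omega> - WA \<omega>\<bar> \<partial>M)) \<and>
        d_K M WA N Z \<le> ereal
          ((2 / sqrt (2 * \<sigma>\<^sup>2 - a\<^sup>2) + 4 * \<bar>a\<bar> / (\<sigma>\<^sup>2 - a\<^sup>2)) * (\<integral>\<omega>. \<bar>W \<omega> - WA \<omega>\<bar> \<partial>M)))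
     \<and>
     (integrable M (\<lambda>\<omega>. (W \<omega>) ^ 4) \<longrightarrow>
        d_2 M W N Z \<le> ereal
          ((\<sigma>\<^sup>2 - a\<^sup>2) / sqrt (2 * \<sigma>\<^sup>2 - a\<^sup>2) *
             (\<integral>\<omega>. \<bar>cond_exp_given M W (\<lambda>\<omega>'. W \<omega>' - WA \<omega>') \<omega>\<bar> \<partial>M) +
           (\<integral>\<omega>. (W \<omega> - WA \<omega>)\<^sup>2 \<partial>M)))"
proof -
  interpret asym_equilibrium_coupling M N W WA Z a \<sigma>
    by (rule asym_equilibrium_coupling.intro) (use assms in \<open>auto intro: asym_equilibrium_coupling_axioms.intro\<close>)
  have third: "integrable M (\<lambda>\<omega>. \<bar>WA \<omega>\<bar>)" "integrable M (\<lambda>\<omega>. \<bar>W \<omega> - WA \<omega>\<bar>)"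
    if "integrable M (\<lambda>\<omega>. \<bar>W \<omega>\<bar> ^ 3)"
    using coupling_moment[of 1] that by simp_all
  have fourth: "integrable M (\<lambda>\<omega>. (WA \<omega>)\<^sup>2)" if "integrable M (\<lambda>\<omega>. (W \<omega>) ^ 4)"
    using coupling_moment(1)[of 2] that by simp
  show ?thesis
    unfolding D_def[symmetric]
    using kolmogorov_W_tail kolmogorov_WA_tail kolmogorov_W_moment
      wasserstein_bounds[OF third] kolmogorov_WA_mean[OF third(2)] d_2_bound[OF fourth]
    by blast
qed

end
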